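(* Let $d\in\{1,2,3\}$, $N\ge 1$, let $G=\mathrm{Iso}(\mathbb{E}^d)$ be the group of isometries of $d$-dimensional Euclidean space with neutral element $e$, and let $\mathcal{L}_0\subset G$ be a closed uniformly separated subset. Let $w$ be an equivariant family of coupling matrices that has finite coupling range and depends continuously on the architecture, and for $\mathcal{L}\in\Xi_{\mathcal{L}_0}$ let $$D_{\mathcal{L}}=\sum_{x,x'\in\mathcal{L}}w_{x,x'}(\mathcal{L})\otimes|x\rangle\langle x'|$$ be the associated dynamical matrix on $\mathbb{C}^N\otimes\ell^2(\mathcal{L})=\ell^2(\mathcal{L},\mathbb{C}^N)$. Then: (a) the function $f(g,\mathcal{L}):=w_{g,e}(\mathcal{L})$, $(g,\mathcal{L})\in\mathcal{G}_{\mathcal{L}_0}$, belongs to $C_c(\mathcal{G}_{\mathcal{L}_0},M_N(\mathbb{C}))$, and $D_{\mathcal{L}}=\pi_{\mathcal{L}}(f)$ for every $\mathcal{L}\in\Xi_{\mathcal{L}_0}$; (b) consequently, for every $\mathcal{L}\in\Xi_{\mathcal{L}_0}$, every bounded operator on $\ell^2(\mathcal{L},\mathbb{C}^N)$ that is a limit in operator norm of dynamical matrices $D_{\mathcal{L}}$ coming from such families $w$ belongs to $\pi_{\mathcal{L}}\big(C^*_r(\mathcal{G}_{\mathcal{L}_0},M_N(\mathbb{C}))\big)$.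
   Context: $G=\mathrm{Iso}(\mathbb{E}^d)\cong\mathbb{R}^d\rtimes O(d)$ is a locally compact second countable group. It acts on itself by $g\cdot x:=xg^{-1}$ and on closed subsets by $g\cdot C=\{xg^{-1}:x\in C\}$. A closed subset $\mathcal{L}_0\subset G$ is uniformly separated if there is a nonempty open $U\subseteq G$ with $|\mathcal{L}_0\cap g\cdot U|\le 1$ for all $g\in G$. The space $\mathcal{C}(G)$ of closed subsets of $G$ carries the Fell topology, with subbasis the sets $\{Y: Y\cap K=\emptyset,\ Y\cap F\ne\emptyset\ \forall F\in\mathcal{F}\}$, for $K$ compact and $\mathcal{F}$ a finite family of nonempty open sets. Let $\Omega_{\mathcal{L}_0}=\overline{\{g\cdot\mathcal{L}_0:g\in G\}}\subseteq\mathcal{C}(G)$, $\Omega^\times_{\mathcal{L}_0}=\Omega_{\mathcal{L}_0}\setminus\{\emptyset\}$, and $\Xi_{\mathcal{L}_0}=\{\mathcal{L}\in\Omega_{\mathcal{L}_0}:e\in\mathcal{L}\}$ (a compact space). The canonical groupoid is $\mathcal{G}_{\mathcal{L}_0}=\{(g,\mathcal{L}):\mathcal{L}\in\Xi_{\mathcal{L}_0},\ g\in\mathcal{L}\}\subset G\times\Xi_{\mathcal{L}_0}$ with the subspace topology, inverse $(g,\mathcal{L})^{-1}=(g^{-1},g\cdot\mathcal{L})$, and product $(g',g\cdot\mathcal{L})(g,\mathcal{L})=(g'g,\mathcal{L})$. It is an étale groupoid because $\mathcal{L}_0$ is uniformly separated. Groupoid algebra: $C_c(\mathcal{G}_{\mathcal{L}_0},M_N(\mathbb{C}))$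 (continuous, compactly supported functions) is a $*$-algebra under $$(f_1*f_2)(g,\mathcal{L})=\sum_{g'\in\mathcal{L}}f_1(gg'^{-1},g'\cdot\mathcal{L})\,f_2(g',\mathcal{L}),\qquad f^*(g,\mathcal{L})=f(g^{-1},g\cdot\mathcal{L})^\dagger .$$ It acts by left convolution on the Hilbert $C(\Xi_{\mathcal{L}_0},M_N(\mathbb{C}))$-module $E_{\mathcal{L}_0}$ obtained by completing $C_c(\mathcal{G}_{\mathcal{L}_0},M_N(\mathbb{C}))$ in the inner product $\langle f_1|f_2\rangle(\mathcal{L})=\sum_{g\in\mathcal{L}}f_1(g,\mathcal{L})^\dagger f_2(g,\mathcal{L})$. The reduced groupoid $C^*$-algebra $C^*_r(\mathcal{G}_{\mathcal{L}_0},M_N(\mathbb{C}))$ is the completion of $C_c(\mathcal{G}_{\mathcal{L}_0},M_N(\mathbb{C}))$ in the norm inherited from the adjointable operators on $E_{\mathcal{L}_0}$. Left-regular representations: for $\mathcal{L}\in\Xi_{\mathcal{L}_0}$, $\pi_{\mathcal{L}}$ is the representation of $C^*_r(\mathcal{G}_{\mathcal{L}_0},M_N(\mathbb{C}))$ on $\ell^2(\mathcal{L},\mathbb{C}^N)$ extending by continuity $$[\pi_{\mathcal{L}}(f)\varphi](g')=\sum_{g\in\mathcal{L}}f(g'g^{-1},g\cdot\mathcal{L})\,\varphi(g),\qquad g'\in\mathcal{L},\ f\in C_c(\mathcal{G}_{\mathcal{L}_0},M_N(\mathbb{C})).$$ An equivariant family of coupling matrices $w$ (Galilean invariance) assigns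 to each $\mathcal{L}\in\Omega^\times_{\mathcal{L}_0}$ and $x,x'\in\mathcal{L}$ a matrix $w_{x,x'}(\mathcal{L})\in M_N(\mathbb{C})$ such that $w_{g\cdot x,g\cdot x'}(g\cdot\mathcal{L})=w_{x,x'}(\mathcal{L})$ for all $g\in G$. It has finite coupling range if there is a compact neighborhood $K$ of $e$ in $G$ such that $w_{x,x'}(\mathcal{L})=0$ whenever $x'\cdot x=xx'^{-1}\notin K$. It depends continuously on the architecture if $(g,\mathcal{L})\mapsto w_{g,e}(\mathcal{L})$ is continuous on $\mathcal{G}_{\mathcal{L}_0}$. *)

theory Defs
  imports "HOL-Analysis.Analysis"
begin

section \<open>The isometry group of Euclidean space\<close>

type_synonym 'd emap = "real ^ 'd \<Rightarrow> real ^ 'd"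

text \<open>
  The group operations are composition \<open>g \<circ> h\<close>, inversion \<open>inv g\<close> and the
  neutral element \<open>id\<close>.
\<close>

definition isoE :: "('d::finite) emap set" where
  "isoE = {g. bij g \<and> (\<forall>x y. dist (g x) (g y) = dist x y)}"

text \<open>
  An isometry is \<open>x \<mapsto> v + Q x\<close> with \<open>v = g 0\<close> and \<open>Q\<close> an orthogonal matrix;
  \<open>g \<mapsto> (v, Q)\<close> is the identification with the semidirect product of the translations
  by the orthogonal group, whose topology is transported to \<open>isoE\<close>.
\<close>

definition isoE_top :: "('d::finite) emap topology" where
  "isoE_top = pullback_topology isoE (\<lambda>g. (g 0, matrix (\<lambda>x. g x - g 0))) euclidean"

definition act :: "('d::finite) emap \<Rightarrow> 'd emap \<Rightarrow> 'd emap" where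
  "act g x = x \<circ> inv g"

definition act_set :: "('d::finite) emap \<Rightarrow> 'd emap set \<Rightarrow> 'd emap set" where
  "act_set g C = act g ` C"

definition uniformly_separated :: "('d::finite) emap set \<Rightarrow> bool" where
  "uniformly_separated L0 \<longleftrightarrow>
     (\<exists>U. openin isoE_top U \<and> U \<noteq> {} \<and>
        (\<forall>g\<in>isoE. finite (L0 \<inter> act_set g U) \<and> card (L0 \<inter> act_set g U) \<le> 1))"


section \<open>Fell topology, hull and transversal\<close>

text \<open>Taking \<open>K\<close> and \<open>\<F>\<close> empty shows that the underlying set consists of all closed subsets.\<close>

definition fell_topology :: "'a topology \<Rightarrow> 'a set topology" where
  "fell_topology X = topology_generated_by
     {{Y. closedin X Y \<and> Y \<inter> K = {} \<and> (\<forall>F\<in>\<F>. Y \<inter> F \<noteq> {})} | K \<F>.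
        compactin X K \<and> finite \<F> \<and> (\<forall>F\<in>\<F>. openin X F \<and> F \<noteq> {})}"

definition dynamical_hull :: "('d::finite) emap set \<Rightarrow> 'd emap set set" where
  "dynamical_hull L0 = fell_topology isoE_top closure_of {act_set g L0 | g. g \<in> isoE}"

definition punctured_hull :: "('d::finite) emap set \<Rightarrow> 'd emap set set" where
  "punctured_hull L0 = dynamical_hull L0 - {{}}"

definition transversal :: "('d::finite) emap set \<Rightarrow> 'd emap set set" where
  "transversal L0 = {L \<in> dynamical_hull L0. id \<in> L}"


section \<open>The canonical groupoid and its algebra\<close>

definition groupoid :: "('d::finite) emap set \<Rightarrow> ('d emap \<times> 'd emap set) set" where
  "groupoid L0 = {(g, L). L \<in> transversal L0 \<and> g \<in> L}"

definition groupoid_top :: "('d::finite) emap set \<Rightarrow> ('d emap \<times> 'd emap set) topology" where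
  "groupoid_top L0 =
     subtopology (prod_topology isoE_top (subtopology (fell_topology isoE_top) (transversal L0)))
       (groupoid L0)"

text \<open>
  A function on the groupoid is represented by its extension by zero, so that equality of
  functions on the groupoid is equality in HOL.
\<close>

definition Cc ::
  "('d::finite) emap set \<Rightarrow> ('d emap \<times> 'd emap set \<Rightarrow> complex ^ 'n ^ 'n) set" where
  "Cc L0 = {f. (\<forall>p. p \<notin> groupoid L0 \<longrightarrow> f p = 0) \<and>
               continuous_map (groupoid_top L0) euclidean f \<and>
               compactin (groupoid_top L0) (groupoid_top L0 closure_of {p. f p \<noteq> 0})}"

definition dagger :: "complex ^ 'n ^ 'n \<Rightarrow> complex ^ 'n ^ ('n::finite)" where
  "dagger A = (\<chi> i j. cnj (A $ j $ i))"

definition conv ::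
  "('d::finite) emap set \<Rightarrow> ('d emap \<times> 'd emap set \<Rightarrow> complex ^ 'n ^ 'n) \<Rightarrow>
   ('d emap \<times> 'd emap set \<Rightarrow> complex ^ 'n ^ 'n) \<Rightarrow>
   ('d emap \<times> 'd emap set \<Rightarrow> complex ^ 'n ^ ('n::finite))" where
  "conv L0 f1 f2 = (\<lambda>(g, L). if (g, L) \<in> groupoid L0
     then \<Sum>\<^sub>\<infinity>g'\<in>L. f1 (g \<circ> inv g', act_set g' L) ** f2 (g', L) else 0)"


section \<open>Completions and operator norms\<close>

text \<open>
  The completion of a space \<open>V\<close> with (semi)norm \<open>p\<close> consists of the Cauchy sequences
  in \<open>V\<close> modulo the sequences tending to zero.
\<close>

definition cauchy_seqs :: "'v::minus set \<Rightarrow> ('v \<Rightarrow> real) \<Rightarrow> (nat \<Rightarrow> 'v) set" where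
  "cauchy_seqs V p = {s. range s \<subseteq> V \<and>
     (\<forall>\<epsilon>>0. \<exists>M. \<forall>m\<ge>M. \<forall>n\<ge>M. p (s m - s n) < \<epsilon>)}"

definition null_rel ::
  "'v::minus set \<Rightarrow> ('v \<Rightarrow> real) \<Rightarrow> ((nat \<Rightarrow> 'v) \<times> (nat \<Rightarrow> 'v)) set" where
  "null_rel V p = {(s, t). s \<in> cauchy_seqs V p \<and> t \<in> cauchy_seqs V p \<and>
     (\<lambda>n. p (s n - t n)) \<longlonglongrightarrow> 0}"

definition completion :: "'v::minus set \<Rightarrow> ('v \<Rightarrow> real) \<Rightarrow> (nat \<Rightarrow> 'v) set set" where
  "completion V p = cauchy_seqs V p // null_rel V p"

definition completion_norm :: "('v::minus \<Rightarrow> real) \<Rightarrow> (nat \<Rightarrow> 'v) set \<Rightarrow> real" where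
  "completion_norm p X = (THE r. \<forall>s\<in>X. (\<lambda>n. p (s n)) \<longlonglongrightarrow> r)"

text \<open>Like \<open>onorm\<close>, this is only meaningful for bounded operators.\<close>

definition op_norm_on :: "'v set \<Rightarrow> ('v \<Rightarrow> real) \<Rightarrow> ('v \<Rightarrow> 'w) \<Rightarrow> ('w \<Rightarrow> real) \<Rightarrow> real" where
  "op_norm_on V p T q = Sup {q (T v) | v. v \<in> V \<and> p v \<le> 1}"


section \<open>The Hilbert module and the reduced groupoid C*-algebra\<close>

definition mod_inner ::
  "('d emap \<times> 'd emap set \<Rightarrow> complex ^ 'n ^ 'n) \<Rightarrow>
   ('d emap \<times> 'd emap set \<Rightarrow> complex ^ 'n ^ 'n) \<Rightarrow>
   ('d::finite) emap set \<Rightarrow> complex ^ 'n ^ ('n::finite)" where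
  "mod_inner f1 f2 L = (\<Sum>\<^sub>\<infinity>g\<in>L. dagger (f1 (g, L)) ** f2 (g, L))"

text \<open>
  The C*-norm of a matrix \<open>A\<close> is \<open>onorm ((*v) A)\<close> (the norm of the type
  \<open>complex ^ 'n ^ 'n\<close> is the Frobenius norm). Inserting 0 only matters when the
  transversal is empty.
\<close>

definition unif_norm ::
  "('d::finite) emap set \<Rightarrow> ('d emap set \<Rightarrow> complex ^ 'n ^ ('n::finite)) \<Rightarrow> real" where
  "unif_norm L0 h = Sup (insert 0 ((\<lambda>L. onorm ((*v) (h L))) ` transversal L0))"

definition mod_norm ::
  "('d::finite) emap set \<Rightarrow> ('d emap \<times> 'd emap set \<Rightarrow> complex ^ 'n ^ ('n::finite)) \<Rightarrow> real" where
  "mod_norm L0 f = sqrt (unif_norm L0 (mod_inner f f))"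

definition hilbert_module ::
  "('d::finite) emap set \<Rightarrow>
   (nat \<Rightarrow> 'd emap \<times> 'd emap set \<Rightarrow> complex ^ 'n ^ ('n::finite)) set set" where
  "hilbert_module L0 = completion (Cc L0) (mod_norm L0)"

text \<open>Left convolution by \<open>f\<close> on the completion: the class of \<open>s\<close> goes to the class of \<open>f * s\<close>.\<close>

definition conv_op ::
  "('d::finite) emap set \<Rightarrow> ('d emap \<times> 'd emap set \<Rightarrow> complex ^ 'n ^ 'n) \<Rightarrow>
   (nat \<Rightarrow> 'd emap \<times> 'd emap set \<Rightarrow> complex ^ 'n ^ 'n) set \<Rightarrow>
   (nat \<Rightarrow> 'd emap \<times> 'd emap set \<Rightarrow> complex ^ 'n ^ ('n::finite)) set" where
  "conv_op L0 f X = null_rel (Cc L0) (mod_norm L0) `` ((\<lambda>s n. conv L0 f (s n)) ` X)"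

text \<open>The norm of the algebra of adjointable operators is the operator norm.\<close>

definition reduced_norm ::
  "('d::finite) emap set \<Rightarrow> ('d emap \<times> 'd emap set \<Rightarrow> complex ^ 'n ^ ('n::finite)) \<Rightarrow> real" where
  "reduced_norm L0 f =
     op_norm_on (hilbert_module L0) (completion_norm (mod_norm L0)) (conv_op L0 f)
       (completion_norm (mod_norm L0))"

definition reduced_cstar ::
  "('d::finite) emap set \<Rightarrow>
   (nat \<Rightarrow> 'd emap \<times> 'd emap set \<Rightarrow> complex ^ 'n ^ ('n::finite)) set set" where
  "reduced_cstar L0 = completion (Cc L0) (reduced_norm L0)"


section \<open>Bounded operators on \<open>\<ell>\<^sup>2(L, \<complex>\<^sup>N)\<close> and the left-regular representations\<close>

definition ell2 :: "'a set \<Rightarrow> ('a \<Rightarrow> complex ^ ('n::finite)) set" where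
  "ell2 L = {\<phi>. (\<forall>x. x \<notin> L \<longrightarrow> \<phi> x = 0) \<and> (\<lambda>x. (norm (\<phi> x))\<^sup>2) summable_on L}"

definition ell2_norm :: "'a set \<Rightarrow> ('a \<Rightarrow> complex ^ ('n::finite)) \<Rightarrow> real" where
  "ell2_norm L \<phi> = sqrt (\<Sum>\<^sub>\<infinity>x\<in>L. (norm (\<phi> x))\<^sup>2)"

definition bounded_ops ::
  "'a set \<Rightarrow> (('a \<Rightarrow> complex ^ 'n) \<Rightarrow> ('a \<Rightarrow> complex ^ ('n::finite))) set" where
  "bounded_ops L = {T \<in> ell2 L \<rightarrow>\<^sub>E ell2 L.
     (\<forall>\<phi>\<in>ell2 L. \<forall>\<psi>\<in>ell2 L. T (\<lambda>x. \<phi> x + \<psi> x) = (\<lambda>x. T \<phi> x + T \<psi> x)) \<and>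
     (\<forall>c. \<forall>\<phi>\<in>ell2 L. T (\<lambda>x. c *s \<phi> x) = (\<lambda>x. c *s T \<phi> x)) \<and>
     (\<exists>B. \<forall>\<phi>\<in>ell2 L. ell2_norm L (T \<phi>) \<le> B * ell2_norm L \<phi>)}"

definition tends_in_op_norm ::
  "'a set \<Rightarrow> (nat \<Rightarrow> ('a \<Rightarrow> complex ^ 'n) \<Rightarrow> ('a \<Rightarrow> complex ^ 'n)) \<Rightarrow>
   (('a \<Rightarrow> complex ^ 'n) \<Rightarrow> ('a \<Rightarrow> complex ^ ('n::finite))) \<Rightarrow> bool" where
  "tends_in_op_norm L S T \<longleftrightarrow>
     (\<lambda>n. op_norm_on (ell2 L) (ell2_norm L) (S n - T) (ell2_norm L)) \<longlonglongrightarrow> 0"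

definition left_regular ::
  "('d::finite) emap set \<Rightarrow> ('d emap \<times> 'd emap set \<Rightarrow> complex ^ 'n ^ 'n) \<Rightarrow>
   ('d emap \<Rightarrow> complex ^ 'n) \<Rightarrow> ('d emap \<Rightarrow> complex ^ ('n::finite))" where
  "left_regular L f = (\<lambda>\<phi>\<in>ell2 L. \<lambda>g'. if g' \<in> L
     then \<Sum>\<^sub>\<infinity>g\<in>L. f (g' \<circ> inv g, act_set g L) *v \<phi> g else 0)"

text \<open>
  The extension by continuity: an element \<open>X\<close> of the completion, that is, a class of Cauchy
  sequences \<open>s\<close>, is sent to the limit in operator norm of the \<open>left_regular L (s n)\<close>.
\<close>

definition left_regular_ext ::
  "('d::finite) emap set \<Rightarrow>
   (nat \<Rightarrow> 'd emap \<times> 'd emap set \<Rightarrow> complex ^ 'n ^ 'n) set \<Rightarrow>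
   ('d emap \<Rightarrow> complex ^ 'n) \<Rightarrow> ('d emap \<Rightarrow> complex ^ ('n::finite))" where
  "left_regular_ext L X = (THE T. T \<in> bounded_ops L \<and>
     (\<forall>s\<in>X. tends_in_op_norm L (\<lambda>n. left_regular L (s n)) T))"


section \<open>Coupling matrices and dynamical matrices\<close>

text \<open>
  \<open>w L x x'\<close> stands for the coupling matrix with indices \<open>x\<close>, \<open>x'\<close> of the architecture
  \<open>L\<close>; only the values for \<open>L\<close> in the punctured hull and \<open>x\<close>, \<open>x'\<close> in \<open>L\<close> matter.
\<close>

type_synonym ('d, 'n) coupling =
  "'d emap set \<Rightarrow> 'd emap \<Rightarrow> 'd emap \<Rightarrow> complex ^ 'n ^ 'n"

definition equivariant :: "('d::finite) emap set \<Rightarrow> ('d, 'n::finite) coupling \<Rightarrow> bool" where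
  "equivariant L0 w \<longleftrightarrow>
     (\<forall>g\<in>isoE. \<forall>L\<in>punctured_hull L0. \<forall>x\<in>L. \<forall>x'\<in>L.
        w (act_set g L) (act g x) (act g x') = w L x x')"

definition finite_range :: "('d::finite) emap set \<Rightarrow> ('d, 'n::finite) coupling \<Rightarrow> bool" where
  "finite_range L0 w \<longleftrightarrow>
     (\<exists>K. compactin isoE_top K \<and> (\<exists>U. openin isoE_top U \<and> id \<in> U \<and> U \<subseteq> K) \<and>
        (\<forall>L\<in>punctured_hull L0. \<forall>x\<in>L. \<forall>x'\<in>L. act x' x \<notin> K \<longrightarrow> w L x x' = 0))"

definition continuous_coupling ::
  "('d::finite) emap set \<Rightarrow> ('d, 'n::finite) coupling \<Rightarrow> bool" where
  "continuous_coupling L0 w \<longleftrightarrow>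
     continuous_map (groupoid_top L0) euclidean (\<lambda>(g, L). w L g id)"

definition admissible_coupling ::
  "('d::finite) emap set \<Rightarrow> ('d, 'n::finite) coupling \<Rightarrow> bool" where
  "admissible_coupling L0 w \<longleftrightarrow>
     equivariant L0 w \<and> finite_range L0 w \<and> continuous_coupling L0 w"

definition coupling_fun ::
  "('d::finite) emap set \<Rightarrow> ('d, 'n::finite) coupling \<Rightarrow>
   ('d emap \<times> 'd emap set \<Rightarrow> complex ^ 'n ^ 'n)" where
  "coupling_fun L0 w = (\<lambda>(g, L). if (g, L) \<in> groupoid L0 then w L g id else 0)"

text \<open>The operator \<open>A \<otimes> |x\<rangle>\<langle>x'|\<close>.\<close>

definition ketbra ::
  "complex ^ 'n ^ 'n \<Rightarrow> 'a \<Rightarrow> 'a \<Rightarrow> ('a \<Rightarrow> complex ^ 'n) \<Rightarrow> ('a \<Rightarrow> complex ^ ('n::finite))" where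
  "ketbra A x x' \<phi> = (\<lambda>y. if y = x then A *v \<phi> x' else 0)"

text \<open>The series is summed entrywise; for a coupling of finite range every entry is a finite sum.\<close>

definition dynamical_matrix ::
  "('d, 'n) coupling \<Rightarrow> ('d::finite) emap set \<Rightarrow>
   ('d emap \<Rightarrow> complex ^ 'n) \<Rightarrow> ('d emap \<Rightarrow> complex ^ ('n::finite))" where
  "dynamical_matrix w L = (\<lambda>\<phi>\<in>ell2 L. \<lambda>y.
     \<Sum>\<^sub>\<infinity>(x, x')\<in>L \<times> L. ketbra (w L x x') x x' \<phi> y)"

end

theory Submission
  imports Defs
begin

text \<open>
  A function \<open>f\<close> on the groupoid amounts to an equivariant family of kernels
  \<open>f (x \<circ> inv y, act_set y L)\<close> on \<open>L \<times> L\<close>. For the function of a coupling this is the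
  coupling itself, by equivariance. Uniform separation passes to the hull, so kernels of compactly
  supported functions have uniformly few entries in every row and column; sums over architectures
  are therefore continuous and the operators are bounded by Schur's test. The norm of the reduced
  C*-algebra is the supremum of the operator norms over the transversal, because every finitely
  supported vector over \<open>L\<close> extends to an element of the Hilbert module of the same norm.

  A limit in the norm over a single \<open>L\<close> must be lifted to a sequence that is Cauchy over the whole
  transversal. Instead of quotients of C*-algebras this uses the cubic map
  \<open>a \<mapsto> a - a a\<^sup>* a / (3 R\<^sup>2)\<close>: it reduces a norm \<open>R\<close> over the transversal to
  \<open>2 R / 3\<close> and moves an operator of norm \<open>e\<close> over \<open>L\<close> by at most \<open>e\<^sup>3 / (3 R\<^sup>2)\<close>.
  Iterating it yields an element of norm at most \<open>2 e\<close> over the transversal at distance at most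
  \<open>e / 15\<close> over \<open>L\<close>, and successive corrections converge geometrically.
\<close>


text \<open>The obstacle in (b): the approximants come from unrelated couplings, and closeness over
  one \<open>L\<close> says nothing about other architectures, whereas \<open>reduced_cstar\<close>
  only admits sequences that are Cauchy over the whole transversal. The textbook argument, that a
  representation is isometric modulo its kernel, uses functional calculus in the completed algebra.
  A polynomial in \<open>a\<close> and \<open>a\<^sup>*\<close> stays inside \<open>Cc\<close>, and
  one and the same polynomial acts over all architectures at once. The cubic
  \<open>x - x^3 / (3 R^2)\<close> is increasing on \<open>[0, R]\<close>, has derivative 0 at
  \<open>R\<close> and there takes its maximum \<open>2 R / 3\<close>, while near 0 it is the
  identity up to third order. Run at the levels \<open>R = 2 e (3/2)^j\<close> with
  \<open>j = k, ..., 1\<close>, it moves the operator over \<open>L\<close> by at most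
  \<open>e / 12 (4/9)^j\<close> each time, and the sum of these stays below \<open>e / 15\<close>.
  All operator estimates are made on finitely supported vectors with the real part of the inner
  product, where they become finite identities between quadratic forms; truncation then carries them
  to all of \<open>ell2 L\<close>.\<close>

lemma continuous_map_euclidean_iff_tendsto:
  "continuous_map X euclidean f \<longleftrightarrow> (\<forall>x\<in>topspace X. (f \<longlongrightarrow> f x) (atin X x))"
  by (simp add: continuous_map_atin)

lemma tendsto_matrix_vector_mult:
  fixes A :: "'a \<Rightarrow> ('f::real_normed_algebra_1) ^ 'n ^ 'm"
  assumes "(A \<longlongrightarrow> a) F" "(u \<longlongrightarrow> b) F"
  shows "((\<lambda>z. A z *v u z) \<longlongrightarrow> a *v b) F"
  unfolding matrix_vector_mult_def
  by (intro tendsto_intros assms)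

lemma tendsto_matrix_matrix_mult:
  fixes A :: "'a \<Rightarrow> ('f::real_normed_algebra_1) ^ 'n ^ 'm" and B :: "'a \<Rightarrow> 'f ^ 'k ^ 'n"
  assumes "(A \<longlongrightarrow> a) F" "(B \<longlongrightarrow> b) F"
  shows "((\<lambda>z. A z ** B z) \<longlongrightarrow> a ** b) F"
  unfolding matrix_matrix_mult_def
  by (intro tendsto_intros assms)

lemma tendsto_dagger:
  assumes "(A \<longlongrightarrow> a) F"
  shows "((\<lambda>z. dagger (A z)) \<longlongrightarrow> dagger a) F"
  unfolding dagger_def
  by (intro tendsto_intros assms)


section \<open>The isometry group\<close>

text \<open>This names the map along which \<open>isoE_top\<close> is pulled back. Its values lie in
  a Euclidean space, so neighbourhoods in the group can be taken to be balls in these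
  coordinates.\<close>

definition iso_coord :: "('d::finite) emap \<Rightarrow> (real ^ 'd) \<times> (real ^ 'd ^ 'd)" where
  "iso_coord g = (g 0, matrix (\<lambda>x. g x - g 0))"

lemma isoE_bij: "g \<in> isoE \<Longrightarrow> bij g"
  and isoE_dist: "g \<in> isoE \<Longrightarrow> dist (g x) (g y) = dist x y"
  by (auto simp: isoE_def)

text \<open>An isometry of Euclidean space that fixes the origin is linear, and subtracting
  \<open>g 0\<close> produces one.\<close>

lemma isoE_orthogonal:
  assumes "g \<in> isoE"
  shows "orthogonal_transformation (\<lambda>x. g x - g 0)"
  using isoE_dist[OF assms] by (simp add: orthogonal_transformation_isometry dist_norm)

lemma isoE_affine:
  assumes "g \<in> isoE"
  shows "g x = g 0 + matrix (\<lambda>x. g x - g 0) *v x"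
  using orthogonal_transformation_linear[OF isoE_orthogonal[OF assms]]
  by (simp add: matrix_works)

lemma isoE_id [simp]: "id \<in> isoE"
  by (simp add: isoE_def)

lemma isoE_comp [simp]: "g \<in> isoE \<Longrightarrow> h \<in> isoE \<Longrightarrow> g \<circ> h \<in> isoE"
  by (auto simp: isoE_def intro: bij_comp)

lemma isoE_inv [simp]:
  assumes "g \<in> isoE"
  shows "inv g \<in> isoE"
proof -
  have b: "bij g" using assms by (rule isoE_bij)
  have "dist (inv g x) (inv g y) = dist x y" for x y
    using isoE_dist[OF assms, of "inv g x" "inv g y"] b by (simp add: bij_is_surj surj_f_inv_f)
  then show ?thesis using b by (simp add: isoE_def bij_imp_bij_inv)
qed

lemma isoE_inv_comp [simp]: "g \<in> isoE \<Longrightarrow> inv g \<circ> g = id"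
  and isoE_comp_inv [simp]: "g \<in> isoE \<Longrightarrow> g \<circ> inv g = id"
  using isoE_bij[of g] by (auto simp: bij_is_inj bij_is_surj simp flip: surj_iff)

lemma isoE_inv_inv [simp]: "g \<in> isoE \<Longrightarrow> inv (inv g) = g"
  by (simp add: isoE_bij inv_inv_eq)

lemma isoE_inv_comp_distrib: "g \<in> isoE \<Longrightarrow> h \<in> isoE \<Longrightarrow> inv (g \<circ> h) = inv h \<circ> inv g"
  by (simp add: isoE_bij o_inv_distrib)

lemma isoE_cancel [simp]:
  assumes "h \<in> isoE"
  shows "g \<circ> h \<circ> inv h = g" "g \<circ> inv h \<circ> h = g" "h \<circ> (inv h \<circ> g) = g" "inv h \<circ> (h \<circ> g) = g"
  using assms by (simp_all add: comp_assoc) (simp_all flip: comp_assoc)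

lemma topspace_isoE [simp]: "topspace isoE_top = isoE"
  by (auto simp: isoE_top_def topspace_pullback_topology)

lemma isoE_top_eq: "isoE_top = pullback_topology isoE iso_coord euclidean"
  by (simp add: isoE_top_def iso_coord_def[abs_def])

lemma iso_coord_continuous: "continuous_map isoE_top euclidean iso_coord"
  using continuous_map_pullback[of euclidean euclidean id isoE iso_coord]
  by (simp add: isoE_top_eq)

lemma iso_coord_inj: "inj_on iso_coord isoE"
proof (rule inj_onI)
  fix g h :: "'a emap"
  assume g: "g \<in> isoE" and h: "h \<in> isoE" and "iso_coord g = iso_coord h"
  then have "g 0 = h 0" "matrix (\<lambda>x. g x - g 0) = matrix (\<lambda>x. h x - h 0)"
    unfolding iso_coord_def by blast+
  then show "g = h"
    using isoE_affine[OF g] isoE_affine[OF h] by (metis ext)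
qed

lemma continuous_map_isoE_coord:
  "continuous_map X isoE_top h \<longleftrightarrow>
     h \<in> topspace X \<rightarrow> isoE \<and> continuous_map X euclidean (iso_coord \<circ> h)"
proof
  assume h: "continuous_map X isoE_top h"
  then have "h \<in> topspace X \<rightarrow> isoE" using continuous_map_funspace by fastforce
  then show "h \<in> topspace X \<rightarrow> isoE \<and> continuous_map X euclidean (iso_coord \<circ> h)"
    using continuous_map_compose[OF h iso_coord_continuous] by blast
next
  assume "h \<in> topspace X \<rightarrow> isoE \<and> continuous_map X euclidean (iso_coord \<circ> h)"
  then show "continuous_map X isoE_top h"
    unfolding isoE_top_eq by (intro continuous_map_pullback') auto
qed

lemma continuous_map_eval:
  assumes "continuous_map X isoE_top h" and "continuous_map X euclidean v"
  shows "continuous_map X euclidean (\<lambda>z. h z (v z))"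
proof -
  have h: "h \<in> topspace X \<rightarrow> isoE" and c: "continuous_map X euclidean (iso_coord \<circ> h)"
    using assms(1) by (auto simp: continuous_map_isoE_coord)
  have "continuous_map X euclidean (\<lambda>z. fst (iso_coord (h z)) + snd (iso_coord (h z)) *v v z)"
    using c assms(2) unfolding continuous_map_euclidean_iff_tendsto
    by (auto intro!: tendsto_intros tendsto_matrix_vector_mult simp: o_def)
  then show ?thesis
  proof (rule continuous_map_eq)
    fix z assume "z \<in> topspace X"
    then have "h z \<in> isoE" using h by auto
    then show "fst (iso_coord (h z)) + snd (iso_coord (h z)) *v v z = h z (v z)"
      using isoE_affine[of "h z" "v z"] by (simp add: iso_coord_def)
  qed
qed

text \<open>The columns of the linear part are the vectors \<open>g (axis i 1) - g 0\<close>, so the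
  topology is that of pointwise convergence. Composition and inversion can then be treated one
  vector at a time.\<close>

lemma continuous_map_into_isoE:
  "continuous_map X isoE_top h \<longleftrightarrow>
     h \<in> topspace X \<rightarrow> isoE \<and> (\<forall>v. continuous_map X euclidean (\<lambda>z. h z v))"
proof
  assume "continuous_map X isoE_top h"
  then show "h \<in> topspace X \<rightarrow> isoE \<and> (\<forall>v. continuous_map X euclidean (\<lambda>z. h z v))"
    using continuous_map_eval[of X h] continuous_map_isoE_coord[of X h]
    by (simp add: continuous_map_canonical_const)
next
  assume *: "h \<in> topspace X \<rightarrow> isoE \<and> (\<forall>v. continuous_map X euclidean (\<lambda>z. h z v))"
  then have "continuous_map X euclidean (\<lambda>z. iso_coord (h z))"
    unfolding continuous_map_euclidean_iff_tendsto iso_coord_def matrix_def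
    by (auto intro!: tendsto_intros)
  then show "continuous_map X isoE_top h"
    using * by (simp add: continuous_map_isoE_coord o_def)
qed

lemma continuous_map_isoE_comp:
  assumes "continuous_map X isoE_top g" and "continuous_map X isoE_top h"
  shows "continuous_map X isoE_top (\<lambda>z. g z \<circ> h z)"
proof -
  have "(\<lambda>z. g z \<circ> h z) \<in> topspace X \<rightarrow> isoE"
    using assms unfolding continuous_map_isoE_coord by (auto intro!: isoE_comp)
  then show ?thesis
    using continuous_map_eval[OF assms(1)] assms(2) by (auto simp: continuous_map_into_isoE)
qed

text \<open>Since \<open>g z\<close> preserves distances, \<open>inv (g z) v\<close> is as far from
  \<open>u = inv (g z0) v\<close> as \<open>g z u\<close> is from \<open>v\<close>, and the latter
  distance tends to 0 by continuity of evaluation at the fixed point \<open>u\<close>.\<close>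

lemma continuous_map_isoE_inv:
  assumes "continuous_map X isoE_top g"
  shows "continuous_map X isoE_top (\<lambda>z. inv (g z))"
proof -
  have g: "g \<in> topspace X \<rightarrow> isoE" and c: "continuous_map X euclidean (\<lambda>z. g z v)" for v
    using assms unfolding continuous_map_into_isoE by auto
  have "continuous_map X euclidean (\<lambda>z. inv (g z) v)" for v
    unfolding continuous_map_euclidean_iff_tendsto
  proof
    fix z0 assume z0: "z0 \<in> topspace X"
    define u where "u = inv (g z0) v"
    have "g z0 u = v"
      using g z0 isoE_bij unfolding u_def by (metis PiE bij_is_surj surj_f_inv_f)
    have "((\<lambda>z. g z u) \<longlongrightarrow> v) (atin X z0)"
      using c[of u] z0 \<open>g z0 u = v\<close> unfolding continuous_map_euclidean_iff_tendsto by auto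
    then have "((\<lambda>z. dist (g z u) v) \<longlongrightarrow> 0) (atin X z0)"
      by (rule iffD1[OF tendsto_dist_iff])
    moreover have "\<forall>\<^sub>F z in atin X z0. z \<in> topspace X"
      using z0 openin_topspace by (fastforce simp: eventually_atin)
    then have "\<forall>\<^sub>F z in atin X z0. dist (g z u) v = dist (inv (g z) v) u"
    proof (eventually_elim)
      case (elim z)
      then have gz: "g z \<in> isoE" using g by auto
      then have "dist (g z u) v = dist (g z u) (g z (inv (g z) v))"
        using isoE_bij by (metis bij_is_surj surj_f_inv_f)
      then show ?case using isoE_dist[OF gz] by (simp add: dist_commute)
    qed
    ultimately have "((\<lambda>z. dist (inv (g z) v) u) \<longlongrightarrow> 0) (atin X z0)"
      using Lim_transform_eventually by fastforce
    then show "((\<lambda>z. inv (g z) v) \<longlongrightarrow> inv (g z0) v) (atin X z0)"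
      unfolding u_def by (rule iffD2[OF tendsto_dist_iff])
  qed
  then show ?thesis
    using g by (auto simp: continuous_map_into_isoE intro!: isoE_inv)
qed

lemma iso_coord_image:
  "iso_coord ` isoE = UNIV \<times> {Q :: real ^ 'd ^ ('d::finite). orthogonal_matrix Q}"
proof (intro set_eqI iffI)
  fix p assume "p \<in> iso_coord ` (isoE :: 'd emap set)"
  then obtain g where "g \<in> isoE" "p = iso_coord g" by blast
  then show "p \<in> UNIV \<times> {Q. orthogonal_matrix Q}"
    using isoE_orthogonal[of g] by (simp add: iso_coord_def orthogonal_transformation_matrix)
next
  fix p :: "(real ^ 'd) \<times> (real ^ 'd ^ 'd)"
  assume "p \<in> UNIV \<times> {Q. orthogonal_matrix Q}"
  then obtain v Q where p: "p = (v, Q)" "orthogonal_matrix Q" by auto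
  define g where "g x = v + Q *v x" for x
  have o: "orthogonal_transformation ((*v) Q)"
    using p(2) by (simp add: orthogonal_transformation_matrix)
  have "bij ((*v) Q)" using o by (rule orthogonal_transformation_bij)
  moreover have "g = (+) v \<circ> (*v) Q" by (auto simp: g_def)
  ultimately have "bij g" by (simp add: bij_comp)
  moreover have "dist (g x) (g y) = dist x y" for x y
    using o by (simp add: g_def orthogonal_transformation_isometry)
  ultimately have "g \<in> isoE" by (simp add: isoE_def)
  moreover have "iso_coord g = p" by (simp add: iso_coord_def g_def p)
  ultimately show "p \<in> iso_coord ` isoE" by blast
qed

text \<open>A closed image gives the Heine-Borel property in the group: closed coordinate balls are
  compact. This is the source of local compactness.\<close>

lemma closed_iso_coord_image: "closed (iso_coord ` (isoE :: ('d::finite) emap set))"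
proof -
  have "closed {Q :: real ^ 'd ^ 'd. orthogonal_matrix Q}"
    unfolding orthogonal_matrix transpose_def matrix_matrix_mult_def
    by (intro closed_Collect_eq continuous_intros)
  then show ?thesis by (simp add: iso_coord_image closed_Times)
qed

lemma isoE_embedding: "embedding_map (isoE_top :: ('d::finite) emap topology) euclidean iso_coord"
proof -
  define f where "f = inv_into (isoE :: 'd emap set) iso_coord"
  have "continuous_map (subtopology euclidean (iso_coord ` isoE)) isoE_top f"
    unfolding continuous_map_isoE_coord
  proof
    show "f \<in> topspace (subtopology euclidean (iso_coord ` isoE)) \<rightarrow> isoE"
      by (auto simp: f_def inv_into_into)
    show "continuous_map (subtopology euclidean (iso_coord ` isoE)) euclidean (iso_coord \<circ> f)"
      by (rule continuous_map_eq[where f = id]) (auto simp: f_def f_inv_into_f)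
  qed
  then have "homeomorphic_maps isoE_top (subtopology euclidean (iso_coord ` isoE)) iso_coord f"
    using iso_coord_continuous inv_into_f_f[OF iso_coord_inj]
    by (auto simp: homeomorphic_maps_def continuous_map_in_subtopology f_def f_inv_into_f)
  then show ?thesis
    unfolding embedding_map_def homeomorphic_map_maps topspace_isoE by blast
qed

lemma compactin_isoE: "compactin isoE_top K \<longleftrightarrow> K \<subseteq> isoE \<and> compact (iso_coord ` K)"
proof
  assume "compactin isoE_top K"
  then show "K \<subseteq> isoE \<and> compact (iso_coord ` K)"
    using compactin_subset_topspace image_compactin[OF _ iso_coord_continuous] by fastforce
next
  assume K: "K \<subseteq> isoE \<and> compact (iso_coord ` K)"
  have "homeomorphic_map isoE_top (subtopology euclidean (iso_coord ` isoE)) iso_coord"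
    using isoE_embedding by (simp add: embedding_map_def)
  moreover have "compactin (subtopology euclidean (iso_coord ` isoE)) (iso_coord ` K)"
    using K by (auto simp: compactin_subtopology)
  ultimately show "compactin isoE_top K"
    using K homeomorphic_map_compactness[of isoE_top _ iso_coord K] by auto
qed

lemma Hausdorff_isoE [simp]: "Hausdorff_space isoE_top"
  using embedding_map_imp_homeomorphic_space[OF isoE_embedding] homeomorphic_Hausdorff_space
    Hausdorff_space_subtopology Hausdorff_space_euclidean by blast

section \<open>Compact balls and local compactness of the group\<close>

definition isoE_cball :: "('d::finite) emap \<Rightarrow> real \<Rightarrow> 'd emap set" where
  "isoE_cball k r = {g \<in> isoE. dist (iso_coord g) (iso_coord k) \<le> r}"

definition isoE_ball :: "('d::finite) emap \<Rightarrow> real \<Rightarrow> 'd emap set" where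
  "isoE_ball k r = {g \<in> isoE. dist (iso_coord g) (iso_coord k) < r}"

lemma compactin_isoE_cball: "compactin isoE_top (isoE_cball k r)"
proof -
  have "iso_coord ` isoE_cball k r = iso_coord ` isoE \<inter> cball (iso_coord k) r"
    by (auto simp: isoE_cball_def dist_commute)
  then show ?thesis
    unfolding compactin_isoE
    by (auto simp: isoE_cball_def closed_iso_coord_image closed_Int_compact)
qed

lemma openin_isoE_ball: "openin isoE_top (isoE_ball k r)"
proof -
  have "openin isoE_top {g \<in> topspace isoE_top. iso_coord g \<in> ball (iso_coord k) r}"
    by (rule openin_continuous_map_preimage[OF iso_coord_continuous]) simp
  then show ?thesis by (simp add: isoE_ball_def dist_commute)
qed

lemma isoE_ball_subset_cball: "isoE_ball k r \<subseteq> isoE_cball k r"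
  by (auto simp: isoE_ball_def isoE_cball_def)

lemma isoE_cball_within:
  assumes "openin isoE_top U" and "k \<in> U"
  obtains r where "r > 0" "isoE_cball k r \<subseteq> U" "k \<in> isoE_ball k r"
proof -
  obtain V where V: "open V" "U = iso_coord -` V \<inter> isoE"
    using assms(1) by (auto simp: isoE_top_eq openin_pullback_topology)
  then obtain r where r: "r > 0" "cball (iso_coord k) r \<subseteq> V"
    using assms(2) open_contains_cball by blast
  show thesis
  proof
    show "isoE_cball k r \<subseteq> U"
      using r V by (auto simp: isoE_cball_def dist_commute subset_eq)
    show "k \<in> isoE_ball k r" using assms V r by (auto simp: isoE_ball_def)
  qed (fact r)
qed

lemma isoE_compact_nhd:
  assumes "openin isoE_top U" and "k \<in> U"
  obtains V K where "openin isoE_top V" "compactin isoE_top K" "k \<in> V" "V \<subseteq> K" "K \<subseteq> U"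
  using isoE_cball_within[OF assms] openin_isoE_ball compactin_isoE_cball isoE_ball_subset_cball
  by metis

lemma closedin_isoE_compact: "compactin isoE_top K \<Longrightarrow> closedin isoE_top K"
  by (simp add: compactin_imp_closedin)

lemma compactin_isoE_comp:
  assumes "compactin isoE_top K" and "compactin isoE_top K'"
  shows "compactin isoE_top {g \<circ> h | g h. g \<in> K \<and> h \<in> K'}"
proof -
  have "continuous_map (prod_topology isoE_top isoE_top) isoE_top (\<lambda>p. fst p \<circ> snd p)"
    by (intro continuous_map_isoE_comp continuous_map_fst continuous_map_snd)
  then have "compactin isoE_top ((\<lambda>p. fst p \<circ> snd p) ` (K \<times> K'))"
    using assms by (intro image_compactin) (auto simp: compactin_Times)
  moreover have "(\<lambda>p. fst p \<circ> snd p) ` (K \<times> K') = {g \<circ> h | g h. g \<in> K \<and> h \<in> K'}"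
    by force
  ultimately show ?thesis by simp
qed

lemma compactin_isoE_inv:
  assumes "compactin isoE_top K"
  shows "compactin isoE_top (inv ` K)"
  using image_compactin[OF assms] continuous_map_isoE_inv[of isoE_top id]
  by (simp add: continuous_map_id)


section \<open>The Fell topology\<close>

lemma topspace_fell [simp]: "topspace (fell_topology X) = {Y. closedin X Y}"
proof -
  have "{Y. closedin X Y} \<in> {{Y. closedin X Y \<and> Y \<inter> K = {} \<and> (\<forall>F\<in>\<F>. Y \<inter> F \<noteq> {})} | K \<F>.
        compactin X K \<and> finite \<F> \<and> (\<forall>F\<in>\<F>. openin X F \<and> F \<noteq> {})}"
    by (intro CollectI exI[of _ "{}"] conjI) auto
  then have "{Y. closedin X Y} \<subseteq> topspace (fell_topology X)"
    unfolding fell_topology_def topology_generated_by_topspace by (rule Union_upper)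
  moreover have "topspace (fell_topology X) \<subseteq> {Y. closedin X Y}"
    unfolding fell_topology_def topology_generated_by_topspace by (rule Union_least) auto
  ultimately show ?thesis by (rule equalityI[rotated])
qed

lemma openin_fell_miss:
  assumes "compactin X K"
  shows "openin (fell_topology X) {Y. closedin X Y \<and> Y \<inter> K = {}}"
  unfolding fell_topology_def
  by (rule topology_generated_by_Basis, intro CollectI exI[of _ K] exI[of _ "{}"]) (use assms in auto)

lemma openin_fell_hit:
  assumes "openin X F"
  shows "openin (fell_topology X) {Y. closedin X Y \<and> Y \<inter> F \<noteq> {}}"
\<comment> \<open>The subbasis only admits nonempty \<open>F\<close>; for empty \<open>F\<close> the
  set in question is itself empty.\<close>
proof (cases "F = {}")
  case False
  then show ?thesis
    unfolding fell_topology_def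
    by (intro topology_generated_by_Basis CollectI exI[of _ "{F}"] exI[of _ "{}"]) (use assms in auto)
qed auto

text \<open>A subbasic set is the intersection of one miss set with finitely many hit sets, so the
  two kinds can be tested separately.\<close>

lemma continuous_map_into_fell:
  "continuous_map Z (fell_topology X) S \<longleftrightarrow>
     (\<forall>z\<in>topspace Z. closedin X (S z)) \<and>
     (\<forall>K. compactin X K \<longrightarrow> openin Z {z \<in> topspace Z. S z \<inter> K = {}}) \<and>
     (\<forall>F. openin X F \<longrightarrow> openin Z {z \<in> topspace Z. S z \<inter> F \<noteq> {}})"
  (is "?lhs \<longleftrightarrow> ?rhs")
proof
  assume S: ?lhs
  have cl: "\<forall>z\<in>topspace Z. closedin X (S z)"
    using continuous_map_funspace[OF S] by auto
  have "openin Z {z \<in> topspace Z. S z \<inter> K = {}}" if "compactin X K" for K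
    using openin_continuous_map_preimage[OF S openin_fell_miss[OF that]] cl
    by (simp add: conj_commute cong: conj_cong)
  moreover have "openin Z {z \<in> topspace Z. S z \<inter> F \<noteq> {}}" if "openin X F" for F
    using openin_continuous_map_preimage[OF S openin_fell_hit[OF that]] cl
    by (simp add: conj_commute cong: conj_cong)
  ultimately show ?rhs using cl by blast
next
  assume r: ?rhs
  show ?lhs
    unfolding fell_topology_def
  proof (rule continuous_on_generated_topo)
    fix U
    assume "U \<in> {{Y. closedin X Y \<and> Y \<inter> K = {} \<and> (\<forall>F\<in>\<F>. Y \<inter> F \<noteq> {})} | K \<F>.
        compactin X K \<and> finite \<F> \<and> (\<forall>F\<in>\<F>. openin X F \<and> F \<noteq> {})}"
    then obtain K \<F> where U: "U = {Y. closedin X Y \<and> Y \<inter> K = {} \<and> (\<forall>F\<in>\<F>. Y \<inter> F \<noteq> {})}"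
      "compactin X K" "finite \<F>" "\<forall>F\<in>\<F>. openin X F"
      by blast
    have "S -` U \<inter> topspace Z =
        {z \<in> topspace Z. S z \<inter> K = {}} \<inter> {z \<in> topspace Z. \<forall>F\<in>\<F>. S z \<inter> F \<noteq> {}}"
      using r by (auto simp: U(1))
    moreover have "openin Z {z \<in> topspace Z. \<forall>F\<in>\<F>. S z \<inter> F \<noteq> {}}"
      using U(3,4)
    proof (induction \<F> rule: finite_induct)
      case (insert F \<F>)
      have "{z \<in> topspace Z. \<forall>F\<in>insert F \<F>. S z \<inter> F \<noteq> {}} =
          {z \<in> topspace Z. S z \<inter> F \<noteq> {}} \<inter> {z \<in> topspace Z. \<forall>F\<in>\<F>. S z \<inter> F \<noteq> {}}"
        by blast
      moreover have "openin Z {z \<in> topspace Z. S z \<inter> F \<noteq> {}}"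
        using r insert.prems by simp
      moreover have "openin Z {z \<in> topspace Z. \<forall>F\<in>\<F>. S z \<inter> F \<noteq> {}}"
        using insert.IH insert.prems by simp
      ultimately show ?case by (simp add: openin_Int)
    qed simp
    ultimately show "openin Z (S -` U \<inter> topspace Z)"
      using r U(2) by auto
  next
    have "S ` topspace Z \<subseteq> topspace (fell_topology X)" using r by auto
    then show "S ` topspace Z \<subseteq> \<Union> {{Y. closedin X Y \<and> Y \<inter> K = {} \<and> (\<forall>F\<in>\<F>. Y \<inter> F \<noteq> {})} | K \<F>.
        compactin X K \<and> finite \<F> \<and> (\<forall>F\<in>\<F>. openin X F \<and> F \<noteq> {})}"
      unfolding fell_topology_def topology_generated_by_topspace .
  qed
qed

text \<open>Alexander's subbase theorem with miss sets and hit sets as subbase. Given a cover, let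
  \<open>O'\<close> be the union of the open \<open>F\<close> whose hit sets occur in it. The closed
  complement of \<open>O'\<close> lies in no such hit set, hence in the miss set of a compact
  \<open>K\<close>. Then \<open>K\<close> lies in \<open>O'\<close>, and finitely many
  \<open>F\<close> covering \<open>K\<close> yield, together with that miss set, a finite subcover.
  \<open>B\<close> has the form that the theorem demands; compactness passes to the Fell topology
  along the identity map.\<close>

lemma compact_space_fell: "compact_space (fell_topology X)"
proof -
  define \<B> where "\<B> = {{Y. closedin X Y \<and> Y \<inter> K = {}} | K. compactin X K}
                     \<union> {{Y. closedin X Y \<and> Y \<inter> F \<noteq> {}} | F. openin X F}"
  define B where "B = topology (arbitrary union_of
      (finite intersection_of (\<lambda>x. x \<in> \<B>) relative_to \<Union>\<B>))"
  have "{Y. closedin X Y} \<in> \<B>"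
    unfolding \<B>_def by (intro UnI1 CollectI exI[of _ "{}"]) auto
  moreover have "V \<subseteq> {Y. closedin X Y}" if "V \<in> \<B>" for V
    using that by (auto simp: \<B>_def)
  ultimately have U: "\<Union>\<B> = {Y. closedin X Y}"
    by (intro equalityI Union_upper Union_least)
  have top: "topspace B = {Y. closedin X Y}"
    by (simp add: B_def U)
  have op: "openin B V" if "V \<in> \<B>" for V
    unfolding B_def openin_subbase
    by (rule arbitrary_union_of_inc)
      (metis U Union_upper finite_intersection_of_inc inf.absorb2 relative_to_def that)
  have "compact_space B"
  proof (rule Alexander_subbase[OF B_def[symmetric]])
    fix C assume C: "C \<subseteq> \<B>" "\<Union>C = topspace B"
    define O' where "O' = \<Union>{F. openin X F \<and> {Y. closedin X Y \<and> Y \<inter> F \<noteq> {}} \<in> C}"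
    have "openin X O'" unfolding O'_def by (rule openin_Union) auto
    then have "topspace X - O' \<in> topspace B" by (simp add: top closedin_def Diff_Diff_Int openin_Int)
    then obtain V where V: "V \<in> C" "topspace X - O' \<in> V" using C(2) by blast
    have neg: "\<not> (\<exists>F. V = {Y. closedin X Y \<and> Y \<inter> F \<noteq> {}} \<and> openin X F)"
      using V unfolding O'_def by blast
    have "V \<in> \<B>" using V(1) C(1) by (rule subsetD[rotated])
    then have "(\<exists>K. V = {Y. closedin X Y \<and> Y \<inter> K = {}} \<and> compactin X K) \<or>
        (\<exists>F. V = {Y. closedin X Y \<and> Y \<inter> F \<noteq> {}} \<and> openin X F)"
      unfolding \<B>_def Un_iff mem_Collect_eq .
    then obtain K where K: "V = {Y. closedin X Y \<and> Y \<inter> K = {}}" "compactin X K"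
      using neg by iprover
    have "K \<subseteq> O'" using V(2) compactin_subset_topspace[OF K(2)] by (auto simp: K(1))
    then have "\<exists>\<F>. finite \<F> \<and> \<F> \<subseteq> {F. openin X F \<and> {Y. closedin X Y \<and> Y \<inter> F \<noteq> {}} \<in> C} \<and> K \<subseteq> \<Union>\<F>"
      unfolding O'_def by (intro compactinD[OF K(2)]) auto
    then obtain \<F> where \<F>: "finite \<F>" "K \<subseteq> \<Union>\<F>"
        "\<F> \<subseteq> {F. openin X F \<and> {Y. closedin X Y \<and> Y \<inter> F \<noteq> {}} \<in> C}"
      by iprover
    define C' where "C' = insert V ((\<lambda>F. {Y. closedin X Y \<and> Y \<inter> F \<noteq> {}}) ` \<F>)"
    have fin: "finite C'" "C' \<subseteq> C" using \<F> V(1) by (auto simp: C'_def)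
    have "topspace B \<subseteq> \<Union>C'"
      using \<F>(2) by (auto simp: C'_def top K(1))
    moreover have "\<Union>C' \<subseteq> topspace B"
      using Union_mono[OF fin(2)] C(2) by simp
    ultimately show "\<exists>C'. finite C' \<and> C' \<subseteq> C \<and> \<Union>C' = topspace B"
      using fin by (intro exI[of _ C'] conjI equalityI)
  qed
  moreover have "continuous_map B (fell_topology X) id"
    unfolding continuous_map_into_fell
  proof (intro conjI allI impI)
    fix K assume "compactin X K"
    then have "openin B {Y. closedin X Y \<and> Y \<inter> K = {}}" by (intro op) (auto simp: \<B>_def)
    then show "openin B {z \<in> topspace B. id z \<inter> K = {}}" by (simp add: top)
  next
    fix F assume "openin X F"
    then have "openin B {Y. closedin X Y \<and> Y \<inter> F \<noteq> {}}" by (intro op) (auto simp: \<B>_def)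
    then show "openin B {z \<in> topspace B. id z \<inter> F \<noteq> {}}" by (simp add: top)
  qed (simp add: top)
  ultimately have "compactin (fell_topology X) (id ` topspace B)"
    by (intro image_compactin) (auto simp: compact_space_def)
  then show ?thesis by (simp add: compact_space_def top)
qed


section \<open>The action on closed sets\<close>

lemma act_set_eq:
  assumes "g \<in> isoE" and "L \<subseteq> isoE"
  shows "act_set g L = {x \<in> isoE. x \<circ> g \<in> L}"
proof (intro set_eqI iffI)
  fix x assume "x \<in> act_set g L"
  then show "x \<in> {x \<in> isoE. x \<circ> g \<in> L}"
    using assms by (auto simp: act_set_def act_def)
next
  fix x assume "x \<in> {x \<in> isoE. x \<circ> g \<in> L}"
  then have "x = act g (x \<circ> g)" "x \<circ> g \<in> L"
    using assms by (auto simp: act_def)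
  then show "x \<in> act_set g L" unfolding act_set_def by blast
qed

lemma act_set_comp:
  assumes "g \<in> isoE" and "h \<in> isoE"
  shows "act_set g (act_set h L) = act_set (g \<circ> h) L"
  using assms by (simp add: act_set_def act_def isoE_inv_comp_distrib image_image comp_assoc)

lemma closedin_act_set:
  assumes "g \<in> isoE" and "closedin isoE_top L"
  shows "closedin isoE_top (act_set g L)"
proof -
  have "continuous_map isoE_top isoE_top (\<lambda>x. x \<circ> g)"
    using assms(1) by (intro continuous_map_isoE_comp) (auto simp: continuous_map_const)
  then have "closedin isoE_top {x \<in> topspace isoE_top. x \<circ> g \<in> L}"
    using assms(2) closedin_continuous_map_preimage by blast
  then show ?thesis
    using assms closedin_subset[OF assms(2)] by (simp add: act_set_eq)
qed

text \<open>Joint continuity is needed because the group element and the set both vary over the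
  groupoid. For missing \<open>K\<close>, the tube lemma provides a compact neighbourhood
  \<open>C\<close> of \<open>g z0\<close> such that the compact set \<open>K'\<close> of all
  \<open>k \<circ> c\<close> still misses \<open>S z0\<close>; missing \<open>K'\<close> is an open
  condition and implies the claim as long as \<open>g z\<close> stays in \<open>C\<close>.\<close>

lemma continuous_map_act_set:
  assumes g: "continuous_map Z isoE_top g" and S: "continuous_map Z (fell_topology isoE_top) S"
  shows "continuous_map Z (fell_topology isoE_top) (\<lambda>z. act_set (g z) (S z))"
proof -
  have gi: "g z \<in> isoE" if "z \<in> topspace Z" for z
    using g that by (auto simp: continuous_map_into_isoE)
  have cl: "closedin isoE_top (S z)" if "z \<in> topspace Z" for z
    using S that by (auto simp: continuous_map_into_fell)
  have Si: "S z \<subseteq> isoE" if "z \<in> topspace Z" for z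
    using closedin_subset[OF cl[OF that]] by simp
  have "openin Z {z \<in> topspace Z. act_set (g z) (S z) \<inter> K = {}}" if K: "compactin isoE_top K" for K
  proof (subst openin_subopen, intro ballI)
    fix z0 assume "z0 \<in> {z \<in> topspace Z. act_set (g z) (S z) \<inter> K = {}}"
    then have z0: "z0 \<in> topspace Z" "act_set (g z0) (S z0) \<inter> K = {}" by auto
    have Ki: "K \<subseteq> isoE" using compactin_subset_topspace[OF K] by simp
    let ?W = "{p \<in> topspace (prod_topology isoE_top isoE_top). fst p \<circ> snd p \<in> isoE - S z0}"
    have "continuous_map (prod_topology isoE_top isoE_top) isoE_top (\<lambda>p. fst p \<circ> snd p)"
      by (intro continuous_map_isoE_comp continuous_map_fst continuous_map_snd)
    moreover have "openin isoE_top (isoE - S z0)"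
      using cl[OF z0(1)] by (simp add: closedin_def)
    ultimately have W: "openin (prod_topology isoE_top isoE_top) ?W"
      by (rule openin_continuous_map_preimage)
    have "K \<times> {g z0} \<subseteq> ?W"
      using z0 Ki gi[OF z0(1)] Si[OF z0(1)] by (auto simp: act_set_eq)
    then have "\<exists>U0 W0. openin isoE_top U0 \<and> openin isoE_top W0 \<and> K \<subseteq> U0 \<and> g z0 \<in> W0 \<and> U0 \<times> W0 \<subseteq> ?W"
      using gi[OF z0(1)] by (intro tube_lemma_left[OF W K]) simp_all
    then obtain U0 W0 where W0: "openin isoE_top W0" "K \<subseteq> U0" "g z0 \<in> W0" "U0 \<times> W0 \<subseteq> ?W"
      by (elim exE conjE)
    obtain V C where V: "openin isoE_top V" "compactin isoE_top C" "g z0 \<in> V" "V \<subseteq> C" "C \<subseteq> W0"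
      using isoE_compact_nhd[OF W0(1,3)] .
    define K' where "K' = {k \<circ> c | k c. k \<in> K \<and> c \<in> C}"
    have K': "compactin isoE_top K'"
      unfolding K'_def using K V(2) by (rule compactin_isoE_comp)
    have "S z0 \<inter> K' = {}"
      using W0 V by (fastforce simp: K'_def)
    define T where "T = {z \<in> topspace Z. g z \<in> V} \<inter> {z \<in> topspace Z. S z \<inter> K' = {}}"
    have "openin Z T"
      unfolding T_def using openin_continuous_map_preimage[OF g V(1)] S K'
      by (auto simp: continuous_map_into_fell)
    moreover have "z0 \<in> T" using z0 V \<open>S z0 \<inter> K' = {}\<close> by (auto simp: T_def)
    moreover have "T \<subseteq> {z \<in> topspace Z. act_set (g z) (S z) \<inter> K = {}}"
    proof
      fix z assume z: "z \<in> T"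
      then have "z \<in> topspace Z" by (auto simp: T_def)
      moreover have "k \<circ> g z \<notin> S z" if "k \<in> K" for k
        using z that V(4) by (auto simp: T_def K'_def)
      ultimately show "z \<in> {z \<in> topspace Z. act_set (g z) (S z) \<inter> K = {}}"
        using gi Si by (auto simp: act_set_eq)
    qed
    ultimately show "\<exists>T. openin Z T \<and> z0 \<in> T \<and> T \<subseteq> {z \<in> topspace Z. act_set (g z) (S z) \<inter> K = {}}"
      by blast
  qed
  moreover have "openin Z {z \<in> topspace Z. act_set (g z) (S z) \<inter> F \<noteq> {}}" if F: "openin isoE_top F" for F
  proof (subst openin_subopen, intro ballI)
    fix z0 assume "z0 \<in> {z \<in> topspace Z. act_set (g z) (S z) \<inter> F \<noteq> {}}"
    then obtain x where z0: "z0 \<in> topspace Z" "x \<in> S z0" "x \<circ> inv (g z0) \<in> F"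
      by (auto simp: act_set_def act_def)
    \<comment> \<open>For hitting \<open>F\<close>, a witness \<open>x\<close> in
      \<open>S z0\<close> may be replaced by any point of a neighbourhood \<open>V\<close> of
      \<open>x\<close>, uniformly for \<open>z\<close> near \<open>z0\<close>; hitting
      \<open>V\<close> is an open condition.\<close>
    let ?W = "{p \<in> topspace (prod_topology Z isoE_top). snd p \<circ> inv (g (fst p)) \<in> F}"
    have "continuous_map (prod_topology Z isoE_top) isoE_top (\<lambda>p. snd p \<circ> inv (g (fst p)))"
      using continuous_map_compose[OF continuous_map_fst g]
      by (intro continuous_map_isoE_comp continuous_map_isoE_inv continuous_map_snd)
        (simp add: o_def)
    then have W: "openin (prod_topology Z isoE_top) ?W"
      using F by (rule openin_continuous_map_preimage)
    have zx: "(z0, x) \<in> ?W" using z0 Si[OF z0(1)] by auto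
    obtain O' V where V: "openin Z O'" "openin isoE_top V" "z0 \<in> O'" "x \<in> V" "O' \<times> V \<subseteq> ?W"
      using iffD1[OF openin_prod_topology_alt W, rule_format, OF zx] by iprover
    define T where "T = O' \<inter> {z \<in> topspace Z. S z \<inter> V \<noteq> {}}"
    have "openin Z T"
      unfolding T_def using V S by (auto simp: continuous_map_into_fell)
    moreover have "z0 \<in> T" using z0 V by (auto simp: T_def)
    moreover have "T \<subseteq> {z \<in> topspace Z. act_set (g z) (S z) \<inter> F \<noteq> {}}"
      using V(5) by (fastforce simp: T_def act_set_def act_def)
    ultimately show "\<exists>T. openin Z T \<and> z0 \<in> T \<and> T \<subseteq> {z \<in> topspace Z. act_set (g z) (S z) \<inter> F \<noteq> {}}"
      by blast
  qed
  ultimately show ?thesis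
    unfolding continuous_map_into_fell using closedin_act_set gi cl by blast
qed

text \<open>If \<open>g\<close> is not in the closed set \<open>L\<close>, then a compact
  neighbourhood of \<open>g\<close> misses \<open>L\<close>, and missing it is Fell-open. Local
  compactness of the group enters here.\<close>

lemma closedin_fell_membership:
  "closedin (prod_topology isoE_top (fell_topology isoE_top)) {(g, L). closedin isoE_top L \<and> g \<in> L}"
  (is "closedin ?P ?E")
proof -
  have "openin ?P (topspace ?P - ?E)"
  proof (subst openin_subopen, intro ballI)
    fix p assume "p \<in> topspace ?P - ?E"
    then obtain g L where p: "p = (g, L)" "g \<in> isoE" "closedin isoE_top L" "g \<notin> L" by auto
    have "openin isoE_top (isoE - L)" using p(3) by (simp add: closedin_def)
    then obtain V K where V: "openin isoE_top V" "compactin isoE_top K" "g \<in> V" "V \<subseteq> K" "K \<subseteq> isoE - L"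
      using isoE_compact_nhd[of "isoE - L" g] p by blast
    define T where "T = V \<times> {Y. closedin isoE_top Y \<and> Y \<inter> K = {}}"
    have "openin ?P T"
      unfolding T_def using V(1) openin_fell_miss[OF V(2)] by (simp add: openin_prod_Times_iff)
    moreover have "p \<in> T" using p V by (auto simp: T_def)
    moreover have "T \<subseteq> topspace ?P - ?E"
      using V openin_subset[OF V(1)] by (auto simp: T_def)
    ultimately show "\<exists>T. openin ?P T \<and> p \<in> T \<and> T \<subseteq> topspace ?P - ?E" by blast
  qed
  moreover have "?E \<subseteq> topspace ?P" using closedin_subset by fastforce
  ultimately show ?thesis by (rule iffD2[OF closedin_def conjI, rotated])
qed


section \<open>Hull, transversal and groupoid\<close>

lemma closedin_hull: "closedin (fell_topology isoE_top) (dynamical_hull L0)"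
  by (simp add: dynamical_hull_def)

lemma hull_closedin: "L \<in> dynamical_hull L0 \<Longrightarrow> closedin isoE_top L"
  using closedin_subset[OF closedin_hull] by auto

lemma hull_isoE: "L \<in> dynamical_hull L0 \<Longrightarrow> x \<in> L \<Longrightarrow> x \<in> isoE"
  using closedin_subset[OF hull_closedin] by fastforce

text \<open>Translation is continuous for the Fell topology and maps the orbit into itself, hence
  also the closure of the orbit.\<close>

lemma act_set_hull:
  assumes g: "g \<in> isoE" and L: "L \<in> dynamical_hull L0"
  shows "act_set g L \<in> dynamical_hull L0"
proof -
  let ?O = "{act_set g L0 | g. g \<in> isoE}"
  have "continuous_map (fell_topology isoE_top) (fell_topology isoE_top) (\<lambda>Y. act_set g (id Y))"
    using g by (intro continuous_map_act_set) (auto simp: continuous_map_const)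
  then have "act_set g ` (fell_topology isoE_top closure_of ?O)
      \<subseteq> fell_topology isoE_top closure_of (act_set g ` ?O)"
    using continuous_map_image_closure_subset by fastforce
  moreover have "act_set g ` ?O \<subseteq> ?O"
    using g isoE_comp by (force simp: act_set_comp)
  then have "fell_topology isoE_top closure_of (act_set g ` ?O) \<subseteq> dynamical_hull L0"
    unfolding dynamical_hull_def by (rule closure_of_mono)
  ultimately have "act_set g ` dynamical_hull L0 \<subseteq> dynamical_hull L0"
    unfolding dynamical_hull_def by (rule order_trans)
  then show ?thesis using L by (rule subsetD[OF _ imageI])
qed

lemma transversal_hull: "L \<in> transversal L0 \<Longrightarrow> L \<in> dynamical_hull L0"
  and transversal_id: "L \<in> transversal L0 \<Longrightarrow> id \<in> L"
  by (auto simp: transversal_def)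

lemma transversal_isoE: "L \<in> transversal L0 \<Longrightarrow> x \<in> L \<Longrightarrow> x \<in> isoE"
  using hull_isoE transversal_hull by blast

lemma transversal_subset_fell: "transversal L0 \<subseteq> topspace (fell_topology isoE_top)"
  using hull_closedin transversal_hull by auto

text \<open>Containing \<open>id\<close> is a closed condition, because the singleton of
  \<open>id\<close> is compact and missing it is Fell-open.\<close>

lemma closedin_transversal: "closedin (fell_topology isoE_top) (transversal L0)"
proof -
  have "openin (fell_topology isoE_top) {Y. closedin isoE_top Y \<and> Y \<inter> {id} = {}}"
    by (rule openin_fell_miss) simp
  then have "closedin (fell_topology isoE_top)
      (topspace (fell_topology isoE_top) - {Y. closedin isoE_top Y \<and> Y \<inter> {id} = {}})"
    by (rule closedin_diff[OF closedin_topspace])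
  moreover have eq: "transversal L0 = dynamical_hull L0 \<inter>
      (topspace (fell_topology isoE_top) - {Y. closedin isoE_top Y \<and> Y \<inter> {id} = {}})"
    using hull_closedin by (auto simp: transversal_def)
  ultimately show ?thesis unfolding eq using closedin_hull by (intro closedin_Int)
qed

lemma compactin_transversal: "compactin (fell_topology isoE_top) (transversal L0)"
  using closedin_transversal compact_space_fell closedin_compact_space by blast

lemma act_set_transversal:
  assumes "L \<in> transversal L0" and "g \<in> L"
  shows "act_set g L \<in> transversal L0"
proof -
  have "g \<in> isoE" using assms transversal_isoE by blast
  moreover from this have "act g g = id" by (simp add: act_def)
  then have "id \<in> act_set g L" using assms(2) unfolding act_set_def by (metis imageI)
  ultimately show ?thesis
    using act_set_hull assms(1) by (auto simp: transversal_def)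
qed

lemma groupoid_iff: "(g, L) \<in> groupoid L0 \<longleftrightarrow> L \<in> transversal L0 \<and> g \<in> L"
  by (simp add: groupoid_def)

text \<open>This is the arrow with source \<open>act_set x' L\<close> and range
  \<open>act_set x L\<close>. Kernel entries, convolution and adjoint evaluate functions at arrows
  of this shape.\<close>

lemma groupoid_kernel:
  assumes "L \<in> transversal L0" "x \<in> L" "x' \<in> L"
  shows "(x \<circ> inv x', act_set x' L) \<in> groupoid L0"
  using act_set_transversal[OF assms(1,3)] assms(2)
  by (auto simp: groupoid_iff act_set_def act_def)

lemma groupoid_top_eq:
  fixes L0 :: "('d::finite) emap set"
  shows "groupoid_top L0 = subtopology (prod_topology isoE_top (fell_topology isoE_top)) (groupoid L0)"
proof -
  have "prod_topology (isoE_top :: 'd emap topology) (subtopology (fell_topology isoE_top) (transversal L0)) =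
      subtopology (prod_topology isoE_top (fell_topology isoE_top)) (UNIV \<times> transversal L0)"
    using subtopology_Times[of "isoE_top :: 'd emap topology" "fell_topology isoE_top" UNIV "transversal L0", symmetric] by simp
  moreover have "(UNIV \<times> transversal L0) \<inter> groupoid L0 = groupoid L0"
    by (auto simp: groupoid_def)
  ultimately show ?thesis by (simp add: groupoid_top_def subtopology_subtopology)
qed

lemma groupoid_subset:
  "groupoid L0 \<subseteq> topspace (prod_topology isoE_top (fell_topology isoE_top))"
  using transversal_isoE transversal_subset_fell by (fastforce simp: groupoid_def)

lemma topspace_groupoid [simp]: "topspace (groupoid_top L0) = groupoid L0"
  using groupoid_subset by (auto simp: groupoid_top_eq)

lemma continuous_map_into_groupoid:
  "continuous_map Z (groupoid_top L0) (\<lambda>z. (g z, S z)) \<longleftrightarrow>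
     (\<forall>z\<in>topspace Z. (g z, S z) \<in> groupoid L0) \<and>
     continuous_map Z isoE_top g \<and> continuous_map Z (fell_topology isoE_top) S"
  by (auto simp: groupoid_top_eq continuous_map_in_subtopology continuous_map_pairwise o_def Pi_iff)

lemma continuous_map_groupoid_fst: "continuous_map (groupoid_top L0) isoE_top fst"
  and continuous_map_groupoid_snd: "continuous_map (groupoid_top L0) (fell_topology isoE_top) snd"
  unfolding groupoid_top_eq
  by (auto intro: continuous_map_from_subtopology continuous_map_fst continuous_map_snd)

text \<open>The transversal is compact, so only the group component has to be controlled, and the
  condition \<open>g \<in> L\<close> cuts a closed subset out of the product.\<close>

lemma compactin_groupoid:
  assumes "compactin isoE_top K"
  shows "compactin (groupoid_top L0) {p \<in> groupoid L0. fst p \<in> K}"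
proof -
  let ?P = "prod_topology isoE_top (fell_topology isoE_top)"
  have "compactin ?P (K \<times> transversal L0)"
    using assms compactin_transversal by (auto simp: compactin_Times)
  then have "compactin ?P ((K \<times> transversal L0) \<inter> {(g, L). closedin isoE_top L \<and> g \<in> L})"
    by (rule compact_Int_closedin[OF _ closedin_fell_membership])
  moreover have "(K \<times> transversal L0) \<inter> {(g, L). closedin isoE_top L \<and> g \<in> L} =
      {p \<in> groupoid L0. fst p \<in> K}"
    using hull_closedin transversal_hull by (fastforce simp: groupoid_def)
  ultimately show ?thesis by (auto simp: groupoid_top_eq compactin_subtopology)
qed

text \<open>Because the transversal is compact, compact support only restricts the group component:
  project the support to the group in one direction, use \<open>compactin_groupoid\<close> in the
  other. Later support arguments use this form.\<close>

lemma Cc_iff: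
  fixes f :: "('d::finite) emap \<times> 'd emap set \<Rightarrow> complex ^ 'n ^ ('n::finite)"
  shows "f \<in> Cc L0 \<longleftrightarrow> (\<forall>p. p \<notin> groupoid L0 \<longrightarrow> f p = 0) \<and>
     continuous_map (groupoid_top L0) euclidean f \<and>
     (\<exists>K. compactin isoE_top K \<and> (\<forall>g L. f (g, L) \<noteq> 0 \<longrightarrow> g \<in> K))"
proof -
  have "compactin (groupoid_top L0) (groupoid_top L0 closure_of {p. f p \<noteq> 0}) \<longleftrightarrow>
      (\<exists>K. compactin isoE_top K \<and> (\<forall>g L. f (g, L) \<noteq> 0 \<longrightarrow> g \<in> K))" (is "?C \<longleftrightarrow> ?K")
    if z: "\<forall>p. p \<notin> groupoid L0 \<longrightarrow> f p = 0"
  proof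
    assume ?C
    then have "compactin isoE_top (fst ` (groupoid_top L0 closure_of {p. f p \<noteq> 0}))"
      using continuous_map_groupoid_fst by (rule image_compactin)
    moreover have "{p. f p \<noteq> 0} \<subseteq> groupoid_top L0 closure_of {p. f p \<noteq> 0}"
      using z by (intro closure_of_subset) auto
    ultimately show ?K by (force simp: image_iff)
  next
    assume ?K
    then obtain K where K: "compactin isoE_top K" "\<And>g L. f (g, L) \<noteq> 0 \<Longrightarrow> g \<in> K" by blast
    have "closedin (groupoid_top L0) {p \<in> topspace (groupoid_top L0). fst p \<in> K}"
      using continuous_map_groupoid_fst closedin_isoE_compact[OF K(1)]
      by (rule closedin_continuous_map_preimage)
    moreover have "{p. f p \<noteq> 0} \<subseteq> {p \<in> groupoid L0. fst p \<in> K}"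
      using z K(2) by force
    ultimately have "groupoid_top L0 closure_of {p. f p \<noteq> 0} \<subseteq> {p \<in> groupoid L0. fst p \<in> K}"
      by (simp add: closure_of_minimal)
    then show ?C
      using compactin_groupoid[OF K(1)] closed_compactin closedin_closure_of by blast
  qed
  then show ?thesis unfolding Cc_def by blast
qed

lemma Cc_zero: "f \<in> Cc L0 \<Longrightarrow> p \<notin> groupoid L0 \<Longrightarrow> f p = 0"
  and Cc_continuous: "f \<in> Cc L0 \<Longrightarrow> continuous_map (groupoid_top L0) euclidean f"
  unfolding Cc_iff by blast+

lemma Cc_support:
  assumes "f \<in> Cc L0"
  obtains K where "compactin isoE_top K" "\<And>g L. f (g, L) \<noteq> 0 \<Longrightarrow> g \<in> K"
  using assms unfolding Cc_iff by blast


section \<open>Uniform separation\<close>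

text \<open>Translating \<open>U\<close> turns it into a neighbourhood of any given point, and the property of
  meeting a fixed open set in at most one point passes to Fell limits.\<close>

lemma separating_nhd:
  assumes "uniformly_separated L0" and k: "k \<in> isoE"
  obtains V where "openin isoE_top V" "k \<in> V"
    "\<And>L x y. L \<in> dynamical_hull L0 \<Longrightarrow> x \<in> L \<inter> V \<Longrightarrow> y \<in> L \<inter> V \<Longrightarrow> x = y"
proof -
  obtain U where U: "openin isoE_top U" "U \<noteq> {}"
    "\<forall>g\<in>isoE. finite (L0 \<inter> act_set g U) \<and> card (L0 \<inter> act_set g U) \<le> 1"
    using assms(1) unfolding uniformly_separated_def by iprover
  obtain u where u: "u \<in> U" using U(2) by blast
  have Ui: "U \<subseteq> isoE" using openin_subset[OF U(1)] by simp
  then have ui: "u \<in> isoE" using u by blast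
  \<comment> \<open>\<open>h\<close> is chosen so that \<open>act h u = k\<close>; the translate
    \<open>act_set h U\<close> is then a neighbourhood of \<open>k\<close>.\<close>
  define h where "h = inv k \<circ> u"
  have h: "h \<in> isoE" using k ui by (simp add: h_def)
  define V where "V = {x \<in> isoE. x \<circ> h \<in> U}"
  have "continuous_map isoE_top isoE_top (\<lambda>x. x \<circ> h)"
    using h by (intro continuous_map_isoE_comp) (auto simp: continuous_map_const)
  then have Vo: "openin isoE_top V"
    using openin_continuous_map_preimage[OF _ U(1)] by (force simp: V_def)
  have kV: "k \<in> V" using k u by (simp add: V_def h_def)
  have VU: "V = act_set h U" using h Ui by (simp add: V_def act_set_eq)
  \<comment> \<open>Composition with \<open>g\<close> carries the points of
    \<open>act_set g L0\<close> in \<open>V\<close> to points of \<open>L0\<close> in the translate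
    \<open>act_set (inv g \<circ> h) U\<close>, where \<open>L0\<close> has at most one.\<close>
  have orbit: "x = y" if g: "g \<in> isoE" and xy: "x \<in> act_set g L0 \<inter> V" "y \<in> act_set g L0 \<inter> V" for g x y
  proof -
    let ?A = "L0 \<inter> act_set (inv g \<circ> h) U"
    have "z \<circ> g \<in> ?A" if z: "z \<in> act_set g L0 \<inter> V" for z
    proof
      show "z \<circ> g \<in> L0" using z g by (auto simp: act_set_def act_def)
      obtain w where "w \<in> U" "z = w \<circ> inv h" using z by (auto simp: VU act_set_def act_def)
      then show "z \<circ> g \<in> act_set (inv g \<circ> h) U"
        using g h by (auto simp: act_set_def act_def isoE_inv_comp_distrib comp_assoc)
    qed
    then have "x \<circ> g \<in> ?A" "y \<circ> g \<in> ?A" using xy by blast+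
    moreover have "finite ?A" "card ?A \<le> 1" using U(3)[rule_format, of "inv g \<circ> h"] g h by auto
    ultimately have "x \<circ> g = y \<circ> g" by (metis card_le_Suc0_iff_eq One_nat_def)
    then show "x = y" using g by (metis isoE_cancel(1))
  qed
  show thesis
  proof (rule that[OF Vo kV])
    fix L x y assume L: "L \<in> dynamical_hull L0" and xy: "x \<in> L \<inter> V" "y \<in> L \<inter> V"
    show "x = y"
    proof (rule ccontr)
      assume "x \<noteq> y"
      have "x \<in> isoE" "y \<in> isoE" using xy by (auto simp: V_def)
      then obtain A B where AB: "openin isoE_top A" "openin isoE_top B" "x \<in> A" "y \<in> B" "disjnt A B"
        using Hausdorff_isoE \<open>x \<noteq> y\<close> unfolding Hausdorff_space_def by (metis topspace_isoE)
      \<comment> \<open>Meeting both \<open>A \<inter> V\<close> and \<open>B \<inter> V\<close> is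
        a Fell-open condition. If \<open>L\<close> satisfied it, so would some translate of
        \<open>L0\<close>, which would then have two distinct points in \<open>V\<close>.\<close>
      define T where "T = {Y. closedin isoE_top Y \<and> Y \<inter> (A \<inter> V) \<noteq> {}} \<inter>
          {Y. closedin isoE_top Y \<and> Y \<inter> (B \<inter> V) \<noteq> {}}"
      have "openin (fell_topology isoE_top) T"
        unfolding T_def using AB Vo by (intro openin_Int openin_fell_hit)
      moreover have "L \<in> T" using xy AB hull_closedin[OF L] by (auto simp: T_def)
      ultimately obtain g where "g \<in> isoE" "act_set g L0 \<in> T"
        using L unfolding dynamical_hull_def in_closure_of by blast
      then obtain a b where "a \<in> act_set g L0 \<inter> V" "b \<in> act_set g L0 \<inter> V" "a \<in> A" "b \<in> B"
        by (auto simp: T_def)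
      then show False using orbit[OF \<open>g \<in> isoE\<close>] AB(5) by (metis disjnt_iff)
    qed
  qed
qed

text \<open>Finitely many separating neighbourhoods cover \<open>K\<close>, and their number bounds
  the number of points. The neighbourhoods serve every \<open>L\<close> in the hull, which makes the
  bound uniform.\<close>

lemma hull_compact_card:
  assumes "uniformly_separated L0" and K: "compactin isoE_top K"
  obtains M where "\<And>L. L \<in> dynamical_hull L0 \<Longrightarrow> finite (L \<inter> K) \<and> card (L \<inter> K) \<le> M"
proof -
  have Ki: "K \<subseteq> isoE" using compactin_subset_topspace[OF K] by simp
  define P where "P k V \<longleftrightarrow> openin isoE_top V \<and> k \<in> V \<and>
     (\<forall>L\<in>dynamical_hull L0. \<forall>x\<in>L \<inter> V. \<forall>y\<in>L \<inter> V. x = y)" for k V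
  have "\<forall>k\<in>K. \<exists>V. P k V"
  proof
    fix k assume "k \<in> K"
    then have "k \<in> isoE" using Ki by blast
    then obtain V where "openin isoE_top V" "k \<in> V"
      "\<And>L x y. L \<in> dynamical_hull L0 \<Longrightarrow> x \<in> L \<inter> V \<Longrightarrow> y \<in> L \<inter> V \<Longrightarrow> x = y"
      by (rule separating_nhd[OF assms(1)]) iprover
    then have "P k V" unfolding P_def by blast
    then show "\<exists>V. P k V" ..
  qed
  then obtain V where VP: "\<forall>k\<in>K. P k (V k)" using bchoice by iprover
  have V: "openin isoE_top (V k)" "k \<in> V k" if "k \<in> K" for k
    using VP that by (auto simp: P_def)
  have V1: "x = y" if "k \<in> K" "L \<in> dynamical_hull L0" "x \<in> L \<inter> V k" "y \<in> L \<inter> V k" for k L x y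
    using VP that unfolding P_def by blast
  have "\<exists>\<F>. finite \<F> \<and> \<F> \<subseteq> V ` K \<and> K \<subseteq> \<Union>\<F>"
    using V by (intro compactinD[OF K]) auto
  then obtain D where D: "finite D" "D \<subseteq> K" "K \<subseteq> \<Union> (V ` D)"
    by (metis finite_subset_image)
  have "finite (L \<inter> K) \<and> card (L \<inter> K) \<le> card D" if L: "L \<in> dynamical_hull L0" for L
  proof -
    have "\<forall>x\<in>L \<inter> K. \<exists>k. k \<in> D \<and> x \<in> V k" using D(3) by blast
    then obtain f where "\<forall>x\<in>L \<inter> K. f x \<in> D \<and> x \<in> V (f x)" using bchoice by iprover
    then have f: "f x \<in> D \<and> x \<in> V (f x)" if "x \<in> L \<inter> K" for x
      using that by blast
    have "inj_on f (L \<inter> K)"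
    proof (rule inj_onI)
      fix x y assume "x \<in> L \<inter> K" "y \<in> L \<inter> K" "f x = f y"
      then show "x = y" using f[of x] f[of y] V1[OF _ L, of "f x" x y] D(2) by auto
    qed
    moreover have "f ` (L \<inter> K) \<subseteq> D" using f by blast
    ultimately show ?thesis using D(1) inj_on_finite card_inj_on_le by blast
  qed
  then show thesis using that by blast
qed

text \<open>Disjoint balls, each met at most once by every member of the hull, are what both the
  continuity of sums over architectures and the construction of bump functions rely on. Each radius
  is at most half the distance to the other centres.\<close>

lemma separating_cballs:
  fixes A :: "('d::finite) emap set"
  assumes sep: "uniformly_separated L0" and A: "finite A" "A \<subseteq> isoE"
  obtains r where "\<And>k. k \<in> A \<Longrightarrow> r k > 0"
    "\<And>k L x y. k \<in> A \<Longrightarrow> L \<in> dynamical_hull L0 \<Longrightarrow> x \<in> L \<inter> isoE_cball k (r k) \<Longrightarrow>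
       y \<in> L \<inter> isoE_cball k (r k) \<Longrightarrow> x = y"
    "\<And>k k' g. k \<in> A \<Longrightarrow> k' \<in> A \<Longrightarrow> g \<in> isoE_ball k (r k) \<Longrightarrow> g \<in> isoE_ball k' (r k') \<Longrightarrow> k = k'"
proof -
  define P where "P k r \<longleftrightarrow> r > 0 \<and>
      (\<forall>L\<in>dynamical_hull L0. \<forall>x\<in>L \<inter> isoE_cball k r. \<forall>y\<in>L \<inter> isoE_cball k r. x = y) \<and>
      (\<forall>x\<in>iso_coord ` A. x \<noteq> iso_coord k \<longrightarrow> 2 * r \<le> dist (iso_coord k) x)" for k r
  have "\<forall>k\<in>A. \<exists>r. P k r"
  proof
    fix k assume "k \<in> A"
    then have "k \<in> isoE" using A(2) by blast
    then obtain V where V: "openin isoE_top V" "k \<in> V"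
      "\<And>L x y. L \<in> dynamical_hull L0 \<Longrightarrow> x \<in> L \<inter> V \<Longrightarrow> y \<in> L \<inter> V \<Longrightarrow> x = y"
      by (rule separating_nhd[OF sep]) iprover
    obtain r where r: "r > 0" "isoE_cball k r \<subseteq> V" "k \<in> isoE_ball k r"
      by (rule isoE_cball_within[OF V(1,2)])
    obtain d where d: "d > 0" "\<forall>x\<in>iso_coord ` A. x \<noteq> iso_coord k \<longrightarrow> d \<le> dist (iso_coord k) x"
      using finite_set_avoid[of "iso_coord ` A" "iso_coord k"] A(1) by blast
    have "isoE_cball k (min r (d / 2)) \<subseteq> V" using r(2) by (auto simp: isoE_cball_def)
    then have "\<forall>L\<in>dynamical_hull L0. \<forall>x\<in>L \<inter> isoE_cball k (min r (d / 2)).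
        \<forall>y\<in>L \<inter> isoE_cball k (min r (d / 2)). x = y"
      using V(3) by (meson IntD1 IntD2 IntI subsetD)
    moreover have "2 * min r (d / 2) \<le> dist (iso_coord k) x" if "x \<in> iso_coord ` A" "x \<noteq> iso_coord k" for x
      using d(2)[rule_format, OF that] by linarith
    ultimately have "P k (min r (d / 2))" using r(1) d(1) by (simp add: P_def)
    then show "\<exists>r. P k r" ..
  qed
  then obtain r where "\<forall>k\<in>A. P k (r k)" using bchoice by iprover
  then have r: "P k (r k)" if "k \<in> A" for k using that by (rule bspec)
  show thesis
  proof (rule that[of r])
    show "r k > 0" if "k \<in> A" for k using r[OF that] by (simp add: P_def)
    show "x = y" if "k \<in> A" "L \<in> dynamical_hull L0" "x \<in> L \<inter> isoE_cball k (r k)"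
      "y \<in> L \<inter> isoE_cball k (r k)" for k L x y
      using r[OF that(1)] that(2-4) unfolding P_def by blast
    show "k = k'" if k: "k \<in> A" "k' \<in> A" and g: "g \<in> isoE_ball k (r k)" "g \<in> isoE_ball k' (r k')" for k k' g
    proof (rule ccontr)
      assume "k \<noteq> k'"
      then have "iso_coord k \<noteq> iso_coord k'"
        using A(2) k iso_coord_inj by (meson inj_onD subsetD)
      then have "2 * r k \<le> dist (iso_coord k) (iso_coord k')" "2 * r k' \<le> dist (iso_coord k') (iso_coord k)"
        using r[OF k(1)] r[OF k(2)] k by (auto simp: P_def)
      moreover have "dist (iso_coord g) (iso_coord k) < r k" "dist (iso_coord g) (iso_coord k') < r k'"
        using g by (auto simp: isoE_ball_def)
      moreover have "dist (iso_coord k) (iso_coord k') \<le>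
          dist (iso_coord g) (iso_coord k) + dist (iso_coord g) (iso_coord k')"
        by (rule dist_triangle3)
      ultimately show False by (simp add: dist_commute)
    qed
  qed
qed


section \<open>Convolution and adjoint\<close>

text \<open>The infinite sums in the convolution, the module inner product and the kernel operators
  have only finitely many nonzero terms; this removes them.\<close>

lemma infsum_eq_sum:
  fixes h :: "'a \<Rightarrow> 'b::{topological_comm_monoid_add, t2_space}"
  assumes "finite S" and "S \<subseteq> L" and "\<And>x. x \<in> L \<Longrightarrow> x \<notin> S \<Longrightarrow> h x = 0"
  shows "infsum h L = sum h S"
proof -
  have "infsum h L = infsum h S"
    using assms by (intro infsum_cong_neutral) auto
  then show ?thesis using assms(1) by simp
qed

text \<open>Near \<open>z\<^sub>0\<close>, the part of \<open>S z\<close> in the compact set \<open>K\<close> consists of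
  exactly one point close to each of the finitely many points of \<open>S z\<^sub>0 \<inter> K\<close>, up to points
  outside \<open>K\<close>, where \<open>F\<close> vanishes.\<close>

lemma continuous_map_fell_sum:
  fixes F :: "'z \<times> ('d::finite) emap \<Rightarrow> 'b::real_normed_vector"
  assumes sep: "uniformly_separated L0"
    and S: "continuous_map Z (fell_topology isoE_top) S"
    and SH: "\<And>z. z \<in> topspace Z \<Longrightarrow> S z \<in> dynamical_hull L0"
    and F: "continuous_map (subtopology (prod_topology Z isoE_top) {(z, g). g \<in> S z}) euclidean F"
    and K: "compactin isoE_top K"
    and FK: "\<And>z g. z \<in> topspace Z \<Longrightarrow> g \<in> S z \<Longrightarrow> g \<notin> K \<Longrightarrow> F (z, g) = 0"
  shows "continuous_map Z euclidean (\<lambda>z. \<Sum>\<^sub>\<infinity>g\<in>S z. F (z, g))"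
  unfolding continuous_map_euclidean_iff_tendsto
proof
  fix z0 assume z0: "z0 \<in> topspace Z"
  define A where "A = S z0 \<inter> K"
  obtain M where "\<And>L. L \<in> dynamical_hull L0 \<Longrightarrow> finite (L \<inter> K) \<and> card (L \<inter> K) \<le> M"
    by (rule hull_compact_card[OF sep K]) iprover
  then have finA: "finite A" using SH[OF z0] by (simp add: A_def)
  have Ai: "A \<subseteq> isoE" using hull_isoE[OF SH[OF z0]] by (auto simp: A_def)
  have sum0: "(\<Sum>\<^sub>\<infinity>g\<in>S z0. F (z0, g)) = (\<Sum>k\<in>A. F (z0, k))"
    using finA FK[OF z0] by (intro infsum_eq_sum) (auto simp: A_def)
  show "((\<lambda>z. \<Sum>\<^sub>\<infinity>g\<in>S z. F (z, g)) \<longlongrightarrow> (\<Sum>\<^sub>\<infinity>g\<in>S z0. F (z0, g))) (atin Z z0)"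
  proof (rule tendstoI)
    fix e :: real assume e: "e > 0"
    \<comment> \<open>One more than the number of terms, so that the total error stays strictly
      below \<open>e\<close> even for empty \<open>A\<close>.\<close>
    define e' where "e' = e / (card A + 1)"
    have e': "e' > 0" using e by (simp add: e'_def)
    obtain r where r: "\<And>k. k \<in> A \<Longrightarrow> r k > 0"
      "\<And>k L x y. k \<in> A \<Longrightarrow> L \<in> dynamical_hull L0 \<Longrightarrow> x \<in> L \<inter> isoE_cball k (r k) \<Longrightarrow>
         y \<in> L \<inter> isoE_cball k (r k) \<Longrightarrow> x = y"
      "\<And>k k' g. k \<in> A \<Longrightarrow> k' \<in> A \<Longrightarrow> g \<in> isoE_ball k (r k) \<Longrightarrow> g \<in> isoE_ball k' (r k') \<Longrightarrow> k = k'"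
      by (rule separating_cballs[OF sep finA Ai]) iprover
    \<comment> \<open>A neighbourhood of \<open>z0\<close> and one of \<open>k\<close> are packed
      into the pair \<open>p\<close>, so that a single choice function serves all
      \<open>k\<close>.\<close>
    define P where "P k p \<longleftrightarrow> openin Z (fst p) \<and> z0 \<in> fst p \<and> openin isoE_top (snd p) \<and> k \<in> snd p \<and>
        snd p \<subseteq> isoE_ball k (r k) \<and>
        (\<forall>z\<in>fst p. \<forall>g\<in>S z \<inter> snd p. dist (F (z, g)) (F (z0, k)) < e')" for k and p :: "'z set \<times> 'd emap set"
    have "\<forall>k\<in>A. \<exists>p. P k p"
    proof
      fix k assume k: "k \<in> A"
      then have ki: "k \<in> isoE" and kS: "k \<in> S z0" using Ai by (auto simp: A_def)
      let ?D = "subtopology (prod_topology Z isoE_top) {(z, g). g \<in> S z}"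
      have "openin ?D {p \<in> topspace ?D. F p \<in> ball (F (z0, k)) e'}"
        using F by (rule openin_continuous_map_preimage) simp
      then obtain T where T: "openin (prod_topology Z isoE_top) T"
        "{p \<in> topspace ?D. F p \<in> ball (F (z0, k)) e'} = T \<inter> {(z, g). g \<in> S z}"
        unfolding openin_subtopology by iprover
      have "(z0, k) \<in> {p \<in> topspace ?D. F p \<in> ball (F (z0, k)) e'}"
        using z0 ki kS e' by simp
      then have "(z0, k) \<in> T" unfolding T(2) by simp
      then obtain O' W where W: "openin Z O'" "openin isoE_top W" "z0 \<in> O'" "k \<in> W" "O' \<times> W \<subseteq> T"
        using iffD1[OF openin_prod_topology_alt T(1), rule_format, of z0 k] by iprover
      have "P k (O', W \<inter> isoE_ball k (r k))"
        unfolding P_def fst_conv snd_conv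
      proof (intro conjI ballI)
        show "k \<in> W \<inter> isoE_ball k (r k)"
          using r(1)[OF k] W ki by (simp add: isoE_ball_def)
        show "openin isoE_top (W \<inter> isoE_ball k (r k))"
          using W(2) openin_isoE_ball by (intro openin_Int)
        show "dist (F (z, g)) (F (z0, k)) < e'"
          if "z \<in> O'" "g \<in> S z \<inter> (W \<inter> isoE_ball k (r k))" for z g
        proof -
          have "(z, g) \<in> T \<inter> {(z, g). g \<in> S z}" using that W(5) by auto
          then have "(z, g) \<in> {p \<in> topspace ?D. F p \<in> ball (F (z0, k)) e'}" unfolding T(2) .
          then show ?thesis by (simp add: dist_commute)
        qed
      qed (use W in auto)
      then show "\<exists>p. P k p" ..
    qed
    then obtain p where "\<forall>k\<in>A. P k (p k)" using bchoice by iprover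
    then have p: "P k (p k)" if "k \<in> A" for k using that by (rule bspec)
    define O1 where "O1 k = fst (p k)" for k
    define W where "W k = snd (p k)" for k
    have O1: "openin Z (O1 k)" "z0 \<in> O1 k" and W: "openin isoE_top (W k)" "k \<in> W k"
      and Wb: "W k \<subseteq> isoE_ball k (r k)"
      and Wd: "\<forall>z\<in>O1 k. \<forall>g\<in>S z \<inter> W k. dist (F (z, g)) (F (z0, k)) < e'" if "k \<in> A" for k
      using p[OF that] unfolding P_def O1_def W_def by iprover+
    \<comment> \<open>The part of \<open>K\<close> outside all the \<open>W k\<close>. It misses
      \<open>S z0\<close>, hence also \<open>S z\<close> for \<open>z\<close> near
      \<open>z0\<close>, and then every point of \<open>S z\<close> in \<open>K\<close> lies in some
      \<open>W k\<close>.\<close>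
    define K' where "K' = K \<inter> (topspace isoE_top - \<Union> (W ` A))"
    have "openin isoE_top (\<Union> (W ` A))" using W(1) by (intro openin_Union) auto
    then have "closedin isoE_top (topspace isoE_top - \<Union> (W ` A))"
      by (intro closedin_diff closedin_topspace)
    then have K': "compactin isoE_top K'"
      unfolding K'_def using K by (rule compact_Int_closedin[rotated])
    \<comment> \<open>Besides closeness of the values, \<open>z\<close> must be near enough for
      \<open>S z\<close> to have a point in \<open>W k\<close> at all.\<close>
    define O2 where "O2 k = O1 k \<inter> {z \<in> topspace Z. S z \<inter> W k \<noteq> {}}" for k
    define U where "U = {z \<in> topspace Z. S z \<inter> K' = {}} \<inter> {z \<in> topspace Z. \<forall>k\<in>A. z \<in> O2 k}"
    have O2: "openin Z (O2 k)" if "k \<in> A" for k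
      unfolding O2_def using O1(1)[OF that] W(1)[OF that] S
      by (intro openin_Int) (simp_all add: continuous_map_into_fell)
    have fin_open: "openin Z {z \<in> topspace Z. \<forall>k\<in>A. z \<in> O2 k}"
    proof -
      have "{z \<in> topspace Z. \<forall>k\<in>A. z \<in> O2 k} = topspace Z \<inter> \<Inter> (O2 ` A)" by auto
      moreover have "openin Z (topspace Z \<inter> \<Inter> (O2 ` A))"
        using finA O2 by (induction A rule: finite_induct)
          (auto simp: Int_left_commute[of "topspace Z"] openin_Int)
      ultimately show ?thesis by simp
    qed
    have "openin Z {z \<in> topspace Z. S z \<inter> K' = {}}"
      using S K' unfolding continuous_map_into_fell by iprover
    then have Uo: "openin Z U" unfolding U_def using fin_open by (rule openin_Int)
    have "S z0 \<inter> K' = {}" using W(2) by (auto simp: K'_def A_def)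
    moreover have "z0 \<in> O2 k" if "k \<in> A" for k
      using O1(2)[OF that] W(2)[OF that] z0 that by (auto simp: O2_def A_def)
    ultimately have z0U: "z0 \<in> U" using z0 by (simp add: U_def)
    have "dist (\<Sum>\<^sub>\<infinity>g\<in>S z. F (z, g)) (\<Sum>\<^sub>\<infinity>g\<in>S z0. F (z0, g)) < e" if zU: "z \<in> U" for z
    proof -
      have zZ: "z \<in> topspace Z" and zK: "S z \<inter> K' = {}" and zO: "\<And>k. k \<in> A \<Longrightarrow> z \<in> O2 k"
        using zU by (auto simp: U_def)
      have "\<forall>k\<in>A. \<exists>g. g \<in> S z \<inter> W k" using zO unfolding O2_def by blast
      then obtain q where "\<forall>k\<in>A. q k \<in> S z \<inter> W k" using bchoice by iprover
      then have q: "q k \<in> S z" "q k \<in> W k" if "k \<in> A" for k using that by auto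
      have inj: "inj_on q A"
      proof (rule inj_onI)
        fix k k' assume k: "k \<in> A" "k' \<in> A" "q k = q k'"
        then have "q k \<in> isoE_ball k (r k)" "q k \<in> isoE_ball k' (r k')"
          using q(2)[OF k(1)] q(2)[OF k(2)] Wb[OF k(1)] Wb[OF k(2)] by auto
        then show "k = k'" by (rule r(3)[OF k(1,2)])
      qed
      have "F (z, g) = 0" if g: "g \<in> S z" "g \<notin> q ` A" for g
      proof (rule FK[OF zZ g(1)])
        show "g \<notin> K"
        proof
          assume "g \<in> K"
          then have "g \<in> \<Union> (W ` A)"
            using zK g(1) hull_isoE[OF SH[OF zZ]] by (auto simp: K'_def)
          then obtain k where k: "k \<in> A" "g \<in> W k" by blast
          then have "g = q k"
            using r(2)[OF k(1) SH[OF zZ], of g "q k"] q[OF k(1)] g(1) Wb[OF k(1)]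
              isoE_ball_subset_cball[of k "r k"] by blast
          then show False using g(2) k(1) by blast
        qed
      qed
      then have "(\<Sum>\<^sub>\<infinity>g\<in>S z. F (z, g)) = (\<Sum>g\<in>q ` A. F (z, g))"
        using finA q(1) by (intro infsum_eq_sum) auto
      also have "\<dots> = (\<Sum>k\<in>A. F (z, q k))" by (simp add: sum.reindex[OF inj])
      finally have "dist (\<Sum>\<^sub>\<infinity>g\<in>S z. F (z, g)) (\<Sum>\<^sub>\<infinity>g\<in>S z0. F (z0, g)) =
          norm (\<Sum>k\<in>A. F (z, q k) - F (z0, k))"
        by (simp add: sum0 dist_norm sum_subtractf)
      also have "\<dots> \<le> (\<Sum>k\<in>A. e')"
      proof (rule sum_norm_le)
        fix k assume k: "k \<in> A"
        have "z \<in> O1 k" using zO[OF k] by (simp add: O2_def)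
        then have "dist (F (z, q k)) (F (z0, k)) < e'" using Wd[OF k] q[OF k] by blast
        then show "norm (F (z, q k) - F (z0, k)) \<le> e'" by (simp add: dist_norm)
      qed
      also have "\<dots> < e" using e by (simp add: e'_def field_simps)
      finally show ?thesis .
    qed
    then show "\<forall>\<^sub>F z in atin Z z0. dist (\<Sum>\<^sub>\<infinity>g\<in>S z. F (z, g)) (\<Sum>\<^sub>\<infinity>g\<in>S z0. F (z0, g)) < e"
      unfolding eventually_atin using Uo z0U by blast
  qed
qed

lemma Cc_fiber_finite:
  assumes "uniformly_separated L0" and "f \<in> Cc L0" and "L \<in> dynamical_hull L0"
  shows "finite {g \<in> L. f (g, L) \<noteq> 0}"
proof -
  obtain K where K: "compactin isoE_top K" "\<And>g L. f (g, L) \<noteq> 0 \<Longrightarrow> g \<in> K"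
    by (rule Cc_support[OF assms(2)]) iprover
  obtain M where "\<And>L. L \<in> dynamical_hull L0 \<Longrightarrow> finite (L \<inter> K) \<and> card (L \<inter> K) \<le> M"
    by (rule hull_compact_card[OF assms(1) K(1)]) iprover
  then have "finite (L \<inter> K)" using assms(3) by blast
  moreover have "{g \<in> L. f (g, L) \<noteq> 0} \<subseteq> L \<inter> K" using K(2) by blast
  ultimately show ?thesis by (rule finite_subset[rotated])
qed

lemma matrix_mult_eq_0: "(A :: 'a::semiring_1 ^ 'n ^ 'm) ** (0 :: 'a ^ 'k ^ 'n) = 0"
    "(0 :: 'a ^ 'n ^ 'm) ** (B :: 'a ^ 'k ^ 'n) = 0"
  by (simp_all add: matrix_matrix_mult_def vec_eq_iff)

lemma conv_nonzero:
  assumes "conv L0 f1 f2 (g, L) \<noteq> 0"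
  obtains g' where "(g, L) \<in> groupoid L0" "g' \<in> L" "f1 (g \<circ> inv g', act_set g' L) \<noteq> 0" "f2 (g', L) \<noteq> 0"
proof -
  have gL: "(g, L) \<in> groupoid L0" using assms by (auto simp: conv_def split: if_splits)
  have "\<exists>g'\<in>L. f1 (g \<circ> inv g', act_set g' L) ** f2 (g', L) \<noteq> 0"
  proof (rule ccontr)
    assume "\<not> ?thesis"
    then have "(\<Sum>\<^sub>\<infinity>g'\<in>L. f1 (g \<circ> inv g', act_set g' L) ** f2 (g', L)) = 0"
      by (intro infsum_0) auto
    then show False using assms by (simp add: conv_def split: if_splits)
  qed
  then show thesis using gL that by (metis matrix_mult_eq_0)
qed

text \<open>Continuity is that of a sum over a varying architecture, whose summand depends
  continuously on the arrow \<open>(g, L)\<close> and on \<open>g'\<close> in \<open>L\<close> and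
  vanishes unless \<open>g'\<close> lies in the compact set \<open>K2\<close>. The support has group
  components in the compact set of products from \<open>K1\<close> and \<open>K2\<close>.\<close>

lemma conv_Cc:
  fixes f1 f2 :: "('d::finite) emap \<times> 'd emap set \<Rightarrow> complex ^ 'n ^ ('n::finite)"
  assumes sep: "uniformly_separated L0" and f1: "f1 \<in> Cc L0" and f2: "f2 \<in> Cc L0"
  shows "conv L0 f1 f2 \<in> Cc L0"
proof -
  let ?Z = "groupoid_top L0"
  let ?D = "subtopology (prod_topology ?Z isoE_top) {(z, g). g \<in> snd z}"
  obtain K1 where K1: "compactin isoE_top K1" "\<And>g L. f1 (g, L) \<noteq> 0 \<Longrightarrow> g \<in> K1"
    by (rule Cc_support[OF f1]) iprover
  obtain K2 where K2: "compactin isoE_top K2" "\<And>g L. f2 (g, L) \<noteq> 0 \<Longrightarrow> g \<in> K2"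
    by (rule Cc_support[OF f2]) iprover
  \<comment> \<open>For \<open>p = ((g, L), g')\<close> the arrows \<open>a p\<close> and
    \<open>b p\<close> are the two factors whose product is \<open>(g, L)\<close>.\<close>
  define a where "a p = (fst (fst p) \<circ> inv (snd p), act_set (snd p) (snd (fst p)))"
    for p :: "('d emap \<times> 'd emap set) \<times> 'd emap"
  define b where "b p = (snd p, snd (fst p))" for p :: "('d emap \<times> 'd emap set) \<times> 'd emap"
  define F where "F p = f1 (a p) ** f2 (b p)" for p
  have tD: "topspace ?D = {((g, L), g'). L \<in> transversal L0 \<and> g \<in> L \<and> g' \<in> L}"
    using transversal_isoE by (auto simp: groupoid_def)
  have c1: "continuous_map ?D ?Z fst"
    by (intro continuous_map_from_subtopology continuous_map_fst)
  have c2: "continuous_map ?D isoE_top snd"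
    by (intro continuous_map_from_subtopology continuous_map_snd)
  have c3: "continuous_map ?D isoE_top (\<lambda>p. fst (fst p))"
    using continuous_map_compose[OF c1 continuous_map_groupoid_fst] by (simp add: o_def)
  have c4: "continuous_map ?D (fell_topology isoE_top) (\<lambda>p. snd (fst p))"
    using continuous_map_compose[OF c1 continuous_map_groupoid_snd] by (simp add: o_def)
  have "continuous_map ?D ?Z a"
    unfolding a_def continuous_map_into_groupoid
  proof (intro conjI ballI)
    show "(fst (fst p) \<circ> inv (snd p), act_set (snd p) (snd (fst p))) \<in> groupoid L0"
      if "p \<in> topspace ?D" for p
      using that unfolding tD by (auto intro!: groupoid_kernel)
    show "continuous_map ?D isoE_top (\<lambda>p. fst (fst p) \<circ> inv (snd p))"
      by (intro continuous_map_isoE_comp continuous_map_isoE_inv c2 c3)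
    show "continuous_map ?D (fell_topology isoE_top) (\<lambda>p. act_set (snd p) (snd (fst p)))"
      by (intro continuous_map_act_set c2 c4)
  qed
  from continuous_map_compose[OF this Cc_continuous[OF f1]]
  have f1a: "continuous_map ?D euclidean (\<lambda>p. f1 (a p))" by (simp add: o_def)
  have "continuous_map ?D ?Z b"
    unfolding b_def continuous_map_into_groupoid
  proof (intro conjI ballI c2 c4)
    show "(snd p, snd (fst p)) \<in> groupoid L0" if "p \<in> topspace ?D" for p
      using that unfolding tD by (auto simp: groupoid_def)
  qed
  from continuous_map_compose[OF this Cc_continuous[OF f2]]
  have f2b: "continuous_map ?D euclidean (\<lambda>p. f2 (b p))" by (simp add: o_def)
  have F: "continuous_map ?D euclidean F"
    unfolding continuous_map_euclidean_iff_tendsto F_def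
    using f1a[unfolded continuous_map_euclidean_iff_tendsto]
      f2b[unfolded continuous_map_euclidean_iff_tendsto]
    by (intro ballI tendsto_matrix_matrix_mult) (erule (1) bspec)+
  have "continuous_map ?Z euclidean (\<lambda>z. \<Sum>\<^sub>\<infinity>g\<in>snd z. F (z, g))"
  proof (rule continuous_map_fell_sum[OF sep continuous_map_groupoid_snd _ F K2(1)])
    show "snd z \<in> dynamical_hull L0" if "z \<in> topspace ?Z" for z
      using that transversal_hull by (auto simp: groupoid_def)
    show "F (z, g) = 0" if "g \<notin> K2" for z g
    proof -
      have "f2 (g, snd z) = 0" using K2(2) that by blast
      then show ?thesis by (simp add: F_def b_def matrix_mult_eq_0)
    qed
  qed
  then have "continuous_map ?Z euclidean (conv L0 f1 f2)"
    by (rule continuous_map_eq) (auto simp: conv_def F_def a_def b_def)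
  moreover have "g \<in> {g \<circ> h | g h. g \<in> K1 \<and> h \<in> K2}" if nz: "conv L0 f1 f2 (g, L) \<noteq> 0" for g L
  proof -
    obtain g' where g': "(g, L) \<in> groupoid L0" "g' \<in> L" "f1 (g \<circ> inv g', act_set g' L) \<noteq> 0" "f2 (g', L) \<noteq> 0"
      using nz by (rule conv_nonzero)
    then have "g' \<in> isoE" using transversal_isoE by (auto simp: groupoid_def)
    then have "g = (g \<circ> inv g') \<circ> g'" by simp
    then show ?thesis using K1(2)[OF g'(3)] K2(2)[OF g'(4)] by blast
  qed
  moreover have "conv L0 f1 f2 p = 0" if "p \<notin> groupoid L0" for p
    using that by (cases p) (simp add: conv_def)
  ultimately show ?thesis
    unfolding Cc_iff using compactin_isoE_comp[OF K1(1) K2(1)] by blast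
qed

text \<open>The involution of the groupoid algebra, extended by zero. It is needed to form
  \<open>a\<^sup>* a\<close> in the cubic map.\<close>

definition star ::
  "('d::finite) emap set \<Rightarrow> ('d emap \<times> 'd emap set \<Rightarrow> complex ^ 'n ^ 'n) \<Rightarrow>
   ('d emap \<times> 'd emap set \<Rightarrow> complex ^ 'n ^ ('n::finite))" where
  "star L0 f = (\<lambda>(g, L). if (g, L) \<in> groupoid L0 then dagger (f (inv g, act_set g L)) else 0)"

lemma dagger_0 [simp]: "dagger 0 = 0"
  by (simp add: dagger_def vec_eq_iff)

lemma star_Cc:
  fixes f :: "('d::finite) emap \<times> 'd emap set \<Rightarrow> complex ^ 'n ^ ('n::finite)"
  assumes f: "f \<in> Cc L0"
  shows "star L0 f \<in> Cc L0"
proof -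
  obtain K where K: "compactin isoE_top K" "\<And>g L. f (g, L) \<noteq> 0 \<Longrightarrow> g \<in> K"
    by (rule Cc_support[OF f]) iprover
  let ?Z = "groupoid_top L0"
  have "continuous_map ?Z ?Z (\<lambda>p. (inv (fst p), act_set (fst p) (snd p)))"
    unfolding continuous_map_into_groupoid
  proof (intro conjI ballI)
    show "(inv (fst p), act_set (fst p) (snd p)) \<in> groupoid L0" if "p \<in> topspace ?Z" for p
      using that groupoid_kernel[of "snd p" L0 id "fst p"] transversal_id[of "snd p" L0]
      by (cases p) (simp add: groupoid_iff)
    show "continuous_map ?Z isoE_top (\<lambda>p. inv (fst p))"
      by (intro continuous_map_isoE_inv continuous_map_groupoid_fst)
    show "continuous_map ?Z (fell_topology isoE_top) (\<lambda>p. act_set (fst p) (snd p))"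
      by (intro continuous_map_act_set continuous_map_groupoid_fst continuous_map_groupoid_snd)
  qed
  from continuous_map_compose[OF this Cc_continuous[OF f]]
  have "continuous_map ?Z euclidean (\<lambda>p. dagger (f (inv (fst p), act_set (fst p) (snd p))))"
    unfolding continuous_map_euclidean_iff_tendsto by (auto simp: o_def intro: tendsto_dagger)
  then have "continuous_map ?Z euclidean (star L0 f)"
    by (rule continuous_map_eq) (auto simp: star_def)
  moreover have "g \<in> inv ` K" if nz: "star L0 f (g, L) \<noteq> 0" for g L
  proof -
    have "(g, L) \<in> groupoid L0" using nz by (auto simp: star_def split: if_splits)
    then have g: "g \<in> isoE" using transversal_isoE by (auto simp: groupoid_def)
    have "f (inv g, act_set g L) \<noteq> 0" using nz by (auto simp: star_def split: if_splits)
    then have "inv g \<in> K" by (rule K(2))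
    then show ?thesis using g by (metis image_eqI isoE_inv_inv)
  qed
  moreover have "star L0 f p = 0" if "p \<notin> groupoid L0" for p
    using that by (cases p) (simp add: star_def)
  ultimately show ?thesis
    unfolding Cc_iff using compactin_isoE_inv[OF K(1)] by blast
qed

lemma Cc_combine:
  fixes f h :: "('d::finite) emap \<times> 'd emap set \<Rightarrow> complex ^ 'n ^ ('n::finite)"
  assumes f: "f \<in> Cc L0" and h: "h \<in> Cc L0"
  shows "(\<lambda>p. a *\<^sub>R f p + b *\<^sub>R h p) \<in> Cc L0"
proof -
  obtain K where K: "compactin isoE_top K" "\<And>g L. f (g, L) \<noteq> 0 \<Longrightarrow> g \<in> K"
    by (rule Cc_support[OF f]) iprover
  obtain K2 where K2: "compactin isoE_top K2" "\<And>g L. h (g, L) \<noteq> 0 \<Longrightarrow> g \<in> K2"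
    by (rule Cc_support[OF h]) iprover
  have "continuous_map (groupoid_top L0) euclidean (\<lambda>p. a *\<^sub>R f p + b *\<^sub>R h p)"
    using Cc_continuous[OF f] Cc_continuous[OF h]
    unfolding continuous_map_euclidean_iff_tendsto by (auto intro!: tendsto_intros)
  moreover have "g \<in> K \<union> K2" if "a *\<^sub>R f (g, L) + b *\<^sub>R h (g, L) \<noteq> 0" for g L
    using that K(2)[of g L] K2(2)[of g L] by (cases "f (g, L) = 0") auto
  moreover have "a *\<^sub>R f p + b *\<^sub>R h p = 0" if "p \<notin> groupoid L0" for p
    using that Cc_zero[OF f] Cc_zero[OF h] by simp
  ultimately show ?thesis
    unfolding Cc_iff using compactin_Un[OF K(1) K2(1)] by blast
qed

lemma Cc_diff: "f \<in> Cc L0 \<Longrightarrow> h \<in> Cc L0 \<Longrightarrow> f - h \<in> Cc L0"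
  and Cc_add: "f \<in> Cc L0 \<Longrightarrow> h \<in> Cc L0 \<Longrightarrow> (\<lambda>p. f p + h p) \<in> Cc L0"
  and Cc_diff_scale: "f \<in> Cc L0 \<Longrightarrow> h \<in> Cc L0 \<Longrightarrow> (\<lambda>p. f p - c *\<^sub>R h p) \<in> Cc L0"
  using Cc_combine[of f L0 h 1 "-1"] Cc_combine[of f L0 h 1 1] Cc_combine[of f L0 h 1 "-c"]
  by (simp_all add: fun_diff_def)


section \<open>Operators given by banded kernels\<close>

text \<open>The inner product on complex vectors is here the real one, that is, the real part of the
  Hermitian one; \<open>dagger\<close> is the adjoint for it as well.\<close>

lemma inner_dagger:
  fixes A :: "complex ^ 'n ^ ('n::finite)"
  shows "(A *v u) \<bullet> w = u \<bullet> (dagger A *v w)"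
proof -
  have c: "(a * x) \<bullet> y = x \<bullet> (cnj a * y)" for a x y :: complex
    by (simp add: inner_complex_def algebra_simps)
  have "(A *v u) \<bullet> w = (\<Sum>i\<in>UNIV. \<Sum>j\<in>UNIV. (A $ i $ j * u $ j) \<bullet> (w $ i))"
    by (simp add: inner_vec_def matrix_vector_mult_def inner_sum_left)
  also have "\<dots> = (\<Sum>j\<in>UNIV. \<Sum>i\<in>UNIV. u $ j \<bullet> (cnj (A $ i $ j) * w $ i))"
    by (subst sum.swap) (simp add: c)
  also have "\<dots> = u \<bullet> (dagger A *v w)"
    by (simp add: inner_vec_def matrix_vector_mult_def inner_sum_right dagger_def)
  finally show ?thesis .
qed

lemma dagger_dagger [simp]: "dagger (dagger A) = A"
  by (simp add: dagger_def vec_eq_iff)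

lemma matrix_vector_mult_scaleR_right:
  "(A :: complex ^ 'n ^ 'm) *v (c *\<^sub>R v) = c *\<^sub>R (A *v v)"
  by (simp add: matrix_vector_mult_def vec_eq_iff scaleR_sum_right)

lemma matrix_vector_mult_scaleR_left:
  "(c *\<^sub>R A :: complex ^ 'n ^ 'm) *v v = c *\<^sub>R (A *v v)"
  by (simp add: matrix_vector_mult_def vec_eq_iff scaleR_sum_right)

lemma matrix_vector_mult_smult_right:
  "(A :: complex ^ 'n ^ 'm) *v (c *s v) = c *s (A *v v)"
  by (simp add: matrix_vector_mult_def vec_eq_iff sum_distrib_left ac_simps)

lemma matrix_vector_mult_sum_left: "(\<Sum>i\<in>S. A i) *v v = (\<Sum>i\<in>S. (A i :: complex ^ 'n ^ 'm) *v v)"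
  by (induction S rule: infinite_finite_induct) (simp_all add: matrix_vector_mult_add_rdistrib)

lemma matrix_vector_mult_sum_right: "A *v (\<Sum>i\<in>S. v i) = (\<Sum>i\<in>S. (A :: complex ^ 'n ^ 'm) *v v i)"
  by (induction S rule: infinite_finite_induct) (simp_all add: matrix_vector_right_distrib)

text \<open>A crude estimate by entries. Only a bound that is uniform for matrices of fixed size
  matters, not its value.\<close>

lemma norm_matrix_vector_mult_le:
  fixes A :: "complex ^ ('n::finite) ^ 'n"
  shows "norm (A *v v) \<le> (real CARD('n))\<^sup>2 * norm A * norm v"
proof -
  have "norm ((A *v v) $ i) \<le> real CARD('n) * (norm A * norm v)" for i
  proof -
    have "norm ((A *v v) $ i) \<le> (\<Sum>j\<in>(UNIV :: 'n set). norm A * norm v)"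
      unfolding matrix_vector_mult_def vec_lambda_beta
    proof (rule sum_norm_le)
      fix j :: 'n
      have "norm (A $ i $ j) \<le> norm A" 
        by (rule order_trans[OF Finite_Cartesian_Product.norm_nth_le Finite_Cartesian_Product.norm_nth_le])
      then show "norm (A $ i $ j * v $ j) \<le> norm A * norm v"
        unfolding norm_mult by (intro mult_mono Finite_Cartesian_Product.norm_nth_le) auto
    qed
    then show ?thesis by simp
  qed
  then have "(\<Sum>i\<in>UNIV. norm ((A *v v) $ i)) \<le> (\<Sum>i\<in>(UNIV :: 'n set). real CARD('n) * (norm A * norm v))"
    by (intro sum_mono)
  then have "(\<Sum>i\<in>UNIV. norm ((A *v v) $ i)) \<le> (real CARD('n))\<^sup>2 * norm A * norm v"
    by (simp add: power2_eq_square mult.assoc)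
  moreover have "norm (A *v v) \<le> (\<Sum>i\<in>UNIV. norm ((A *v v) $ i))"
    unfolding norm_vec_def by (rule L2_set_le_sum) simp
  ultimately show ?thesis by linarith
qed


section \<open>Finitely supported vectors and the cubic estimates\<close>

text \<open>Banded kernels map this space into itself, and all inner products on it are finite sums.
  Bounds proved here are extended to \<open>ell2\<close> by truncation in
  \<open>mop_ell2\<close>.\<close>

definition fin_supp :: "'a set \<Rightarrow> ('a \<Rightarrow> complex ^ ('n::finite)) set" where
  "fin_supp L = {\<phi>. finite {x. \<phi> x \<noteq> 0} \<and> {x. \<phi> x \<noteq> 0} \<subseteq> L}"

text \<open>The real part of the inner product; the complex one is not needed.\<close>

definition ip :: "('a \<Rightarrow> complex ^ 'n) \<Rightarrow> ('a \<Rightarrow> complex ^ ('n::finite)) \<Rightarrow> real" where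
  "ip \<phi> \<psi> = (\<Sum>x | \<phi> x \<noteq> 0. \<phi> x \<bullet> \<psi> x)"

lemma ip_eq_sum:
  assumes "finite S" and "{x. \<phi> x \<noteq> 0} \<subseteq> S"
  shows "ip \<phi> \<psi> = (\<Sum>x\<in>S. \<phi> x \<bullet> \<psi> x)"
  unfolding ip_def using assms by (intro sum.mono_neutral_left) auto

lemma ip_commute:
  assumes "\<phi> \<in> fin_supp L" and "\<psi> \<in> fin_supp L"
  shows "ip \<phi> \<psi> = ip \<psi> \<phi>"
proof -
  let ?S = "{x. \<phi> x \<noteq> 0} \<union> {x. \<psi> x \<noteq> 0}"
  have "finite ?S" using assms by (simp add: fin_supp_def)
  then show ?thesis
    using ip_eq_sum[of ?S \<phi> \<psi>] ip_eq_sum[of ?S \<psi> \<phi>] by (simp add: inner_commute)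
qed

lemma fin_supp_combine:
  assumes "\<phi> \<in> fin_supp L" and "\<psi> \<in> fin_supp L"
  shows "(\<lambda>x. \<phi> x - c *\<^sub>R \<psi> x) \<in> fin_supp L"
proof -
  have "{x. \<phi> x - c *\<^sub>R \<psi> x \<noteq> 0} \<subseteq> {x. \<phi> x \<noteq> 0} \<union> {x. \<psi> x \<noteq> 0}" by auto
  then show ?thesis
    using assms unfolding fin_supp_def by (auto intro: finite_subset)
qed

lemma ip_combine_self:
  assumes "\<phi> \<in> fin_supp L" and "\<psi> \<in> fin_supp L"
  shows "ip (\<lambda>x. \<phi> x - c *\<^sub>R \<psi> x) (\<lambda>x. \<phi> x - c *\<^sub>R \<psi> x) =
    ip \<phi> \<phi> - 2 * c * ip \<phi> \<psi> + c\<^sup>2 * ip \<psi> \<psi>"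
proof -
  let ?S = "{x. \<phi> x \<noteq> 0} \<union> {x. \<psi> x \<noteq> 0}"
  have S: "finite ?S" using assms by (simp add: fin_supp_def)
  have "ip (\<lambda>x. \<phi> x - c *\<^sub>R \<psi> x) (\<lambda>x. \<phi> x - c *\<^sub>R \<psi> x) =
      (\<Sum>x\<in>?S. (\<phi> x - c *\<^sub>R \<psi> x) \<bullet> (\<phi> x - c *\<^sub>R \<psi> x))"
    using S by (rule ip_eq_sum) auto
  also have "\<dots> = (\<Sum>x\<in>?S. \<phi> x \<bullet> \<phi> x - 2 * c * (\<phi> x \<bullet> \<psi> x) + c\<^sup>2 * (\<psi> x \<bullet> \<psi> x))"
    by (intro sum.cong refl)
      (simp add: inner_diff_left inner_diff_right inner_commute power2_eq_square algebra_simps)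
  also have "\<dots> = ip \<phi> \<phi> - 2 * c * ip \<phi> \<psi> + c\<^sup>2 * ip \<psi> \<psi>"
    using S ip_eq_sum[of ?S \<phi> \<phi>] ip_eq_sum[of ?S \<phi> \<psi>] ip_eq_sum[of ?S \<psi> \<psi>]
    by (simp add: sum.distrib sum_subtractf sum_distrib_left)
  finally show ?thesis .
qed

lemma ip_nonneg [simp]: "0 \<le> ip \<phi> \<phi>"
  unfolding ip_def by (intro sum_nonneg) auto

lemma ip_scale:
  assumes "\<phi> \<in> fin_supp L"
  shows "ip (\<lambda>x. c *\<^sub>R \<phi> x) (\<lambda>x. c *\<^sub>R \<phi> x) = c\<^sup>2 * ip \<phi> \<phi>"
proof -
  have "finite {x. \<phi> x \<noteq> 0}" using assms by (simp add: fin_supp_def)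
  then have "ip (\<lambda>x. c *\<^sub>R \<phi> x) (\<lambda>x. c *\<^sub>R \<phi> x) = (\<Sum>x | \<phi> x \<noteq> 0. (c *\<^sub>R \<phi> x) \<bullet> (c *\<^sub>R \<phi> x))"
    by (rule ip_eq_sum) auto
  then show ?thesis
    by (simp add: ip_def sum_distrib_left power2_eq_square mult.assoc)
qed

lemma ip_Cauchy_Schwarz:
  assumes "\<phi> \<in> fin_supp L" and "\<psi> \<in> fin_supp L"
  shows "(ip \<phi> \<psi>)\<^sup>2 \<le> ip \<phi> \<phi> * ip \<psi> \<psi>"
proof -
  have q: "0 \<le> ip \<phi> \<phi> - 2 * c * ip \<phi> \<psi> + c\<^sup>2 * ip \<psi> \<psi>" for c
    using ip_nonneg[of "\<lambda>x. \<phi> x - c *\<^sub>R \<psi> x"] ip_combine_self[OF assms, of c] by simp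
  show ?thesis
  proof (cases "ip \<psi> \<psi> = 0")
    case True
    have "ip \<phi> \<psi> = 0"
    proof (rule ccontr)
      assume n: "ip \<phi> \<psi> \<noteq> 0"
      \<comment> \<open>The quadratic \<open>q\<close> has degenerated to an affine function of
        \<open>c\<close>; the witness is where it takes the value -1.\<close>
      show False
        using q[of "(ip \<phi> \<phi> + 1) / (2 * ip \<phi> \<psi>)"] n True by (simp add: field_simps)
    qed
    then show ?thesis using True by simp
  next
    case False
    then have p: "ip \<psi> \<psi> > 0" using ip_nonneg[of \<psi>] by linarith
    \<comment> \<open>The value of the quadratic \<open>q\<close> at its minimum.\<close>
    have "0 \<le> ip \<phi> \<phi> - (ip \<phi> \<psi>)\<^sup>2 / ip \<psi> \<psi>"
      using q[of "ip \<phi> \<psi> / ip \<psi> \<psi>"] p by (simp add: power2_eq_square field_simps)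
    then show ?thesis using p by (simp add: field_simps)
  qed
qed

text \<open>Here \<open>b\<close> stands for \<open>a\<^sup>* a\<close>, so that \<open>a\<close> is replaced by
  \<open>a - a a\<^sup>* a / (3 R\<^sup>2)\<close>. For \<open>t\<close> in the spectrum
  of \<open>a\<^sup>* a / R\<^sup>2\<close> the bound \<open>2 R / 3\<close> is the identity
  \<open>4/9 - t (1 - t/3)\<^sup>2 = (1 - t)\<^sup>2 (4 - t) / 9\<close>.\<close>

context
  fixes L :: "'a set" and a b :: "('a \<Rightarrow> complex ^ ('n::finite)) \<Rightarrow> ('a \<Rightarrow> complex ^ 'n)"
    and R :: real
  assumes a_fs: "\<And>\<phi>. \<phi> \<in> fin_supp L \<Longrightarrow> a \<phi> \<in> fin_supp L"
    and b_fs: "\<And>\<phi>. \<phi> \<in> fin_supp L \<Longrightarrow> b \<phi> \<in> fin_supp L"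
    and adj: "\<And>\<phi> \<psi>. \<phi> \<in> fin_supp L \<Longrightarrow> \<psi> \<in> fin_supp L \<Longrightarrow> ip (a \<psi>) (a \<phi>) = ip \<psi> (b \<phi>)"
    and lin: "\<And>\<phi> \<psi> c. \<phi> \<in> fin_supp L \<Longrightarrow> \<psi> \<in> fin_supp L \<Longrightarrow>
        a (\<lambda>x. \<phi> x - c *\<^sub>R \<psi> x) = (\<lambda>x. a \<phi> x - c *\<^sub>R a \<psi> x)"
    and R: "R > 0"
begin

text \<open>The factor \<open>(1 - t)\<^sup>2\<close> of the identity is realised by the vector
  \<open>y\<close>, which stands for \<open>(1 - t) \<phi>\<close>:
  \<open>4 R\<^sup>2 |y|\<^sup>2 - |a y|\<^sup>2\<close> corresponds to
  \<open>R\<^sup>2 (1 - t)\<^sup>2 (4 - t)\<close>, and it is nonnegative by the bound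
  \<open>R\<close> applied to \<open>y\<close>. Expanding everything in \<open>t0\<close>, ...,
  \<open>t3\<close> turns the identity into plain algebra.\<close>

lemma cubic_shrink:
  assumes bd: "\<And>\<phi>. \<phi> \<in> fin_supp L \<Longrightarrow> ip (a \<phi>) (a \<phi>) \<le> R\<^sup>2 * ip \<phi> \<phi>"
    and f: "\<phi> \<in> fin_supp L"
  defines "d \<equiv> \<lambda>x. a \<phi> x - (1 / (3 * R\<^sup>2)) *\<^sub>R a (b \<phi>) x"
  shows "ip d d \<le> (2 / 3 * R)\<^sup>2 * ip \<phi> \<phi>"
proof -
  define y where "y = (\<lambda>x. \<phi> x - (1 / R\<^sup>2) *\<^sub>R b \<phi> x)"
  define t0 where "t0 = ip \<phi> \<phi>"
  define t1 where "t1 = ip (a \<phi>) (a \<phi>)"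
  define t2 where "t2 = ip (b \<phi>) (b \<phi>)"
  define t3 where "t3 = ip (a (b \<phi>)) (a (b \<phi>))"
  have bf: "b \<phi> \<in> fin_supp L" and af: "a \<phi> \<in> fin_supp L" and abf: "a (b \<phi>) \<in> fin_supp L"
    using f a_fs b_fs by auto
  have y: "y \<in> fin_supp L" unfolding y_def using f bf by (rule fin_supp_combine)
  have t1': "ip \<phi> (b \<phi>) = t1" using adj[OF f f] by (simp add: t1_def)
  have "ip (a (b \<phi>)) (a \<phi>) = t2" using adj[OF f bf] by (simp add: t2_def)
  then have t2': "ip (a \<phi>) (a (b \<phi>)) = t2" using ip_commute[OF af abf] by simp
  have yy: "ip y y = t0 - 2 * (1 / R\<^sup>2) * t1 + (1 / R\<^sup>2)\<^sup>2 * t2"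
    unfolding y_def ip_combine_self[OF f bf] t1' by (simp add: t0_def t2_def)
  have ay: "ip (a y) (a y) = t1 - 2 * (1 / R\<^sup>2) * t2 + (1 / R\<^sup>2)\<^sup>2 * t3"
    unfolding y_def lin[OF f bf] ip_combine_self[OF af abf] t2' by (simp add: t1_def t3_def)
  have dd: "ip d d = t1 - 2 * (1 / (3 * R\<^sup>2)) * t2 + (1 / (3 * R\<^sup>2))\<^sup>2 * t3"
    unfolding d_def ip_combine_self[OF af abf] t2' by (simp add: t1_def t3_def)
  have id: "(2 / 3 * R)\<^sup>2 * t0 - ip d d = (4 * R\<^sup>2 * ip y y - ip (a y) (a y)) / 9"
    unfolding yy ay dd using R by (simp add: field_simps power2_eq_square)
  have "ip (a y) (a y) \<le> R\<^sup>2 * ip y y" using bd[OF y] .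
  moreover have "R\<^sup>2 * ip y y \<le> 4 * R\<^sup>2 * ip y y"
    by (intro mult_right_mono) auto
  ultimately have "ip (a y) (a y) \<le> 4 * R\<^sup>2 * ip y y" by (rule order_trans)
  then have "0 \<le> (2 / 3 * R)\<^sup>2 * t0 - ip d d" unfolding id by simp
  then show ?thesis by (simp add: t0_def)
qed

text \<open>Cauchy-Schwarz for \<open>|b \<phi>|\<^sup>2\<close>, the inner product of
  \<open>a (b \<phi>)\<close> and \<open>a \<phi>\<close>, gives
  \<open>|b \<phi>| \<le> e |a \<phi>|\<close>, and with it the bound \<open>e ^ 3\<close>. For the
  other bound, \<open>d = a y\<close> with \<open>y = \<phi> - c b \<phi>\<close>, and
  \<open>y\<close> is no longer than \<open>\<phi>\<close> because
  \<open>c e\<^sup>2 \<le> 1\<close>.\<close>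

lemma cubic_bounded:
  assumes e: "0 \<le> e" "e \<le> R"
    and bd: "\<And>\<phi>. \<phi> \<in> fin_supp L \<Longrightarrow> ip (a \<phi>) (a \<phi>) \<le> e\<^sup>2 * ip \<phi> \<phi>"
    and f: "\<phi> \<in> fin_supp L"
  defines "d \<equiv> \<lambda>x. a \<phi> x - (1 / (3 * R\<^sup>2)) *\<^sub>R a (b \<phi>) x"
  shows "ip d d \<le> e\<^sup>2 * ip \<phi> \<phi>"
    and "ip (a (b \<phi>)) (a (b \<phi>)) \<le> (e ^ 3)\<^sup>2 * ip \<phi> \<phi>"
proof -
  have bf: "b \<phi> \<in> fin_supp L" and af: "a \<phi> \<in> fin_supp L" and abf: "a (b \<phi>) \<in> fin_supp L"
    using f a_fs b_fs by auto
  define t1 where "t1 = ip (a \<phi>) (a \<phi>)"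
  define t2 where "t2 = ip (b \<phi>) (b \<phi>)"
  have "ip (a (b \<phi>)) (a \<phi>) = t2" using adj[OF f bf] by (simp add: t2_def)
  then have "t2\<^sup>2 \<le> ip (a (b \<phi>)) (a (b \<phi>)) * t1"
    using ip_Cauchy_Schwarz[OF abf af] by (simp add: t1_def)
  also have "\<dots> \<le> (e\<^sup>2 * t2) * t1"
    unfolding t2_def t1_def using bd[OF bf] by (intro mult_right_mono) auto
  finally have "t2 * t2 \<le> t2 * (e\<^sup>2 * t1)" by (simp add: power2_eq_square ac_simps)
  moreover have "0 \<le> t2" "0 \<le> t1" by (simp_all add: t1_def t2_def)
  ultimately have t21: "t2 \<le> e\<^sup>2 * t1"
    by (metis mult_le_cancel_left_pos order_le_less zero_le_mult_iff zero_le_power2)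
  have t10: "t1 \<le> e\<^sup>2 * ip \<phi> \<phi>" unfolding t1_def using bd[OF f] .
  have "ip (a (b \<phi>)) (a (b \<phi>)) \<le> e\<^sup>2 * t2" using bd[OF bf] by (simp add: t2_def)
  also have "\<dots> \<le> e\<^sup>2 * (e\<^sup>2 * (e\<^sup>2 * ip \<phi> \<phi>))"
    using t21 t10 by (meson mult_left_mono order_trans zero_le_power2)
  also have "\<dots> = (e ^ 3)\<^sup>2 * ip \<phi> \<phi>" by (simp add: power2_eq_square power3_eq_cube ac_simps)
  finally show "ip (a (b \<phi>)) (a (b \<phi>)) \<le> (e ^ 3)\<^sup>2 * ip \<phi> \<phi>" .
  define c where "c = 1 / (3 * R\<^sup>2)"
  have c: "c \<ge> 0" by (simp add: c_def)
  define y where "y = (\<lambda>x. \<phi> x - c *\<^sub>R b \<phi> x)"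
  have y: "y \<in> fin_supp L" unfolding y_def using f bf by (rule fin_supp_combine)
  have "e\<^sup>2 \<le> R\<^sup>2" using e by (intro power_mono)
  then have "e\<^sup>2 \<le> 3 * R\<^sup>2" by (smt (verit) zero_le_power2)
  then have "c * e\<^sup>2 \<le> 1" using R by (simp add: c_def field_simps)
  have "ip y y = ip \<phi> \<phi> - 2 * c * t1 + c\<^sup>2 * t2"
    unfolding y_def ip_combine_self[OF f bf] adj[OF f f, symmetric] t1_def t2_def ..
  also have "c\<^sup>2 * t2 \<le> c\<^sup>2 * (e\<^sup>2 * t1)" using t21 by (intro mult_left_mono) auto
  also have "\<dots> = (c * t1) * (c * e\<^sup>2)" by (simp add: power2_eq_square)
  also have "\<dots> \<le> (c * t1) * 1"
    using \<open>c * e\<^sup>2 \<le> 1\<close> c \<open>0 \<le> t1\<close> by (intro mult_left_mono) auto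
  finally have "ip y y \<le> ip \<phi> \<phi>" using mult_nonneg_nonneg[OF c \<open>0 \<le> t1\<close>] by simp
  moreover have "d = a y" unfolding d_def y_def lin[OF f bf] c_def ..
  ultimately show "ip d d \<le> e\<^sup>2 * ip \<phi> \<phi>"
    using bd[OF y] by (meson mult_left_mono order_trans zero_le_power2)
qed

end


section \<open>Kernel operators and Schur's test\<close>

definition mop :: "'a set \<Rightarrow> ('a \<Rightarrow> 'a \<Rightarrow> complex ^ 'n ^ 'n) \<Rightarrow>
    ('a \<Rightarrow> complex ^ 'n) \<Rightarrow> ('a \<Rightarrow> complex ^ ('n::finite))" where
  "mop L k \<phi> = (\<lambda>x. if x \<in> L then \<Sum>\<^sub>\<infinity>y\<in>L. k x y *v \<phi> y else 0)"

text \<open>Finiteness is listed separately because \<open>card\<close> of an infinite set is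
  0.\<close>

definition banded :: "'a set \<Rightarrow> ('a \<Rightarrow> 'a \<Rightarrow> complex ^ 'n ^ ('n::finite)) \<Rightarrow> nat \<Rightarrow> real \<Rightarrow> bool" where
  "banded L k M C \<longleftrightarrow> (\<forall>x\<in>L.
     finite {y \<in> L. k x y \<noteq> 0} \<and> card {y \<in> L. k x y \<noteq> 0} \<le> M \<and>
     finite {y \<in> L. k y x \<noteq> 0} \<and> card {y \<in> L. k y x \<noteq> 0} \<le> M \<and>
     (\<forall>y\<in>L. norm (k x y) \<le> C))"

text \<open>The square makes the sign of \<open>R\<close> irrelevant, see
  \<open>op_bound_abs\<close>. For banded kernels and \<open>R \<ge> 0\<close> this says that the
  operator norm on \<open>ell2 L\<close> is at most \<open>R\<close>, by
  \<open>mop_ell2\<close>.\<close>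

definition op_bound :: "'a set \<Rightarrow> ('a \<Rightarrow> 'a \<Rightarrow> complex ^ 'n ^ ('n::finite)) \<Rightarrow> real \<Rightarrow> bool" where
  "op_bound L k R \<longleftrightarrow> (\<forall>\<phi>\<in>fin_supp L. ip (mop L k \<phi>) (mop L k \<phi>) \<le> R\<^sup>2 * ip \<phi> \<phi>)"

lemma banded_row: "banded L k M C \<Longrightarrow> x \<in> L \<Longrightarrow> finite {y \<in> L. k x y \<noteq> 0}"
  and banded_col: "banded L k M C \<Longrightarrow> y \<in> L \<Longrightarrow> finite {x \<in> L. k x y \<noteq> 0}"
  by (auto simp: banded_def)

lemma mop_row:
  assumes "banded L k M C" and "x \<in> L"
  shows "mop L k \<phi> x = (\<Sum>y | y \<in> L \<and> k x y \<noteq> 0. k x y *v \<phi> y)"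
proof -
  have "(\<Sum>\<^sub>\<infinity>y\<in>L. k x y *v \<phi> y) = (\<Sum>y | y \<in> L \<and> k x y \<noteq> 0. k x y *v \<phi> y)"
    using banded_row[OF assms] by (intro infsum_eq_sum) auto
  then show ?thesis using assms(2) by (simp add: mop_def)
qed

lemma mop_eq_sum:
  assumes "finite S" and "S \<subseteq> L" and "x \<in> L"
    and "\<And>y. y \<in> L \<Longrightarrow> y \<notin> S \<Longrightarrow> k x y *v \<phi> y = 0"
  shows "mop L k \<phi> x = (\<Sum>y\<in>S. k x y *v \<phi> y)"
  using infsum_eq_sum[OF assms(1,2), of "\<lambda>y. k x y *v \<phi> y"] assms(3,4) by (simp add: mop_def)

lemma mop_outside: "x \<notin> L \<Longrightarrow> mop L k \<phi> x = 0"
  by (simp add: mop_def)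

lemma fin_suppD: "\<phi> \<in> fin_supp L \<Longrightarrow> finite {x. \<phi> x \<noteq> 0}"
    "\<phi> \<in> fin_supp L \<Longrightarrow> {x. \<phi> x \<noteq> 0} \<subseteq> L"
  by (auto simp: fin_supp_def)

lemma mop_fin_supp_eq:
  fixes k :: "'a \<Rightarrow> 'a \<Rightarrow> complex ^ 'n ^ ('n::finite)"
  assumes "\<phi> \<in> fin_supp L" and "x \<in> L"
  shows "mop L k \<phi> x = (\<Sum>y | \<phi> y \<noteq> 0. k x y *v \<phi> y)"
  using fin_suppD[OF assms(1)] assms(2) by (intro mop_eq_sum) auto

lemma mop_fin_supp:
  assumes b: "banded L k M C" and f: "\<phi> \<in> fin_supp L"
  shows "mop L k \<phi> \<in> fin_supp L"
proof -
  let ?S = "\<Union>y\<in>{y. \<phi> y \<noteq> 0}. {x \<in> L. k x y \<noteq> 0}"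
  have fin: "finite ?S" using fin_suppD[OF f] banded_col[OF b] by auto
  have "x \<in> ?S" if "mop L k \<phi> x \<noteq> 0" for x
  proof -
    have x: "x \<in> L" using that mop_outside by metis
    then have "(\<Sum>y | \<phi> y \<noteq> 0. k x y *v \<phi> y) \<noteq> 0"
      using that mop_fin_supp_eq[OF f] by metis
    then obtain y where "\<phi> y \<noteq> 0" "k x y *v \<phi> y \<noteq> 0"
      using sum.neutral by (metis (mono_tags, lifting) mem_Collect_eq)
    then show ?thesis using x by fastforce
  qed
  then have "{x. mop L k \<phi> x \<noteq> 0} \<subseteq> ?S" by blast
  then show ?thesis
    using finite_subset[OF _ fin] unfolding fin_supp_def by blast
qed

lemma mop_combine:
  assumes "banded L k M C"
  shows "mop L k (\<lambda>x. \<phi> x - c *\<^sub>R \<psi> x) = (\<lambda>x. mop L k \<phi> x - c *\<^sub>R mop L k \<psi> x)"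
proof
  fix x
  show "mop L k (\<lambda>x. \<phi> x - c *\<^sub>R \<psi> x) x = mop L k \<phi> x - c *\<^sub>R mop L k \<psi> x"
    by (cases "x \<in> L")
      (simp_all add: mop_row[OF assms] mop_outside matrix_vector_mult_diff_distrib
        matrix_vector_mult_scaleR_right sum_subtractf scaleR_sum_right)
qed

lemma mop_adjoint:
  assumes k: "banded L k M C" and f: "\<phi> \<in> fin_supp L" and g: "\<psi> \<in> fin_supp L"
    and k': "\<And>x y. x \<in> L \<Longrightarrow> y \<in> L \<Longrightarrow> k' x y = dagger (k y x)"
  shows "ip (mop L k \<phi>) \<psi> = ip \<phi> (mop L k' \<psi>)"
proof -
  have "ip (mop L k \<phi>) \<psi> = ip \<psi> (mop L k \<phi>)"
    using mop_fin_supp[OF k f] g by (rule ip_commute)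
  also have "\<dots> = (\<Sum>x | \<psi> x \<noteq> 0. \<Sum>y | \<phi> y \<noteq> 0. (k x y *v \<phi> y) \<bullet> \<psi> x)"
    unfolding ip_def
  proof (intro sum.cong refl)
    fix x assume "x \<in> {x. \<psi> x \<noteq> 0}"
    then have "x \<in> L" using fin_suppD(2)[OF g] by blast
    then show "\<psi> x \<bullet> mop L k \<phi> x = (\<Sum>y | \<phi> y \<noteq> 0. (k x y *v \<phi> y) \<bullet> \<psi> x)"
      by (simp add: mop_fin_supp_eq[OF f] inner_sum_right inner_commute)
  qed
  also have "\<dots> = (\<Sum>y | \<phi> y \<noteq> 0. \<Sum>x | \<psi> x \<noteq> 0. \<phi> y \<bullet> (dagger (k x y) *v \<psi> x))"
    by (subst sum.swap) (simp add: inner_dagger)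
  also have "\<dots> = ip \<phi> (mop L k' \<psi>)"
    unfolding ip_def
  proof (intro sum.cong refl)
    fix y assume "y \<in> {y. \<phi> y \<noteq> 0}"
    then have y: "y \<in> L" using fin_suppD(2)[OF f] by blast
    have "(\<Sum>x | \<psi> x \<noteq> 0. dagger (k x y) *v \<psi> x) = (\<Sum>x | \<psi> x \<noteq> 0. k' y x *v \<psi> x)"
      using fin_suppD(2)[OF g] y k' by (intro sum.cong) auto
    then show "(\<Sum>x | \<psi> x \<noteq> 0. \<phi> y \<bullet> (dagger (k x y) *v \<psi> x)) = \<phi> y \<bullet> mop L k' \<psi> y"
      by (simp add: mop_fin_supp_eq[OF g y] flip: inner_sum_right)
  qed
  finally show ?thesis .
qed

lemma mop_mult:
  fixes k :: "'a \<Rightarrow> 'a \<Rightarrow> complex ^ 'n ^ ('n::finite)"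
  assumes k1: "banded L k1 M1 C1" and k2: "banded L k2 M2 C2" and f: "\<phi> \<in> fin_supp L"
    and k: "\<And>x y. x \<in> L \<Longrightarrow> y \<in> L \<Longrightarrow> k x y = (\<Sum>\<^sub>\<infinity>z\<in>L. k1 x z ** k2 z y)"
  shows "mop L k \<phi> = mop L k1 (mop L k2 \<phi>)"
proof
  fix x
  show "mop L k \<phi> x = mop L k1 (mop L k2 \<phi>) x"
  proof (cases "x \<in> L")
    case x: True
    let ?S = "{z \<in> L. k1 x z \<noteq> 0}"
    have S: "finite ?S" using k1 x by (rule banded_row)
    have kx: "k x y = (\<Sum>z\<in>?S. k1 x z ** k2 z y)" if "y \<in> L" for y
      unfolding k[OF x that] using S by (intro infsum_eq_sum) (auto simp: matrix_mult_eq_0)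
    have "mop L k \<phi> x = (\<Sum>y | \<phi> y \<noteq> 0. k x y *v \<phi> y)" using f x by (rule mop_fin_supp_eq)
    also have "\<dots> = (\<Sum>y | \<phi> y \<noteq> 0. \<Sum>z\<in>?S. k1 x z *v (k2 z y *v \<phi> y))"
      using fin_suppD(2)[OF f]
      by (intro sum.cong refl) (auto simp: kx matrix_vector_mult_sum_left matrix_vector_mul_assoc)
    also have "\<dots> = (\<Sum>z\<in>?S. k1 x z *v (\<Sum>y | \<phi> y \<noteq> 0. k2 z y *v \<phi> y))"
      by (subst sum.swap) (simp add: matrix_vector_mult_sum_right)
    also have "\<dots> = (\<Sum>z\<in>?S. k1 x z *v mop L k2 \<phi> z)"
      by (intro sum.cong refl) (simp add: mop_fin_supp_eq[OF f])
    also have "\<dots> = mop L k1 (mop L k2 \<phi>) x" using mop_row[OF k1 x] by simp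
    finally show ?thesis .
  qed (simp add: mop_outside)
qed

text \<open>Cauchy-Schwarz in each row, which has at most \<open>M\<close> nonzero entries, costs
  one factor \<open>M\<close>. After exchanging the sums, each column has at most \<open>M\<close>
  nonzero entries, which costs the second.\<close>

lemma schur_test:
  fixes k :: "'a \<Rightarrow> 'a \<Rightarrow> complex ^ 'n ^ ('n::finite)"
  assumes b: "banded L k M C"
  shows "op_bound L k (real M * ((real CARD('n))\<^sup>2 * C))"
  unfolding op_bound_def
proof
  fix \<phi> :: "'a \<Rightarrow> complex ^ 'n" assume f: "\<phi> \<in> fin_supp L"
  define c where "c = (real CARD('n))\<^sup>2 * C"
  let ?X = "{x. mop L k \<phi> x \<noteq> 0}" and ?Y = "{y. \<phi> y \<noteq> 0}"
  have X: "finite ?X" "?X \<subseteq> L" using fin_suppD[OF mop_fin_supp[OF b f]] by auto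
  have Y: "finite ?Y" "?Y \<subseteq> L" using fin_suppD[OF f] by auto
  have kc: "norm (k x y *v v) \<le> c * norm v" if "x \<in> L" "y \<in> L" for x y v
  proof -
    have "norm (k x y *v v) \<le> (real CARD('n))\<^sup>2 * norm (k x y) * norm v"
      by (rule norm_matrix_vector_mult_le)
    also have "\<dots> \<le> (real CARD('n))\<^sup>2 * C * norm v"
      using b that by (intro mult_right_mono mult_left_mono) (auto simp: banded_def)
    finally show ?thesis by (simp add: c_def)
  qed
  have row: "(norm (mop L k \<phi> x))\<^sup>2 \<le> real M * c\<^sup>2 * (\<Sum>y\<in>?Y. if k x y \<noteq> 0 then (norm (\<phi> y))\<^sup>2 else 0)"
    if x: "x \<in> L" for x
  proof -
    let ?S = "{y \<in> ?Y. k x y \<noteq> 0}"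
    have S: "finite ?S" using Y by simp
    have "card ?S \<le> card {y \<in> L. k x y \<noteq> 0}"
      using banded_row[OF b x] Y by (intro card_mono) auto
    then have cS: "card ?S \<le> M" using b x unfolding banded_def by fastforce
    have "mop L k \<phi> x = (\<Sum>y\<in>?S. k x y *v \<phi> y)"
      using S Y x by (intro mop_eq_sum) auto
    \<comment> \<open>The factor 1 plays the second vector in the Cauchy-Schwarz inequality; its
      squares sum to the number of nonzero entries.\<close>
    then have "norm (mop L k \<phi> x) \<le> (\<Sum>y\<in>?S. norm (k x y *v \<phi> y) * 1)"
      by (simp add: norm_sum)
    then have "(norm (mop L k \<phi> x))\<^sup>2 \<le> (\<Sum>y\<in>?S. norm (k x y *v \<phi> y) * 1)\<^sup>2"
      by (intro power_mono) auto
    also have "\<dots> \<le> (\<Sum>y\<in>?S. (norm (k x y *v \<phi> y))\<^sup>2) * (\<Sum>y\<in>?S. 1\<^sup>2)"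
      by (rule Cauchy_Schwarz_ineq_sum)
    also have "\<dots> = real (card ?S) * (\<Sum>y\<in>?S. (norm (k x y *v \<phi> y))\<^sup>2)" by simp
    also have "\<dots> \<le> real M * (\<Sum>y\<in>?S. c\<^sup>2 * (norm (\<phi> y))\<^sup>2)"
    proof (intro mult_mono sum_mono)
      fix y assume "y \<in> ?S"
      then have "norm (k x y *v \<phi> y) \<le> c * norm (\<phi> y)" using kc[OF x] Y by auto
      then have "(norm (k x y *v \<phi> y))\<^sup>2 \<le> (c * norm (\<phi> y))\<^sup>2" by (intro power_mono) auto
      then show "(norm (k x y *v \<phi> y))\<^sup>2 \<le> c\<^sup>2 * (norm (\<phi> y))\<^sup>2" by (simp add: power_mult_distrib)
    qed (use cS in \<open>auto intro: sum_nonneg\<close>)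
    also have "\<dots> = real M * c\<^sup>2 * (\<Sum>y\<in>?Y. if k x y \<noteq> 0 then (norm (\<phi> y))\<^sup>2 else 0)"
      using Y by (simp add: sum.If_cases sum_distrib_left Int_def conj_commute mult.assoc)
    finally show ?thesis .
  qed
  have "ip (mop L k \<phi>) (mop L k \<phi>) = (\<Sum>x\<in>?X. (norm (mop L k \<phi> x))\<^sup>2)"
    by (simp add: ip_def power2_norm_eq_inner)
  also have "\<dots> \<le> (\<Sum>x\<in>?X. real M * c\<^sup>2 * (\<Sum>y\<in>?Y. if k x y \<noteq> 0 then (norm (\<phi> y))\<^sup>2 else 0))"
    using X row by (intro sum_mono) auto
  also have "\<dots> = real M * c\<^sup>2 * (\<Sum>y\<in>?Y. \<Sum>x\<in>?X. if k x y \<noteq> 0 then (norm (\<phi> y))\<^sup>2 else 0)"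
    by (subst sum.swap) (simp add: sum_distrib_left)
  also have "\<dots> \<le> real M * c\<^sup>2 * (\<Sum>y\<in>?Y. real M * (norm (\<phi> y))\<^sup>2)"
  proof (intro mult_left_mono sum_mono)
    fix y assume "y \<in> ?Y"
    then have y: "y \<in> L" using Y by blast
    have "card {x \<in> ?X. k x y \<noteq> 0} \<le> card {x \<in> L. k x y \<noteq> 0}"
      using banded_col[OF b y] X by (intro card_mono) auto
    then have "card {x \<in> ?X. k x y \<noteq> 0} \<le> M" using b y unfolding banded_def by fastforce
    then have "real (card {x \<in> ?X. k x y \<noteq> 0}) * (norm (\<phi> y))\<^sup>2 \<le> real M * (norm (\<phi> y))\<^sup>2"
      by (intro mult_right_mono) auto
    then show "(\<Sum>x\<in>?X. if k x y \<noteq> 0 then (norm (\<phi> y))\<^sup>2 else 0) \<le> real M * (norm (\<phi> y))\<^sup>2"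
      using X by (simp add: sum.If_cases Int_def conj_commute)
  qed auto
  also have "\<dots> = (real M * c)\<^sup>2 * (\<Sum>y\<in>?Y. (norm (\<phi> y))\<^sup>2)"
    by (simp add: power_mult_distrib power2_eq_square[of "real M"] flip: sum_distrib_left)
  also have "\<dots> = (real M * c)\<^sup>2 * ip \<phi> \<phi>"
    by (simp add: ip_def power2_norm_eq_inner)
  finally show "ip (mop L k \<phi>) (mop L k \<phi>) \<le> (real M * ((real CARD('n))\<^sup>2 * C))\<^sup>2 * ip \<phi> \<phi>"
    by (simp add: c_def)
qed


section \<open>Operators on square-summable families\<close>

lemma ell2_norm_nonneg [simp]: "0 \<le> ell2_norm L \<phi>"
  by (simp add: ell2_norm_def infsum_nonneg)

lemma ell2_norm_sq: "(ell2_norm L \<phi>)\<^sup>2 = (\<Sum>\<^sub>\<infinity>x\<in>L. (norm (\<phi> x))\<^sup>2)"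
  by (simp add: ell2_norm_def infsum_nonneg)

lemma ell2_outside: "\<phi> \<in> ell2 L \<Longrightarrow> x \<notin> L \<Longrightarrow> \<phi> x = 0"
  by (simp add: ell2_def)

lemma ell2_finite_sum_le:
  assumes "\<phi> \<in> ell2 L" and "finite S" and "S \<subseteq> L"
  shows "(\<Sum>x\<in>S. (norm (\<phi> x))\<^sup>2) \<le> (ell2_norm L \<phi>)\<^sup>2"
  unfolding ell2_norm_sq using assms
  by (intro finite_sum_le_infsum) (auto simp: ell2_def)

text \<open>Bounding the finite partial sums gives square-summability and the norm estimate at the
  same time.\<close>

lemma ell2I:
  assumes z: "\<And>x. x \<notin> L \<Longrightarrow> \<phi> x = 0" and B: "B \<ge> 0"
    and S: "\<And>S. finite S \<Longrightarrow> S \<subseteq> L \<Longrightarrow> (\<Sum>x\<in>S. (norm (\<phi> x))\<^sup>2) \<le> B\<^sup>2"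
  shows "\<phi> \<in> ell2 L" and "ell2_norm L \<phi> \<le> B"
proof -
  have s: "(\<lambda>x. (norm (\<phi> x))\<^sup>2) summable_on L"
  proof (rule nonneg_bdd_above_summable_on)
    show "bdd_above (sum (\<lambda>x. (norm (\<phi> x))\<^sup>2) ` {F. F \<subseteq> L \<and> finite F})"
      using S by (auto intro: bdd_aboveI2[where M = "B\<^sup>2"])
  qed auto
  then show "\<phi> \<in> ell2 L" using z by (simp add: ell2_def)
  have "(\<Sum>\<^sub>\<infinity>x\<in>L. (norm (\<phi> x))\<^sup>2) \<le> B\<^sup>2"
    using s S by (intro infsum_le_finite_sums) auto
  then show "ell2_norm L \<phi> \<le> B"
    unfolding ell2_norm_def using B by (simp add: real_le_lsqrt)
qed

lemma ell2_add:
  assumes f: "\<phi> \<in> ell2 L" and g: "\<psi> \<in> ell2 L"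
  shows "(\<lambda>x. \<phi> x + \<psi> x) \<in> ell2 L"
    and "ell2_norm L (\<lambda>x. \<phi> x + \<psi> x) \<le> ell2_norm L \<phi> + ell2_norm L \<psi>"
proof -
  have S: "(\<Sum>x\<in>S. (norm (\<phi> x + \<psi> x))\<^sup>2) \<le> (ell2_norm L \<phi> + ell2_norm L \<psi>)\<^sup>2"
    if "finite S" "S \<subseteq> L" for S
  proof -
    have "L2_set (\<lambda>x. norm (\<phi> x + \<psi> x)) S \<le> L2_set (\<lambda>x. norm (\<phi> x) + norm (\<psi> x)) S"
      by (intro L2_set_mono norm_triangle_ineq) auto
    also have "\<dots> \<le> L2_set (\<lambda>x. norm (\<phi> x)) S + L2_set (\<lambda>x. norm (\<psi> x)) S"
      by (rule L2_set_triangle_ineq)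
    also have "\<dots> \<le> ell2_norm L \<phi> + ell2_norm L \<psi>"
      unfolding L2_set_def
      using ell2_finite_sum_le[OF f that] ell2_finite_sum_le[OF g that]
      by (intro add_mono real_le_lsqrt) (auto intro: sum_nonneg)
    finally have "(L2_set (\<lambda>x. norm (\<phi> x + \<psi> x)) S)\<^sup>2 \<le> (ell2_norm L \<phi> + ell2_norm L \<psi>)\<^sup>2"
      by (intro power_mono) auto
    then show ?thesis by (simp add: L2_set_def sum_nonneg)
  qed
  show "(\<lambda>x. \<phi> x + \<psi> x) \<in> ell2 L"
    and "ell2_norm L (\<lambda>x. \<phi> x + \<psi> x) \<le> ell2_norm L \<phi> + ell2_norm L \<psi>"
    by (rule ell2I[OF _ _ S]; simp add: ell2_outside[OF f] ell2_outside[OF g])+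
qed

lemma norm_smult_vec: "norm (c *s (v :: complex ^ ('n::finite))) = norm c * norm v"
  by (simp add: norm_vec_def norm_mult L2_set_right_distrib)

lemma ell2_smult:
  assumes f: "\<phi> \<in> ell2 L"
  shows "(\<lambda>x. c *s \<phi> x) \<in> ell2 L" and "ell2_norm L (\<lambda>x. c *s \<phi> x) = norm c * ell2_norm L \<phi>"
proof -
  show "(\<lambda>x. c *s \<phi> x) \<in> ell2 L"
    using f by (auto simp: ell2_def norm_smult_vec power_mult_distrib intro: summable_on_cmult_right)
  have "(\<Sum>\<^sub>\<infinity>x\<in>L. (norm (c *s \<phi> x))\<^sup>2) = (norm c)\<^sup>2 * (\<Sum>\<^sub>\<infinity>x\<in>L. (norm (\<phi> x))\<^sup>2)"
    using f by (simp add: norm_smult_vec power_mult_distrib infsum_cmult_right ell2_def)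
  then show "ell2_norm L (\<lambda>x. c *s \<phi> x) = norm c * ell2_norm L \<phi>"
    by (simp add: ell2_norm_def real_sqrt_mult)
qed

lemma ell2_diff:
  assumes f: "\<phi> \<in> ell2 L" and g: "\<psi> \<in> ell2 L"
  shows "(\<lambda>x. \<phi> x - \<psi> x) \<in> ell2 L"
    and "ell2_norm L (\<lambda>x. \<phi> x - \<psi> x) \<le> ell2_norm L \<phi> + ell2_norm L \<psi>"
  using ell2_add[OF f ell2_smult(1)[OF g, of "-1"]] ell2_smult(2)[OF g, of "-1"]
  by (simp_all add: vector_sneg_minus1[symmetric])

lemma ell2_norm_minus_commute: "ell2_norm L (\<lambda>x. \<phi> x - \<psi> x) = ell2_norm L (\<lambda>x. \<psi> x - \<phi> x)"
  by (simp add: ell2_norm_def norm_minus_commute)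

lemma ell2_zero: "(\<lambda>x. 0) \<in> ell2 L" "ell2_norm L (\<lambda>x. 0) = 0"
  by (simp_all add: ell2_def ell2_norm_def)

lemma ell2_norm_eq_0:
  assumes "\<phi> \<in> ell2 L" and "ell2_norm L \<phi> = 0"
  shows "\<phi> = (\<lambda>x. 0)"
proof
  fix x
  show "\<phi> x = 0"
  proof (cases "x \<in> L")
    case True
    then show ?thesis using ell2_finite_sum_le[OF assms(1), of "{x}"] assms(2) by simp
  qed (simp add: ell2_outside[OF assms(1)])
qed

lemma fin_supp_ell2:
  assumes "\<phi> \<in> fin_supp L"
  shows "\<phi> \<in> ell2 L" and "(ell2_norm L \<phi>)\<^sup>2 = ip \<phi> \<phi>"
proof -
  have eq: "(\<Sum>\<^sub>\<infinity>x\<in>L. (norm (\<phi> x))\<^sup>2) = ip \<phi> \<phi>"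
    unfolding ip_def power2_norm_eq_inner using fin_suppD[OF assms]
    by (intro infsum_eq_sum) auto
  show "(ell2_norm L \<phi>)\<^sup>2 = ip \<phi> \<phi>" using eq by (simp add: ell2_norm_sq)
  have "(\<lambda>x. (norm (\<phi> x))\<^sup>2) summable_on {x. \<phi> x \<noteq> 0}"
    using fin_suppD[OF assms] by simp
  then have "(\<lambda>x. (norm (\<phi> x))\<^sup>2) summable_on L"
    using fin_suppD(2)[OF assms] by (subst summable_on_cong_neutral[where T = "{x. \<phi> x \<noteq> 0}"]) auto
  then show "\<phi> \<in> ell2 L" using fin_suppD(2)[OF assms] by (auto simp: ell2_def)
qed

text \<open>Finitely many rows only see the finitely many columns in \<open>T\<close>. Over these
  rows the vector may be truncated to \<open>T\<close>, where the bound for finitely supported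
  vectors applies.\<close>

lemma mop_ell2:
  assumes b: "banded L k M C" and R: "op_bound L k R" "R \<ge> 0" and f: "\<phi> \<in> ell2 L"
  shows "mop L k \<phi> \<in> ell2 L" and "ell2_norm L (mop L k \<phi>) \<le> R * ell2_norm L \<phi>"
proof -
  have S: "(\<Sum>x\<in>S. (norm (mop L k \<phi> x))\<^sup>2) \<le> (R * ell2_norm L \<phi>)\<^sup>2" if S: "finite S" "S \<subseteq> L" for S
  proof -
    define T where "T = (\<Union>x\<in>S. {y \<in> L. k x y \<noteq> 0})"
    have T: "finite T" "T \<subseteq> L" using S banded_row[OF b] by (auto simp: T_def)
    define \<psi> where "\<psi> y = (if y \<in> T then \<phi> y else 0)" for y
    have supp: "{y. \<psi> y \<noteq> 0} \<subseteq> T" by (auto simp: \<psi>_def)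
    then have p: "\<psi> \<in> fin_supp L" using T finite_subset unfolding fin_supp_def by blast
    have eq: "mop L k \<phi> x = mop L k \<psi> x" if "x \<in> S" for x
    proof -
      have "x \<in> L" using that S by blast
      then show ?thesis
        unfolding mop_row[OF b \<open>x \<in> L\<close>] using that by (intro sum.cong refl) (auto simp: \<psi>_def T_def)
    qed
    have m: "mop L k \<psi> \<in> fin_supp L" using b p by (rule mop_fin_supp)
    have "(\<Sum>x\<in>S. (norm (mop L k \<phi> x))\<^sup>2) = (\<Sum>x\<in>S. (norm (mop L k \<psi> x))\<^sup>2)"
      using eq by simp
    also have "\<dots> \<le> ip (mop L k \<psi>) (mop L k \<psi>)"
      using ell2_finite_sum_le[OF fin_supp_ell2(1)[OF m] S] fin_supp_ell2(2)[OF m] by simp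
    also have "\<dots> \<le> R\<^sup>2 * ip \<psi> \<psi>" using R(1) p by (simp add: op_bound_def)
    also have "ip \<psi> \<psi> = (\<Sum>x\<in>T. (norm (\<phi> x))\<^sup>2)"
      unfolding ip_eq_sum[OF T(1) supp] by (simp add: \<psi>_def power2_norm_eq_inner)
    also have "R\<^sup>2 * \<dots> \<le> R\<^sup>2 * (ell2_norm L \<phi>)\<^sup>2"
      using ell2_finite_sum_le[OF f T] by (intro mult_left_mono) auto
    finally show ?thesis by (simp add: power_mult_distrib)
  qed
  show "mop L k \<phi> \<in> ell2 L" and "ell2_norm L (mop L k \<phi>) \<le> R * ell2_norm L \<phi>"
    by (rule ell2I[OF _ _ S]; simp add: mop_outside R)+
qed

lemma op_bound_abs: "op_bound L k \<bar>R\<bar> \<longleftrightarrow> op_bound L k R"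
  by (simp add: op_bound_def)

lemma mop_bounded_ops:
  fixes k :: "'a \<Rightarrow> 'a \<Rightarrow> complex ^ 'n ^ ('n::finite)"
  assumes b: "banded L k M C"
  shows "restrict (mop L k) (ell2 L) \<in> bounded_ops L"
proof -
  obtain R where R: "op_bound L k R" "R \<ge> 0"
    using schur_test[OF b] op_bound_abs abs_ge_zero by blast
  have add: "mop L k (\<lambda>x. \<phi> x + \<psi> x) = (\<lambda>x. mop L k \<phi> x + mop L k \<psi> x)" for \<phi> \<psi>
  proof
    fix x
    show "mop L k (\<lambda>x. \<phi> x + \<psi> x) x = mop L k \<phi> x + mop L k \<psi> x"
      by (cases "x \<in> L")
        (simp_all add: mop_row[OF b] mop_outside matrix_vector_right_distrib sum.distrib)
  qed
  have scale: "mop L k (\<lambda>x. c *s \<phi> x) = (\<lambda>x. c *s mop L k \<phi> x)" for c \<phi>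
  proof
    fix x
    show "mop L k (\<lambda>x. c *s \<phi> x) x = c *s mop L k \<phi> x"
      by (cases "x \<in> L")
        (simp_all add: mop_row[OF b] mop_outside matrix_vector_mult_smult_right
          vec_eq_iff sum_distrib_left)
  qed
  show ?thesis
    unfolding bounded_ops_def
  proof (intro CollectI conjI ballI allI exI)
    show "restrict (mop L k) (ell2 L) \<in> ell2 L \<rightarrow>\<^sub>E ell2 L"
      using mop_ell2(1)[OF b R] by simp
    show "ell2_norm L (restrict (mop L k) (ell2 L) \<phi>) \<le> R * ell2_norm L \<phi>" if "\<phi> \<in> ell2 L" for \<phi>
      using mop_ell2(2)[OF b R that] that by simp
  qed (simp_all add: add scale ell2_add(1) ell2_smult(1))
qed


section \<open>Distance in operator norm\<close>

text \<open>The inequality form of operator norm distance at most \<open>r\<close>. It avoids the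
  supremum in \<open>op_norm_on\<close>; the two are tied together by \<open>op_norm_on_le\<close>
  and \<open>op_close_op_norm_on\<close>.\<close>

definition op_close :: "'a set \<Rightarrow> (('a \<Rightarrow> complex ^ 'n) \<Rightarrow> ('a \<Rightarrow> complex ^ 'n)) \<Rightarrow>
    (('a \<Rightarrow> complex ^ 'n) \<Rightarrow> ('a \<Rightarrow> complex ^ ('n::finite))) \<Rightarrow> real \<Rightarrow> bool" where
  "op_close L S T r \<longleftrightarrow> (\<forall>\<phi>\<in>ell2 L. ell2_norm L (\<lambda>x. S \<phi> x - T \<phi> x) \<le> r * ell2_norm L \<phi>)"

lemma bounded_ops_ell2: "T \<in> bounded_ops L \<Longrightarrow> \<phi> \<in> ell2 L \<Longrightarrow> T \<phi> \<in> ell2 L"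
  by (auto simp: bounded_ops_def)

lemma op_close_commute: "op_close L S T r \<longleftrightarrow> op_close L T S r"
proof -
  have "ell2_norm L (\<lambda>x. S \<phi> x - T \<phi> x) = ell2_norm L (\<lambda>x. T \<phi> x - S \<phi> x)" for \<phi>
    by (rule ell2_norm_minus_commute)
  then show ?thesis by (simp add: op_close_def)
qed

lemma op_close_trans:
  assumes "S \<in> bounded_ops L" "T \<in> bounded_ops L" "U \<in> bounded_ops L"
    and "op_close L S T r" "op_close L T U q"
  shows "op_close L S U (r + q)"
  unfolding op_close_def
proof
  fix \<phi> :: "'a \<Rightarrow> complex ^ 'b" assume f: "\<phi> \<in> ell2 L"
  have eq: "(\<lambda>x. S \<phi> x - U \<phi> x) = (\<lambda>x. (S \<phi> x - T \<phi> x) + (T \<phi> x - U \<phi> x))" by simp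
  have "ell2_norm L (\<lambda>x. S \<phi> x - U \<phi> x) \<le>
      ell2_norm L (\<lambda>x. S \<phi> x - T \<phi> x) + ell2_norm L (\<lambda>x. T \<phi> x - U \<phi> x)"
    unfolding eq by (intro ell2_add(2) ell2_diff(1) assms(1-3)[THEN bounded_ops_ell2, OF f])
  also have "\<dots> \<le> r * ell2_norm L \<phi> + q * ell2_norm L \<phi>"
    using assms(4,5) f by (intro add_mono) (auto simp: op_close_def)
  finally show "ell2_norm L (\<lambda>x. S \<phi> x - U \<phi> x) \<le> (r + q) * ell2_norm L \<phi>"
    by (simp add: algebra_simps)
qed

lemma op_close_mono: "op_close L S T r \<Longrightarrow> r \<le> q \<Longrightarrow> op_close L S T q"
  unfolding op_close_def
  by (auto intro: order_trans[OF _ mult_right_mono[OF _ ell2_norm_nonneg]])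

text \<open>Equality also needs \<open>bounded_ops\<close> to fix the values off
  \<open>ell2 L\<close>, where its members are \<open>undefined\<close>. The lemma yields uniqueness
  of limits in \<open>left_regular_ext\<close>.\<close>

lemma op_close_eq:
  assumes S: "S \<in> bounded_ops L" and T: "T \<in> bounded_ops L" and c: "\<And>r. r > 0 \<Longrightarrow> op_close L S T r"
  shows "S = T"
proof (rule PiE_ext)
  show "S \<in> ell2 L \<rightarrow>\<^sub>E ell2 L" "T \<in> ell2 L \<rightarrow>\<^sub>E ell2 L" using S T by (auto simp: bounded_ops_def)
  fix \<phi> :: "'a \<Rightarrow> complex ^ 'b" assume f: "\<phi> \<in> ell2 L"
  have "ell2_norm L (\<lambda>x. S \<phi> x - T \<phi> x) \<le> 0"
  proof (rule field_le_epsilon)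
    fix e :: real assume e: "e > 0"
    define r where "r = e / (ell2_norm L \<phi> + 1)"
    have n: "0 < ell2_norm L \<phi> + 1" using ell2_norm_nonneg[of L \<phi>] by linarith
    then have "r > 0" using e by (simp add: r_def)
    then have "ell2_norm L (\<lambda>x. S \<phi> x - T \<phi> x) \<le> r * ell2_norm L \<phi>"
      using c f by (simp add: op_close_def)
    also have "\<dots> \<le> r * (ell2_norm L \<phi> + 1)" using \<open>r > 0\<close> by (intro mult_left_mono) auto
    also have "\<dots> = e" using n by (simp add: r_def)
    finally show "ell2_norm L (\<lambda>x. S \<phi> x - T \<phi> x) \<le> 0 + e" by simp
  qed
  then have "ell2_norm L (\<lambda>x. S \<phi> x - T \<phi> x) = 0"
    using ell2_norm_nonneg order_antisym by blast
  then have "(\<lambda>x. S \<phi> x - T \<phi> x) = (\<lambda>x. 0)"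
    using ell2_diff(1)[OF bounded_ops_ell2[OF S f] bounded_ops_ell2[OF T f]] ell2_norm_eq_0 by blast
  then show "S \<phi> = T \<phi>" by (simp add: fun_eq_iff)
qed

lemma op_norm_on_le:
  assumes "op_close L S T r" and "r \<ge> 0"
  shows "op_norm_on (ell2 L) (ell2_norm L) (S - T) (ell2_norm L) \<le> r"
  unfolding op_norm_on_def
proof (rule cSup_least)
  show "{ell2_norm L ((S - T) v) | v. v \<in> ell2 L \<and> ell2_norm L v \<le> 1} \<noteq> {}"
    by (auto intro!: exI[of _ "\<lambda>x. 0"] simp: ell2_zero)
  fix q assume "q \<in> {ell2_norm L ((S - T) v) | v. v \<in> ell2 L \<and> ell2_norm L v \<le> 1}"
  then obtain v where v: "q = ell2_norm L (\<lambda>x. S v x - T v x)" "v \<in> ell2 L" "ell2_norm L v \<le> 1"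
    by (auto simp: fun_diff_def)
  have "q \<le> r * ell2_norm L v" using assms(1) v by (simp add: op_close_def)
  also have "\<dots> \<le> r * 1" using v(3) assms(2) by (rule mult_left_mono)
  finally show "q \<le> r" by simp
qed

text \<open>Boundedness of both operators makes the supremum finite; homogeneity extends the
  estimate from the unit ball to all vectors, where a vector of norm 0 must be treated apart because
  it cannot be normalised.\<close>

lemma op_close_op_norm_on:
  assumes S: "S \<in> bounded_ops L" and T: "T \<in> bounded_ops L"
  defines "r \<equiv> op_norm_on (ell2 L) (ell2_norm L) (S - T) (ell2_norm L)"
  shows "op_close L S T r" and "r \<ge> 0"
proof -
  obtain A where A: "\<And>\<phi>. \<phi> \<in> ell2 L \<Longrightarrow> ell2_norm L (S \<phi>) \<le> A * ell2_norm L \<phi>"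
    using S unfolding bounded_ops_def by blast
  obtain B where B: "\<And>\<phi>. \<phi> \<in> ell2 L \<Longrightarrow> ell2_norm L (T \<phi>) \<le> B * ell2_norm L \<phi>"
    using T unfolding bounded_ops_def by blast
  let ?X = "{ell2_norm L ((S - T) v) | v. v \<in> ell2 L \<and> ell2_norm L v \<le> 1}"
  have bdd: "bdd_above ?X"
  proof (rule bdd_aboveI)
    fix q assume "q \<in> ?X"
    then obtain v where v: "q = ell2_norm L (\<lambda>x. S v x - T v x)" "v \<in> ell2 L" "ell2_norm L v \<le> 1"
      by (auto simp: fun_diff_def)
    have "q \<le> ell2_norm L (S v) + ell2_norm L (T v)"
      unfolding v(1) by (intro ell2_diff bounded_ops_ell2[OF S v(2)] bounded_ops_ell2[OF T v(2)])
    also have "\<dots> \<le> \<bar>A\<bar> * ell2_norm L v + \<bar>B\<bar> * ell2_norm L v"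
      using A[OF v(2)] B[OF v(2)]
      by (intro add_mono; elim order_trans) (auto intro: mult_right_mono)
    also have "\<dots> \<le> \<bar>A\<bar> * 1 + \<bar>B\<bar> * 1" using v(3) by (intro add_mono mult_left_mono) auto
    finally show "q \<le> \<bar>A\<bar> + \<bar>B\<bar>" by simp
  qed
  have le: "ell2_norm L (\<lambda>x. S v x - T v x) \<le> r" if "v \<in> ell2 L" "ell2_norm L v \<le> 1" for v
  proof -
    have "ell2_norm L ((S - T) v) \<in> ?X" using that by blast
    then have "ell2_norm L ((S - T) v) \<le> r"
      unfolding r_def op_norm_on_def using bdd by (rule cSup_upper)
    then show ?thesis by (simp add: fun_diff_def)
  qed
  show "r \<ge> 0"
    by (rule order_trans[OF ell2_norm_nonneg le[OF ell2_zero(1)]]) (simp add: ell2_zero)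
  have hom: "U (\<lambda>x. c *s \<phi> x) = (\<lambda>x. c *s U \<phi> x)" if "U \<in> bounded_ops L" "\<phi> \<in> ell2 L"
    for U c and \<phi> :: "'a \<Rightarrow> complex ^ 'b"
    using that by (simp add: bounded_ops_def)
  show "op_close L S T r"
    unfolding op_close_def
  proof
    fix \<phi> :: "'a \<Rightarrow> complex ^ 'b" assume f: "\<phi> \<in> ell2 L"
    show "ell2_norm L (\<lambda>x. S \<phi> x - T \<phi> x) \<le> r * ell2_norm L \<phi>"
    proof (cases "ell2_norm L \<phi> = 0")
      case True
      then have "\<phi> = (\<lambda>x. 0 *s \<phi> x)" using ell2_norm_eq_0[OF f] by simp
      then have "S \<phi> = (\<lambda>x. 0)" "T \<phi> = (\<lambda>x. 0)"
        using hom[OF S f, of 0] hom[OF T f, of 0] by simp_all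
      then show ?thesis using True by (simp add: ell2_zero)
    next
      case False
      define n where "n = ell2_norm L \<phi>"
      have n: "n > 0" using False ell2_norm_nonneg[of L \<phi>] unfolding n_def by linarith
      define c where "c = complex_of_real (1 / n)"
      have c: "norm c = 1 / n" using n by (simp add: c_def norm_divide)
      define v where "v = (\<lambda>x. c *s \<phi> x)"
      have v: "v \<in> ell2 L" "ell2_norm L v \<le> 1"
        using ell2_smult[OF f, of c] n by (simp_all add: v_def c n_def[symmetric])
      have "(\<lambda>x. S v x - T v x) = (\<lambda>x. c *s (S \<phi> x - T \<phi> x))"
        unfolding v_def hom[OF S f] hom[OF T f] by (simp add: vector_ssub_ldistrib)
      moreover have "ell2_norm L (\<lambda>x. c *s (S \<phi> x - T \<phi> x)) = norm c * ell2_norm L (\<lambda>x. S \<phi> x - T \<phi> x)"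
        by (intro ell2_smult ell2_diff bounded_ops_ell2[OF S f] bounded_ops_ell2[OF T f])
      ultimately have "ell2_norm L (\<lambda>x. S \<phi> x - T \<phi> x) / n \<le> r"
        using le[OF v] by (simp add: c)
      then show ?thesis using n by (simp add: field_simps flip: n_def)
    qed
  qed
qed

lemma tends_in_op_norm_iff:
  assumes S: "\<And>n. S n \<in> bounded_ops L" and T: "T \<in> bounded_ops L"
  shows "tends_in_op_norm L S T \<longleftrightarrow> (\<forall>e>0. \<exists>N. \<forall>n\<ge>N. op_close L (S n) T e)"
proof
  assume "tends_in_op_norm L S T"
  then have lim: "(\<lambda>n. op_norm_on (ell2 L) (ell2_norm L) (S n - T) (ell2_norm L)) \<longlonglongrightarrow> 0"
    by (simp add: tends_in_op_norm_def)
  show "\<forall>e>0. \<exists>N. \<forall>n\<ge>N. op_close L (S n) T e"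
  proof (intro allI impI)
    fix e :: real assume "e > 0"
    then obtain N where N: "\<And>n. n \<ge> N \<Longrightarrow>
        norm (op_norm_on (ell2 L) (ell2_norm L) (S n - T) (ell2_norm L) - 0) < e"
      using LIMSEQ_D[OF lim] by blast
    have "op_close L (S n) T e" if "n \<ge> N" for n
      using op_close_mono[OF op_close_op_norm_on(1)[OF S T]] N[OF that] by force
    then show "\<exists>N. \<forall>n\<ge>N. op_close L (S n) T e" by blast
  qed
next
  assume c: "\<forall>e>0. \<exists>N. \<forall>n\<ge>N. op_close L (S n) T e"
  show "tends_in_op_norm L S T"
    unfolding tends_in_op_norm_def
  proof (rule LIMSEQ_I)
    fix e :: real assume e: "e > 0"
    then obtain N where N: "\<And>n. n \<ge> N \<Longrightarrow> op_close L (S n) T (e / 2)"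
      using c by (meson half_gt_zero)
    have "norm (op_norm_on (ell2 L) (ell2_norm L) (S n - T) (ell2_norm L) - 0) < e" if "n \<ge> N" for n
      using op_norm_on_le[OF N[OF that]] op_close_op_norm_on(2)[OF S T, of n] e by simp
    then show "\<exists>N. \<forall>n\<ge>N. norm (op_norm_on (ell2 L) (ell2_norm L) (S n - T) (ell2_norm L) - 0) < e"
      by blast
  qed
qed

text \<open>The difference of the operators has the kernel \<open>k\<close>. One direction restricts
  to finitely supported vectors, the other is \<open>mop_ell2\<close>.\<close>

lemma op_close_mop:
  fixes k1 k2 :: "'a \<Rightarrow> 'a \<Rightarrow> complex ^ 'n ^ ('n::finite)"
  assumes b1: "banded L k1 M1 C1" and b2: "banded L k2 M2 C2" and b3: "banded L k M C"
    and k: "\<And>x y. x \<in> L \<Longrightarrow> y \<in> L \<Longrightarrow> k x y = k1 x y - k2 x y" and r: "r \<ge> 0"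
  shows "op_close L (restrict (mop L k1) (ell2 L)) (restrict (mop L k2) (ell2 L)) r \<longleftrightarrow> op_bound L k r"
proof -
  have eq: "mop L k \<phi> = (\<lambda>x. mop L k1 \<phi> x - mop L k2 \<phi> x)" for \<phi>
  proof
    fix x
    show "mop L k \<phi> x = mop L k1 \<phi> x - mop L k2 \<phi> x"
    proof (cases "x \<in> L")
      case x: True
      let ?S = "{y \<in> L. k1 x y \<noteq> 0} \<union> {y \<in> L. k2 x y \<noteq> 0}"
      have S: "finite ?S" using banded_row[OF b1 x] banded_row[OF b2 x] by simp
      have "mop L k1 \<phi> x = (\<Sum>y\<in>?S. k1 x y *v \<phi> y)" "mop L k2 \<phi> x = (\<Sum>y\<in>?S. k2 x y *v \<phi> y)"
        using S x by (intro mop_eq_sum; force)+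
      moreover have "mop L k \<phi> x = (\<Sum>y\<in>?S. k x y *v \<phi> y)"
        using S x k by (intro mop_eq_sum) auto
      moreover have "(\<Sum>y\<in>?S. k x y *v \<phi> y) = (\<Sum>y\<in>?S. k1 x y *v \<phi> y - k2 x y *v \<phi> y)"
        using k x by (intro sum.cong refl) (auto simp: matrix_vector_mult_diff_rdistrib)
      ultimately show ?thesis by (simp add: sum_subtractf)
    qed (simp add: mop_outside)
  qed
  show ?thesis
  proof
    assume c: "op_close L (restrict (mop L k1) (ell2 L)) (restrict (mop L k2) (ell2 L)) r"
    show "op_bound L k r"
      unfolding op_bound_def
    proof
      fix \<phi> :: "'a \<Rightarrow> complex ^ 'n" assume f: "\<phi> \<in> fin_supp L"
      have "ell2_norm L (mop L k \<phi>) \<le> r * ell2_norm L \<phi>"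
        using c fin_supp_ell2(1)[OF f] by (simp add: op_close_def eq)
      then have "(ell2_norm L (mop L k \<phi>))\<^sup>2 \<le> (r * ell2_norm L \<phi>)\<^sup>2" by (intro power_mono) auto
      then show "ip (mop L k \<phi>) (mop L k \<phi>) \<le> r\<^sup>2 * ip \<phi> \<phi>"
        using fin_supp_ell2(2)[OF f] fin_supp_ell2(2)[OF mop_fin_supp[OF b3 f]]
        by (simp add: power_mult_distrib)
    qed
  next
    assume "op_bound L k r"
    then show "op_close L (restrict (mop L k1) (ell2 L)) (restrict (mop L k2) (ell2 L)) r"
      using mop_ell2(2)[OF b3 _ r] by (simp add: op_close_def flip: eq)
  qed
qed


section \<open>Kernels of groupoid functions\<close>

definition kern :: "('d::finite) emap set \<Rightarrow> ('d emap \<times> 'd emap set \<Rightarrow> complex ^ 'n ^ 'n) \<Rightarrow>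
    'd emap \<Rightarrow> 'd emap \<Rightarrow> complex ^ 'n ^ ('n::finite)" where
  "kern L f x y = f (x \<circ> inv y, act_set y L)"

lemma left_regular_eq: "left_regular L f = restrict (mop L (kern L f)) (ell2 L)"
  by (simp add: left_regular_def mop_def kern_def fun_eq_iff restrict_def)

lemma inj_act: "y \<in> isoE \<Longrightarrow> inj_on (act y) S"
  by (metis act_def inj_onI isoE_cancel(2))

lemma Cc_bounded:
  assumes "f \<in> Cc L0"
  obtains C where "C > 0" "\<And>p. norm (f p) \<le> C"
proof -
  obtain K where K: "compactin isoE_top K" "\<And>g L. f (g, L) \<noteq> 0 \<Longrightarrow> g \<in> K"
    by (rule Cc_support[OF assms]) iprover
  have "compact (f ` {p \<in> groupoid L0. fst p \<in> K})"
    using image_compactin[OF compactin_groupoid[OF K(1)] Cc_continuous[OF assms]] by simp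
  then obtain C where C: "C > 0" "\<And>p. p \<in> groupoid L0 \<Longrightarrow> fst p \<in> K \<Longrightarrow> norm (f p) \<le> C"
    using bounded_pos[of "f ` {p \<in> groupoid L0. fst p \<in> K}"] compact_imp_bounded by auto
  have "norm (f p) \<le> C" for p
  proof (cases "f p = 0")
    case False
    then have "p \<in> groupoid L0" using Cc_zero[OF assms] by blast
    moreover have "fst p \<in> K" using False K(2)[of "fst p" "snd p"] by simp
    ultimately show ?thesis by (rule C(2))
  qed (use C in simp)
  then show thesis using that C(1) by iprover
qed

lemma kern_banded:
  fixes f :: "('d::finite) emap \<times> 'd emap set \<Rightarrow> complex ^ 'n ^ ('n::finite)"
  assumes sep: "uniformly_separated L0" and f: "f \<in> Cc L0"
  obtains M C where "\<And>L. L \<in> transversal L0 \<Longrightarrow> banded L (kern L f) M C"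
proof -
  obtain K where K: "compactin isoE_top K" "\<And>g L. f (g, L) \<noteq> 0 \<Longrightarrow> g \<in> K"
    by (rule Cc_support[OF f]) iprover
  obtain C where "C > 0" and C: "\<And>p. norm (f p) \<le> C" by (rule Cc_bounded[OF f]) iprover
  obtain M1 where M1: "\<And>L. L \<in> dynamical_hull L0 \<Longrightarrow> finite (L \<inter> K) \<and> card (L \<inter> K) \<le> M1"
    by (rule hull_compact_card[OF sep K(1)]) iprover
  obtain M2 where M2: "\<And>L. L \<in> dynamical_hull L0 \<Longrightarrow>
      finite (L \<inter> inv ` K) \<and> card (L \<inter> inv ` K) \<le> M2"
    by (rule hull_compact_card[OF sep compactin_isoE_inv[OF K(1)]]) iprover
  have "banded L (kern L f) (max M1 M2) C" if L: "L \<in> transversal L0" for L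
    unfolding banded_def
  proof
    fix x assume x: "x \<in> L"
    have xi: "x \<in> isoE" using transversal_isoE[OF L x] .
    have ax: "act_set x L \<in> dynamical_hull L0"
      using act_set_hull[OF xi transversal_hull[OF L]] .
    have *: "finite {y \<in> L. P y} \<and> card {y \<in> L. P y} \<le> m"
      if "\<And>y. y \<in> L \<Longrightarrow> P y \<Longrightarrow> act x y \<in> Q" "finite (act_set x L \<inter> Q) \<and> card (act_set x L \<inter> Q) \<le> m"
      for P Q m
    proof -
      have "act x ` {y \<in> L. P y} \<subseteq> act_set x L \<inter> Q" using that(1) by (auto simp: act_set_def)
      then show ?thesis
        using that(2) inj_act[OF xi] inj_on_finite card_inj_on_le by (meson order_trans)
    qed
    have "act x y \<in> inv ` K" if "y \<in> L" "kern L f x y \<noteq> 0" for y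
    proof -
      have "x \<circ> inv y \<in> K" using K(2) that(2) by (simp add: kern_def)
      moreover have "act x y = inv (x \<circ> inv y)"
        using xi transversal_isoE[OF L that(1)] by (simp add: act_def isoE_inv_comp_distrib)
      ultimately show ?thesis by blast
    qed
    then have row: "finite {y \<in> L. kern L f x y \<noteq> 0} \<and> card {y \<in> L. kern L f x y \<noteq> 0} \<le> M2"
      by (intro *[of "\<lambda>y. kern L f x y \<noteq> 0" "inv ` K"] M2[OF ax])
    have "act x y \<in> K" if "y \<in> L" "kern L f y x \<noteq> 0" for y
      using K(2) that(2) by (simp add: kern_def act_def)
    then have col: "finite {y \<in> L. kern L f y x \<noteq> 0} \<and> card {y \<in> L. kern L f y x \<noteq> 0} \<le> M1"
      by (intro *[of "\<lambda>y. kern L f y x \<noteq> 0" K] M1[OF ax])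
    show "finite {y \<in> L. kern L f x y \<noteq> 0} \<and> card {y \<in> L. kern L f x y \<noteq> 0} \<le> max M1 M2 \<and>
        finite {y \<in> L. kern L f y x \<noteq> 0} \<and> card {y \<in> L. kern L f y x \<noteq> 0} \<le> max M1 M2 \<and>
        (\<forall>y\<in>L. norm (kern L f x y) \<le> C)"
      using row col C by (auto simp: kern_def)
  qed
  then show thesis using that by iprover
qed

lemma kern_banded_at:
  assumes "uniformly_separated L0" and "f \<in> Cc L0" and "L \<in> transversal L0"
  obtains M C where "banded L (kern L f) M C"
  using kern_banded[OF assms(1,2)] assms(3) by metis

lemma op_bound_self_diff: "op_bound L (kern L (f - f)) 0"
proof -
  have z: "mop L (kern L (f - f)) \<phi> = (\<lambda>x. 0)" for \<phi>
    by (auto simp: fun_eq_iff mop_def kern_def)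
  show ?thesis unfolding op_bound_def z by (simp add: ip_def)
qed

lemma op_bound_mono:
  assumes "op_bound L k R" and "\<bar>R\<bar> \<le> R'"
  shows "op_bound L k R'"
proof -
  have "R\<^sup>2 \<le> R'\<^sup>2" using assms(2) by (simp add: abs_le_square_iff flip: abs_le_square_iff)
  then have "R\<^sup>2 * ip \<phi> \<phi> \<le> R'\<^sup>2 * ip \<phi> \<phi>" for \<phi> :: "'a \<Rightarrow> complex ^ 'b"
    by (intro mult_right_mono) auto
  then show ?thesis using assms(1) unfolding op_bound_def by (meson order_trans)
qed

lemma Cc_op_bound:
  fixes f :: "('d::finite) emap \<times> 'd emap set \<Rightarrow> complex ^ 'n ^ ('n::finite)"
  assumes "uniformly_separated L0" and "f \<in> Cc L0"
  obtains R where "R \<ge> 0" "\<And>L. L \<in> transversal L0 \<Longrightarrow> op_bound L (kern L f) R"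
proof -
  obtain M C where b: "\<And>L. L \<in> transversal L0 \<Longrightarrow> banded L (kern L f) M C"
    by (rule kern_banded[OF assms]) iprover
  have "op_bound L (kern L f) \<bar>real M * ((real CARD('n))\<^sup>2 * C)\<bar>" if "L \<in> transversal L0" for L
    using schur_test[OF b[OF that]] by (simp only: op_bound_abs)
  then show thesis by (rule that[rotated]) auto
qed

lemma left_regular_bounded_ops:
  assumes "uniformly_separated L0" and "f \<in> Cc L0" and "L \<in> transversal L0"
  shows "left_regular L f \<in> bounded_ops L"
  unfolding left_regular_eq
  by (rule kern_banded_at[OF assms]) (rule mop_bounded_ops)

lemma left_regular_close_iff:
  assumes "uniformly_separated L0" and "f \<in> Cc L0" and "h \<in> Cc L0" and "L \<in> transversal L0"
    and "r \<ge> 0"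
  shows "op_close L (left_regular L f) (left_regular L h) r \<longleftrightarrow> op_bound L (kern L (f - h)) r"
proof -
  obtain M1 C1 where 1: "banded L (kern L f) M1 C1"
    by (rule kern_banded_at[OF assms(1,2) assms(4)])
  obtain M2 C2 where 2: "banded L (kern L h) M2 C2"
    by (rule kern_banded_at[OF assms(1,3) assms(4)])
  obtain M3 C3 where 3: "banded L (kern L (f - h)) M3 C3"
    by (rule kern_banded_at[OF assms(1) Cc_diff[OF assms(2,3)] assms(4)])
  show ?thesis
    unfolding left_regular_eq
    using 1 2 3 _ assms(5)
    by (rule op_close_mop) (simp add: kern_def)
qed

lemma op_bound_triangle:
  assumes sep: "uniformly_separated L0" and Cc: "f \<in> Cc L0" "h \<in> Cc L0" "k \<in> Cc L0"
    and L: "L \<in> transversal L0" and r: "r \<ge> 0" "q \<ge> 0"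
    and b: "op_bound L (kern L (f - h)) r" "op_bound L (kern L (h - k)) q"
  shows "op_bound L (kern L (f - k)) (r + q)"
proof -
  have "op_close L (left_regular L f) (left_regular L k) (r + q)"
    using left_regular_bounded_ops[OF sep _ L] Cc b
      left_regular_close_iff[OF sep Cc(1,2) L r(1)] left_regular_close_iff[OF sep Cc(2,3) L r(2)]
    by (intro op_close_trans[where T = "left_regular L h"]) auto
  then show ?thesis using left_regular_close_iff[OF sep Cc(1,3) L] r by simp
qed

text \<open>The convolution at the arrow of \<open>x\<close> and \<open>y\<close> sums over
  \<open>act_set y L\<close>. The substitution \<open>g = act y z\<close> with \<open>z\<close> in
  \<open>L\<close> turns it into a matrix product.\<close>

lemma kern_conv:
  assumes L: "L \<in> transversal L0" and x: "x \<in> L" and y: "y \<in> L"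
  shows "kern L (conv L0 f1 f2) x y = (\<Sum>\<^sub>\<infinity>z\<in>L. kern L f1 x z ** kern L f2 z y)"
proof -
  have yi: "y \<in> isoE" using transversal_isoE[OF L y] .
  have "kern L (conv L0 f1 f2) x y =
      (\<Sum>\<^sub>\<infinity>g\<in>act y ` L. f1 (x \<circ> inv y \<circ> inv g, act_set g (act_set y L)) ** f2 (g, act_set y L))"
    using groupoid_kernel[OF L x y] by (simp add: kern_def conv_def act_set_def[of y])
  also have "\<dots> = (\<Sum>\<^sub>\<infinity>z\<in>L. f1 (x \<circ> inv y \<circ> inv (act y z), act_set (act y z) (act_set y L)) ** f2 (act y z, act_set y L))"
    by (subst infsum_reindex[OF inj_act[OF yi]]) (simp add: o_def)
  also have "\<dots> = (\<Sum>\<^sub>\<infinity>z\<in>L. kern L f1 x z ** kern L f2 z y)"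
  proof (rule infsum_cong)
    fix z assume "z \<in> L"
    then have zi: "z \<in> isoE" using transversal_isoE[OF L] by blast
    have "x \<circ> inv y \<circ> inv (act y z) = x \<circ> inv z"
      using yi zi by (simp add: act_def isoE_inv_comp_distrib comp_assoc)
    moreover have "act_set (act y z) (act_set y L) = act_set z L"
      using yi zi by (simp add: act_def act_set_comp)
    ultimately show "f1 (x \<circ> inv y \<circ> inv (act y z), act_set (act y z) (act_set y L)) ** f2 (act y z, act_set y L) =
        kern L f1 x z ** kern L f2 z y"
      by (simp add: kern_def act_def)
  qed
  finally show ?thesis .
qed

lemma kern_star:
  assumes L: "L \<in> transversal L0" and x: "x \<in> L" and y: "y \<in> L"
  shows "kern L (star L0 f) x y = dagger (kern L f y x)"
proof -
  have i: "x \<in> isoE" "y \<in> isoE" using transversal_isoE[OF L] x y by auto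
  have "act_set (x \<circ> inv y) (act_set y L) = act_set x L"
    using i by (simp add: act_set_comp)
  then show ?thesis
    using groupoid_kernel[OF L x y] i by (simp add: kern_def star_def isoE_inv_comp_distrib)
qed

section \<open>The cubic map and lifting with norm control\<close>

text \<open>The same \<open>h\<close>, a polynomial in \<open>f\<close> and its adjoint, works for
  every architecture, and each bound over \<open>L\<close> depends only on the bound for
  \<open>f\<close> over that \<open>L\<close>. Hence the norm can be lowered over the whole
  transversal while a small operator over one chosen \<open>L\<close> is preserved.\<close>

lemma cubic_step:
  fixes f :: "('d::finite) emap \<times> 'd emap set \<Rightarrow> complex ^ 'n ^ ('n::finite)"
  assumes sep: "uniformly_separated L0" and f: "f \<in> Cc L0" and R: "R > 0"
  obtains h where "h \<in> Cc L0"
    "\<And>L. L \<in> transversal L0 \<Longrightarrow> op_bound L (kern L f) R \<Longrightarrow> op_bound L (kern L h) (2 / 3 * R)"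
    "\<And>L e. L \<in> transversal L0 \<Longrightarrow> 0 \<le> e \<Longrightarrow> e \<le> R \<Longrightarrow> op_bound L (kern L f) e \<Longrightarrow> op_bound L (kern L h) e"
    "\<And>L e. L \<in> transversal L0 \<Longrightarrow> 0 \<le> e \<Longrightarrow> e \<le> R \<Longrightarrow> op_bound L (kern L f) e \<Longrightarrow>
       op_bound L (kern L (f - h)) (e ^ 3 / (3 * R\<^sup>2))"
proof -
  define s where "s = star L0 f"
  define u where "u = conv L0 s f"
  define t where "t = conv L0 f u"
  define c where "c = 1 / (3 * R\<^sup>2)"
  define h where "h = (\<lambda>p. f p - c *\<^sub>R t p)"
  have s: "s \<in> Cc L0" unfolding s_def using f by (rule star_Cc)
  have u: "u \<in> Cc L0" unfolding u_def using sep s f by (rule conv_Cc)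
  have t: "t \<in> Cc L0" unfolding t_def using sep f u by (rule conv_Cc)
  have h: "h \<in> Cc L0" unfolding h_def using f t by (rule Cc_diff_scale)
  have c0: "c \<ge> 0" by (simp add: c_def)
  \<comment> \<open>For each \<open>L\<close> this collects what the cubic estimates assume of
    \<open>a\<close> and \<open>b\<close>, here the operators of \<open>f\<close> and
    \<open>u\<close>, and expresses the operators of \<open>h\<close> and \<open>f - h\<close> by
    them.\<close>
  have main: "(\<forall>\<phi>\<in>fin_supp L. mop L (kern L f) \<phi> \<in> fin_supp L) \<and>
      (\<forall>\<phi>\<in>fin_supp L. mop L (kern L u) \<phi> \<in> fin_supp L) \<and>
      (\<forall>\<phi>\<in>fin_supp L. \<forall>\<psi>\<in>fin_supp L.
        ip (mop L (kern L f) \<psi>) (mop L (kern L f) \<phi>) = ip \<psi> (mop L (kern L u) \<phi>)) \<and>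
      (\<forall>\<phi>\<in>fin_supp L. \<forall>\<psi>\<in>fin_supp L. \<forall>c. mop L (kern L f) (\<lambda>x. \<phi> x - c *\<^sub>R \<psi> x) =
        (\<lambda>x. mop L (kern L f) \<phi> x - c *\<^sub>R mop L (kern L f) \<psi> x)) \<and>
      (\<forall>\<phi>\<in>fin_supp L. mop L (kern L h) \<phi> =
        (\<lambda>x. mop L (kern L f) \<phi> x - c *\<^sub>R mop L (kern L f) (mop L (kern L u) \<phi>) x)) \<and>
      (\<forall>\<phi>\<in>fin_supp L. mop L (kern L (f - h)) \<phi> =
        (\<lambda>x. c *\<^sub>R mop L (kern L f) (mop L (kern L u) \<phi>) x))"
    if L: "L \<in> transversal L0" for L
  proof -
    obtain M1 C1 where bf: "banded L (kern L f) M1 C1"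
      by (rule kern_banded_at[OF sep f L])
    obtain M2 C2 where bs: "banded L (kern L s) M2 C2"
      by (rule kern_banded_at[OF sep s L])
    obtain M3 C3 where bu: "banded L (kern L u) M3 C3"
      by (rule kern_banded_at[OF sep u L])
    have fs: "mop L (kern L f) \<phi> \<in> fin_supp L" if "\<phi> \<in> fin_supp L" for \<phi>
      using bf that by (rule mop_fin_supp)
    have us: "mop L (kern L u) \<phi> \<in> fin_supp L" if "\<phi> \<in> fin_supp L" for \<phi>
      using bu that by (rule mop_fin_supp)
    have mu: "mop L (kern L u) \<phi> = mop L (kern L s) (mop L (kern L f) \<phi>)" if "\<phi> \<in> fin_supp L" for \<phi>
      using bs bf that unfolding u_def by (rule mop_mult) (rule kern_conv[OF L])
    have mt: "mop L (kern L t) \<phi> = mop L (kern L f) (mop L (kern L u) \<phi>)" if "\<phi> \<in> fin_supp L" for \<phi>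
      using bf bu that unfolding t_def by (rule mop_mult) (rule kern_conv[OF L])
    have "ip (mop L (kern L f) \<psi>) (mop L (kern L f) \<phi>) = ip \<psi> (mop L (kern L u) \<phi>)"
      if "\<phi> \<in> fin_supp L" "\<psi> \<in> fin_supp L" for \<phi> \<psi>
      unfolding mu[OF that(1)] using bf that(2) fs[OF that(1)]
      by (rule mop_adjoint) (simp add: s_def kern_star[OF L])
    moreover have "mop L (kern L h) \<phi> =
        (\<lambda>x. mop L (kern L f) \<phi> x - c *\<^sub>R mop L (kern L t) \<phi> x)" if p: "\<phi> \<in> fin_supp L" for \<phi>
    proof
      fix x
      show "mop L (kern L h) \<phi> x = mop L (kern L f) \<phi> x - c *\<^sub>R mop L (kern L t) \<phi> x"
        by (cases "x \<in> L")
          (simp_all add: mop_fin_supp_eq[OF p] mop_outside kern_def h_def sum_subtractf scaleR_sum_right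
            matrix_vector_mult_diff_rdistrib matrix_vector_mult_scaleR_left)
    qed
    moreover have "mop L (kern L (f - h)) \<phi> = (\<lambda>x. c *\<^sub>R mop L (kern L t) \<phi> x)"
      if p: "\<phi> \<in> fin_supp L" for \<phi>
    proof
      fix x
      show "mop L (kern L (f - h)) \<phi> x = c *\<^sub>R mop L (kern L t) \<phi> x"
        by (cases "x \<in> L")
          (simp_all add: mop_fin_supp_eq[OF p] mop_outside kern_def h_def scaleR_sum_right
            matrix_vector_mult_scaleR_left)
    qed
    ultimately show ?thesis using fs us mt mop_combine[OF bf] by simp
  qed
  show thesis
  proof (rule that[OF h])
    fix L assume L: "L \<in> transversal L0" and b: "op_bound L (kern L f) R"
    show "op_bound L (kern L h) (2 / 3 * R)"
      unfolding op_bound_def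
    proof
      fix \<phi> :: "'d emap \<Rightarrow> complex ^ 'n" assume p: "\<phi> \<in> fin_supp L"
      show "ip (mop L (kern L h) \<phi>) (mop L (kern L h) \<phi>) \<le> (2 / 3 * R)\<^sup>2 * ip \<phi> \<phi>"
        using cubic_shrink[of L "mop L (kern L f)" "mop L (kern L u)" R \<phi>] main[OF L] R b p
        unfolding op_bound_def c_def by simp
    qed
  next
    fix L e assume L: "L \<in> transversal L0" and e: "0 \<le> e" "e \<le> R" and b: "op_bound L (kern L f) e"
    show "op_bound L (kern L h) e"
      unfolding op_bound_def
    proof
      fix \<phi> :: "'d emap \<Rightarrow> complex ^ 'n" assume p: "\<phi> \<in> fin_supp L"
      show "ip (mop L (kern L h) \<phi>) (mop L (kern L h) \<phi>) \<le> e\<^sup>2 * ip \<phi> \<phi>"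
        using cubic_bounded(1)[of L "mop L (kern L f)" "mop L (kern L u)" R e \<phi>] main[OF L] R b p e
        unfolding op_bound_def c_def by simp
    qed
    show "op_bound L (kern L (f - h)) (e ^ 3 / (3 * R\<^sup>2))"
      unfolding op_bound_def
    proof
      fix \<phi> :: "'d emap \<Rightarrow> complex ^ 'n" assume p: "\<phi> \<in> fin_supp L"
      let ?\<psi> = "mop L (kern L f) (mop L (kern L u) \<phi>)"
      have m: "?\<psi> \<in> fin_supp L" using main[OF L] p by blast
      have "ip ?\<psi> ?\<psi> \<le> (e ^ 3)\<^sup>2 * ip \<phi> \<phi>"
        using cubic_bounded(2)[of L "mop L (kern L f)" "mop L (kern L u)" R e \<phi>] main[OF L] R b p e
        unfolding op_bound_def by simp
      then have "c\<^sup>2 * ip ?\<psi> ?\<psi> \<le> c\<^sup>2 * ((e ^ 3)\<^sup>2 * ip \<phi> \<phi>)" by (intro mult_left_mono) auto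
      also have "\<dots> = (e ^ 3 / (3 * R\<^sup>2))\<^sup>2 * ip \<phi> \<phi>"
        by (simp add: c_def power_divide power_mult_distrib)
      finally show "ip (mop L (kern L (f - h)) \<phi>) (mop L (kern L (f - h)) \<phi>) \<le>
          (e ^ 3 / (3 * R\<^sup>2))\<^sup>2 * ip \<phi> \<phi>"
        using main[OF L] p ip_scale[OF m, of c] by simp
    qed
  qed
qed

text \<open>Iterating the cubic map lowers the norm over the whole transversal geometrically, while an
  operator over \<open>L\<close> that is already small hardly changes. This replaces the functional calculus
  in the proof that the image of the C*-algebra under a representation is closed.\<close>

lemma norm_controlled_lift_aux:
  fixes f :: "('d::finite) emap \<times> 'd emap set \<Rightarrow> complex ^ 'n ^ ('n::finite)"
  assumes sep: "uniformly_separated L0" and L: "L \<in> transversal L0" and e: "e > 0"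
  shows "f \<in> Cc L0 \<Longrightarrow> op_bound L (kern L f) e \<Longrightarrow>
    (\<And>L'. L' \<in> transversal L0 \<Longrightarrow> op_bound L' (kern L' f) (2 * e * (3 / 2) ^ k)) \<Longrightarrow>
    \<exists>g\<in>Cc L0. (\<forall>L'\<in>transversal L0. op_bound L' (kern L' g) (2 * e)) \<and>
      op_bound L (kern L (f - g)) (e / 15 * (1 - (4 / 9) ^ k))"
proof (induction k arbitrary: f)
  case 0
  have "op_bound L (kern L (f - f)) (e / 15 * (1 - (4 / 9) ^ 0))"
    using op_bound_self_diff[of L f] by (simp only: power_0 diff_self mult_zero_right)
  moreover have "\<forall>L'\<in>transversal L0. op_bound L' (kern L' f) (2 * e)" using 0(3) by simp
  ultimately show ?case using 0(1) by (intro bexI[of _ f] conjI)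
next
  case (Suc k)
  \<comment> \<open>The induction descends: one cubic step at level \<open>R\<close> brings the
    bound over the transversal to the level with exponent \<open>k\<close>, while
    \<open>e \<le> R\<close> keeps the bound \<open>e\<close> over \<open>L\<close> intact.\<close>
  define R where "R = 2 * e * (3 / 2) ^ Suc k"
  have k1: "(3 / 2 :: real) ^ Suc k \<ge> 1" by (rule one_le_power) simp
  then have "e * 1 \<le> 2 * e * (3 / 2) ^ Suc k" using e by (intro mult_mono) auto
  then have R: "R > 0" "e \<le> R" using e by (simp_all add: R_def)
  obtain h where h: "h \<in> Cc L0"
    "\<And>L. L \<in> transversal L0 \<Longrightarrow> op_bound L (kern L f) R \<Longrightarrow> op_bound L (kern L h) (2 / 3 * R)"
    "\<And>L e. L \<in> transversal L0 \<Longrightarrow> 0 \<le> e \<Longrightarrow> e \<le> R \<Longrightarrow> op_bound L (kern L f) e \<Longrightarrow> op_bound L (kern L h) e"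
    "\<And>L e. L \<in> transversal L0 \<Longrightarrow> 0 \<le> e \<Longrightarrow> e \<le> R \<Longrightarrow> op_bound L (kern L f) e \<Longrightarrow>
       op_bound L (kern L (f - h)) (e ^ 3 / (3 * R\<^sup>2))"
    by (rule cubic_step[OF sep Suc.prems(1) R(1)]) iprover
  have R': "2 / 3 * R = 2 * e * (3 / 2) ^ k" by (simp add: R_def)
  have "op_bound L' (kern L' h) (2 * e * (3 / 2) ^ k)" if "L' \<in> transversal L0" for L'
    using h(2)[OF that Suc.prems(3)[OF that, folded R_def]] unfolding R' .
  moreover have "op_bound L (kern L h) e" using h(3)[OF L _ R(2)] e Suc.prems(2) by simp
  ultimately obtain g where g: "g \<in> Cc L0" "\<forall>L'\<in>transversal L0. op_bound L' (kern L' g) (2 * e)"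
      "op_bound L (kern L (h - g)) (e / 15 * (1 - (4 / 9) ^ k))"
    using Suc.IH[OF h(1)] by blast
  have d: "op_bound L (kern L (f - h)) (e ^ 3 / (3 * R\<^sup>2))"
    using h(4)[OF L _ R(2)] e Suc.prems(2) by simp
  have nn: "0 \<le> e ^ 3 / (3 * R\<^sup>2)" "0 \<le> e / 15 * (1 - (4 / 9) ^ k)"
    using e by (auto intro!: mult_nonneg_nonneg power_le_one)
  have R2: "R\<^sup>2 = 4 * e\<^sup>2 * (9 / 4) ^ Suc k"
    by (simp add: R_def power_mult_distrib power2_eq_square flip: power_mult_distrib)
  \<comment> \<open>The new term of a geometric series: \<open>e / 12 * (4 / 9) ^ j\<close> summed
    over \<open>j = 1, ..., k\<close> is \<open>e / 15 * (1 - (4 / 9) ^ k)\<close>.\<close>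
  have step: "e ^ 3 / (3 * R\<^sup>2) = e / 12 * (4 / 9) ^ Suc k"
    unfolding R2 using e by (simp add: power2_eq_square power3_eq_cube power_divide field_simps)
  have "e ^ 3 / (3 * R\<^sup>2) + e / 15 * (1 - (4 / 9) ^ k) = e / 15 * (1 - (4 / 9) ^ Suc k)"
    unfolding step by (simp add: algebra_simps)
  then have "op_bound L (kern L (f - g)) (e / 15 * (1 - (4 / 9) ^ Suc k))"
    using op_bound_triangle[OF sep Suc.prems(1) h(1) g(1) L nn d g(3)] by (simp only:)
  then show ?case using g by blast
qed

text \<open>This replaces the lifting of an element of the image to one of comparable norm. The
  factor 2 and the error \<open>e / 15\<close> are affordable because later rounds correct the
  error.\<close>

lemma norm_controlled_lift:
  fixes f :: "('d::finite) emap \<times> 'd emap set \<Rightarrow> complex ^ 'n ^ ('n::finite)"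
  assumes sep: "uniformly_separated L0" and L: "L \<in> transversal L0" and e: "e > 0"
    and f: "f \<in> Cc L0" and b: "op_bound L (kern L f) e"
  obtains g where "g \<in> Cc L0" "\<And>L'. L' \<in> transversal L0 \<Longrightarrow> op_bound L' (kern L' g) (2 * e)"
    "op_bound L (kern L (f - g)) (e / 15)"
proof -
  obtain R where R: "R \<ge> 0" "\<And>L. L \<in> transversal L0 \<Longrightarrow> op_bound L (kern L f) R"
    by (rule Cc_op_bound[OF sep f]) iprover
  \<comment> \<open>The number of rounds: a crude bound \<open>R\<close> over the whole transversal,
    coming from Schur's test, must not exceed the starting level of the iteration.\<close>
  obtain k where k: "R / (2 * e) < (3 / 2) ^ k" using real_arch_pow[of "3/2"] by auto
  then have "R \<le> 2 * e * (3 / 2) ^ k" using e by (simp add: field_simps)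
  then have "op_bound L' (kern L' f) (2 * e * (3 / 2) ^ k)" if "L' \<in> transversal L0" for L'
    using op_bound_mono[OF R(2)[OF that]] R(1) by simp
  then obtain g where g: "g \<in> Cc L0" "\<forall>L'\<in>transversal L0. op_bound L' (kern L' g) (2 * e)"
      "op_bound L (kern L (f - g)) (e / 15 * (1 - (4 / 9) ^ k))"
    using norm_controlled_lift_aux[OF sep L e f b] by blast
  have "0 \<le> 1 - (4 / 9 :: real) ^ k" "1 - (4 / 9 :: real) ^ k \<le> 1" by (auto intro: power_le_one)
  then have "\<bar>e / 15 * (1 - (4 / 9) ^ k)\<bar> \<le> e / 15" using e by (simp add: mult_left_le abs_mult)
  then have "op_bound L (kern L (f - g)) (e / 15)" using op_bound_mono[OF g(3)] by blast
  then show thesis using that g by blast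
qed


section \<open>The norm of the Hilbert module\<close>

text \<open>Applying the matrix-valued fibre over \<open>L\<close> to a vector turns elements of the
  Hilbert module into vectors of \<open>ell2 L\<close>, on which the kernel operators act.\<close>

definition slice :: "('d::finite) emap set \<Rightarrow> ('d emap \<times> 'd emap set \<Rightarrow> complex ^ 'n ^ 'n) \<Rightarrow>
    complex ^ 'n \<Rightarrow> 'd emap \<Rightarrow> complex ^ ('n::finite)" where
  "slice L f v = (\<lambda>g. f (g, L) *v v)"

text \<open>The module norm without suprema and matrix norms: by \<open>mod_norm_le\<close> and
  \<open>mod_norm_bounds\<close>, for functions in \<open>Cc\<close> over a uniformly separated set,
  \<open>mod_norm\<close> is the least nonnegative \<open>r\<close> with this property.\<close>

definition mod_bound :: "('d::finite) emap set \<Rightarrow>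
    ('d emap \<times> 'd emap set \<Rightarrow> complex ^ 'n ^ ('n::finite)) \<Rightarrow> real \<Rightarrow> bool" where
  "mod_bound L0 f r \<longleftrightarrow> (\<forall>L\<in>transversal L0. \<forall>v. ell2_norm L (slice L f v) \<le> r * norm v)"

lemma slice_nonzero:
  assumes "f \<in> Cc L0" and "slice L f v g \<noteq> 0"
  shows "g \<in> L" and "f (g, L) \<noteq> 0"
proof -
  show nz: "f (g, L) \<noteq> 0" using assms(2) by (auto simp: slice_def)
  then have "(g, L) \<in> groupoid L0" using Cc_zero[OF assms(1)] by blast
  then show "g \<in> L" by (simp add: groupoid_iff)
qed

lemma slice_fin_supp:
  assumes "uniformly_separated L0" and "f \<in> Cc L0" and "L \<in> transversal L0"
  shows "slice L f v \<in> fin_supp L"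
proof -
  have "{g. slice L f v g \<noteq> 0} \<subseteq> {g \<in> L. f (g, L) \<noteq> 0}"
    using slice_nonzero[OF assms(2)] by blast
  then show ?thesis
    using Cc_fiber_finite[OF assms(1,2) transversal_hull[OF assms(3)]] finite_subset
    unfolding fin_supp_def by blast
qed

lemma slice_ell2:
  assumes "uniformly_separated L0" and "f \<in> Cc L0" and "L \<in> transversal L0"
  shows "slice L f v \<in> ell2 L"
  using fin_supp_ell2(1)[OF slice_fin_supp[OF assms]] .

text \<open>The module inner product of \<open>f\<close> with itself is a Gram matrix: as a
  quadratic form it is the inner product of slices.\<close>

lemma mod_inner_slice:
  assumes sep: "uniformly_separated L0" and f: "f \<in> Cc L0" and L: "L \<in> transversal L0"
  shows "(mod_inner f f L *v v) \<bullet> w = ip (slice L f v) (slice L f w)"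
proof -
  let ?S = "{g \<in> L. f (g, L) \<noteq> 0}"
  have S: "finite ?S" using Cc_fiber_finite[OF sep f transversal_hull[OF L]] .
  have "mod_inner f f L = (\<Sum>g\<in>?S. dagger (f (g, L)) ** f (g, L))"
    unfolding mod_inner_def using S by (intro infsum_eq_sum) (auto simp: matrix_mult_eq_0)
  then have "(mod_inner f f L *v v) \<bullet> w = (\<Sum>g\<in>?S. (f (g, L) *v v) \<bullet> (f (g, L) *v w))"
    by (simp add: matrix_vector_mult_sum_left inner_sum_left inner_dagger flip: matrix_vector_mul_assoc)
  also have "\<dots> = ip (slice L f v) (slice L f w)"
    using S slice_nonzero[OF f, of L v] by (subst ip_eq_sum[where S = ?S]) (auto simp: slice_def)
  finally show ?thesis .
qed

lemma norm_le_onorm_matrix: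
  fixes A :: "complex ^ ('n::finite) ^ 'n"
  shows "norm (A *v v) \<le> onorm ((*v) A) * norm v" and "0 \<le> onorm ((*v) A)"
proof -
  have "bounded_linear ((*v) A)"
    by (rule bounded_linear_intro[where K = "(real CARD('n))\<^sup>2 * norm A"])
      (use norm_matrix_vector_mult_le[of A] in
        \<open>auto simp: matrix_vector_right_distrib matrix_vector_mult_scaleR_right ac_simps\<close>)
  then show "norm (A *v v) \<le> onorm ((*v) A) * norm v" and "0 \<le> onorm ((*v) A)"
    by (auto intro: onorm onorm_pos_le)
qed

text \<open>The norm of a positive matrix is controlled by its quadratic form. With
  \<open>w = ?M *v v\<close>, the square of \<open>norm w\<close> is the inner product of the slices
  for \<open>v\<close> and \<open>w\<close>; Cauchy-Schwarz bounds it by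
  \<open>r\<^sup>2 * norm v * norm w\<close>, and one factor \<open>norm w\<close> cancels.\<close>

lemma onorm_mod_inner_le:
  assumes sep: "uniformly_separated L0" and f: "f \<in> Cc L0" and L: "L \<in> transversal L0"
    and b: "mod_bound L0 f r" and r: "r \<ge> 0"
  shows "onorm ((*v) (mod_inner f f L)) \<le> r\<^sup>2"
proof (rule onorm_bound)
  fix v
  let ?M = "mod_inner f f L"
  have q: "ip (slice L f u) (slice L f u) \<le> (r * norm u)\<^sup>2" for u
  proof -
    have "ell2_norm L (slice L f u) \<le> r * norm u" using b L by (simp add: mod_bound_def)
    then have "(ell2_norm L (slice L f u))\<^sup>2 \<le> (r * norm u)\<^sup>2" by (intro power_mono) auto
    then show ?thesis using fin_supp_ell2(2)[OF slice_fin_supp[OF sep f L]] by simp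
  qed
  define w where "w = ?M *v v"
  have "((norm w)\<^sup>2)\<^sup>2 = (ip (slice L f v) (slice L f w))\<^sup>2"
    using mod_inner_slice[OF sep f L, of v w] by (simp add: w_def power2_norm_eq_inner)
  also have "\<dots> \<le> ip (slice L f v) (slice L f v) * ip (slice L f w) (slice L f w)"
    by (intro ip_Cauchy_Schwarz[where L = L] slice_fin_supp[OF sep f L])
  also have "\<dots> \<le> (r * norm v)\<^sup>2 * (r * norm w)\<^sup>2"
    using q by (intro mult_mono) auto
  also have "\<dots> = (r\<^sup>2 * norm v * norm w)\<^sup>2" by (simp add: power2_eq_square ac_simps)
  finally have "(norm w)\<^sup>2 \<le> r\<^sup>2 * norm v * norm w"
    by (rule power2_le_imp_le) auto
  then have "norm w * norm w \<le> (r\<^sup>2 * norm v) * norm w" by (simp add: power2_eq_square)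
  then show "norm (?M *v v) \<le> r\<^sup>2 * norm v"
    unfolding w_def[symmetric] by (cases "w = 0") auto
qed simp

lemma mod_bound_exists:
  fixes f :: "('d::finite) emap \<times> 'd emap set \<Rightarrow> complex ^ 'n ^ ('n::finite)"
  assumes sep: "uniformly_separated L0" and f: "f \<in> Cc L0"
  obtains r where "r \<ge> 0" "mod_bound L0 f r"
proof -
  obtain K where K: "compactin isoE_top K" "\<And>g L. f (g, L) \<noteq> 0 \<Longrightarrow> g \<in> K"
    by (rule Cc_support[OF f]) iprover
  obtain M where M: "\<And>L. L \<in> dynamical_hull L0 \<Longrightarrow> finite (L \<inter> K) \<and> card (L \<inter> K) \<le> M"
    by (rule hull_compact_card[OF sep K(1)]) iprover
  obtain C where C: "C > 0" "\<And>p. norm (f p) \<le> C" by (rule Cc_bounded[OF f]) iprover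
  define c where "c = (real CARD('n))\<^sup>2 * C"
  have c: "norm (f p *v v) \<le> c * norm v" for p v
  proof -
    have "norm (f p *v v) \<le> (real CARD('n))\<^sup>2 * norm (f p) * norm v"
      by (rule norm_matrix_vector_mult_le)
    also have "\<dots> \<le> c * norm v"
      unfolding c_def using C(2) by (intro mult_right_mono mult_left_mono) auto
    finally show ?thesis .
  qed
  have c0: "c \<ge> 0" using C(1) by (simp add: c_def)
  have "mod_bound L0 f (real M * c)"
    unfolding mod_bound_def
  proof (intro ballI allI)
    fix L v assume L: "L \<in> transversal L0"
    let ?S = "L \<inter> K"
    have S: "finite ?S" "card ?S \<le> M" using M[OF transversal_hull[OF L]] by auto
    have "{g. slice L f v g \<noteq> 0} \<subseteq> ?S"
      using K(2) slice_nonzero[OF f, of L v] by blast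
    then have "ip (slice L f v) (slice L f v) = (\<Sum>g\<in>?S. (norm (f (g, L) *v v))\<^sup>2)"
      using S(1) by (subst ip_eq_sum) (auto simp: slice_def power2_norm_eq_inner)
    also have "\<dots> \<le> (\<Sum>g\<in>?S. (c * norm v)\<^sup>2)"
      using c by (intro sum_mono power_mono) auto
    also have "\<dots> \<le> real M * (c * norm v)\<^sup>2"
      using S(2) by (simp add: mult_right_mono)
    \<comment> \<open>Replacing \<open>M\<close> by its square avoids a square root in the final
      bound.\<close>
    also have "\<dots> \<le> (real M)\<^sup>2 * (c * norm v)\<^sup>2"
    proof (intro mult_right_mono)
      have "M \<le> M\<^sup>2" by (cases M) (auto simp: power2_eq_square)
      then show "real M \<le> (real M)\<^sup>2" by (simp flip: of_nat_power)
    qed auto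
    finally have "(ell2_norm L (slice L f v))\<^sup>2 \<le> (real M * c * norm v)\<^sup>2"
      using fin_supp_ell2(2)[OF slice_fin_supp[OF sep f L]] by (simp add: power_mult_distrib mult.assoc)
    then show "ell2_norm L (slice L f v) \<le> real M * c * norm v"
      by (rule power2_le_imp_le) (use c0 in auto)
  qed
  moreover have "0 \<le> real M * c" using c0 by simp
  ultimately show thesis using that by blast
qed

lemma mod_norm_le:
  assumes "uniformly_separated L0" and "f \<in> Cc L0" and "mod_bound L0 f r" and "r \<ge> 0"
  shows "mod_norm L0 f \<le> r"
proof -
  have "unif_norm L0 (mod_inner f f) \<le> r\<^sup>2"
    unfolding unif_norm_def
    using onorm_mod_inner_le[OF assms(1,2) _ assms(3,4)] by (intro cSup_least) auto
  then show ?thesis using assms(4) by (simp add: mod_norm_def real_le_lsqrt)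
qed

lemma mod_norm_bounds:
  assumes sep: "uniformly_separated L0" and f: "f \<in> Cc L0"
  shows "mod_norm L0 f \<ge> 0" and "mod_bound L0 f (mod_norm L0 f)"
proof -
  obtain r where r: "r \<ge> 0" "mod_bound L0 f r" by (rule mod_bound_exists[OF sep f])
  let ?X = "insert 0 ((\<lambda>L. onorm ((*v) (mod_inner f f L))) ` transversal L0)"
  have bdd: "bdd_above ?X"
    using onorm_mod_inner_le[OF sep f _ r(2,1)] by (intro bdd_aboveI[where M = "r\<^sup>2"]) auto
  have u: "q \<le> unif_norm L0 (mod_inner f f)" if "q \<in> ?X" for q
    unfolding unif_norm_def using that bdd by (rule cSup_upper)
  have u0: "0 \<le> unif_norm L0 (mod_inner f f)" by (rule u) simp
  then show m0: "mod_norm L0 f \<ge> 0" by (simp add: mod_norm_def)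
  show "mod_bound L0 f (mod_norm L0 f)"
    unfolding mod_bound_def
  proof (intro ballI allI)
    fix L v assume L: "L \<in> transversal L0"
    have "(ell2_norm L (slice L f v))\<^sup>2 = (mod_inner f f L *v v) \<bullet> v"
      using mod_inner_slice[OF sep f L] fin_supp_ell2(2)[OF slice_fin_supp[OF sep f L]] by simp
    also have "\<dots> \<le> norm (mod_inner f f L *v v) * norm v" by (rule norm_cauchy_schwarz)
    also have "\<dots> \<le> (onorm ((*v) (mod_inner f f L)) * norm v) * norm v"
      by (intro mult_right_mono norm_le_onorm_matrix) auto
    also have "\<dots> \<le> (unif_norm L0 (mod_inner f f) * norm v) * norm v"
      using L by (intro mult_right_mono u) auto
    also have "\<dots> = (mod_norm L0 f * norm v)\<^sup>2"
      using u0 by (simp add: mod_norm_def power_mult_distrib power2_eq_square[of "norm v"] mult.assoc)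
    finally show "ell2_norm L (slice L f v) \<le> mod_norm L0 f * norm v"
      by (rule power2_le_imp_le) (use m0 in auto)
  qed
qed

text \<open>Stating the sum pointwise for a separate \<open>k\<close> lets one lemma serve both
  triangle inequalities in \<open>mod_norm_seminorm\<close>.\<close>

lemma mod_norm_add_le:
  fixes f h k :: "('d::finite) emap \<times> 'd emap set \<Rightarrow> complex ^ 'n ^ ('n::finite)"
  assumes sep: "uniformly_separated L0" and Cc: "f \<in> Cc L0" "h \<in> Cc L0" "k \<in> Cc L0"
    and eq: "\<And>p. k p = f p + h p"
  shows "mod_norm L0 k \<le> mod_norm L0 f + mod_norm L0 h"
proof (rule mod_norm_le[OF sep Cc(3)])
  show "mod_bound L0 k (mod_norm L0 f + mod_norm L0 h)"
    unfolding mod_bound_def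
  proof (intro ballI allI)
    fix L and v :: "complex ^ 'n" assume L: "L \<in> transversal L0"
    have "slice L k v = (\<lambda>g. slice L f v g + slice L h v g)"
      by (simp add: slice_def eq matrix_vector_mult_add_rdistrib)
    then have "ell2_norm L (slice L k v) \<le> ell2_norm L (slice L f v) + ell2_norm L (slice L h v)"
      using ell2_add(2)[OF slice_ell2[OF sep Cc(1) L] slice_ell2[OF sep Cc(2) L]] by simp
    also have "\<dots> \<le> mod_norm L0 f * norm v + mod_norm L0 h * norm v"
      using mod_norm_bounds(2)[OF sep Cc(1)] mod_norm_bounds(2)[OF sep Cc(2)] L
      by (intro add_mono) (simp_all add: mod_bound_def)
    finally show "ell2_norm L (slice L k v) \<le> (mod_norm L0 f + mod_norm L0 h) * norm v"
      by (simp add: algebra_simps)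
  qed
  show "0 \<le> mod_norm L0 f + mod_norm L0 h"
    using mod_norm_bounds(1)[OF sep Cc(1)] mod_norm_bounds(1)[OF sep Cc(2)] by simp
qed

lemma mod_norm_uminus_le:
  fixes f h :: "('d::finite) emap \<times> 'd emap set \<Rightarrow> complex ^ 'n ^ ('n::finite)"
  assumes sep: "uniformly_separated L0" and Cc: "f \<in> Cc L0" "h \<in> Cc L0"
    and eq: "\<And>p. h p = - f p"
  shows "mod_norm L0 h \<le> mod_norm L0 f"
proof (rule mod_norm_le[OF sep Cc(2)])
  have "norm (slice L h v g) = norm (slice L f v g)" for L v g
  proof -
    have "f (g, L) *v v + h (g, L) *v v = 0"
      by (simp add: eq flip: matrix_vector_mult_add_rdistrib)
    then have "slice L h v g = - slice L f v g" unfolding slice_def by (rule minus_unique[symmetric])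
    then show ?thesis by simp
  qed
  then have "ell2_norm L (slice L h v) = ell2_norm L (slice L f v)" for L v
    by (simp add: ell2_norm_def)
  then show "mod_bound L0 h (mod_norm L0 f)"
    using mod_norm_bounds(2)[OF sep Cc(1)] by (simp add: mod_bound_def)
qed (rule mod_norm_bounds(1)[OF sep Cc(1)])

lemma mod_norm_seminorm:
  fixes f h k :: "('d::finite) emap \<times> 'd emap set \<Rightarrow> complex ^ 'n ^ ('n::finite)"
  assumes sep: "uniformly_separated L0" and Cc: "f \<in> Cc L0" "h \<in> Cc L0"
  shows "mod_norm L0 (f - f) = 0"
    and "mod_norm L0 (f - h) = mod_norm L0 (h - f)"
    and "k \<in> Cc L0 \<Longrightarrow> mod_norm L0 (f - k) \<le> mod_norm L0 (f - h) + mod_norm L0 (h - k)"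
    and "mod_norm L0 f \<le> mod_norm L0 h + mod_norm L0 (f - h)"
proof -
  have z: "slice L (f - f) v = (\<lambda>g. 0)" for L v by (simp add: slice_def)
  have "mod_bound L0 (f - f) 0" unfolding mod_bound_def z by (simp add: ell2_zero)
  then have "mod_norm L0 (f - f) \<le> 0" by (intro mod_norm_le[OF sep Cc_diff[OF Cc(1,1)]]) auto
  then show "mod_norm L0 (f - f) = 0"
    using mod_norm_bounds(1)[OF sep Cc_diff[OF Cc(1,1)]] by (rule order_antisym)
  show "mod_norm L0 (f - h) = mod_norm L0 (h - f)"
    by (intro order_antisym mod_norm_uminus_le[OF sep] Cc_diff Cc) simp_all
  show "k \<in> Cc L0 \<Longrightarrow> mod_norm L0 (f - k) \<le> mod_norm L0 (f - h) + mod_norm L0 (h - k)"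
    by (intro mod_norm_add_le[OF sep] Cc_diff Cc) simp_all
  show "mod_norm L0 f \<le> mod_norm L0 h + mod_norm L0 (f - h)"
    by (intro mod_norm_add_le[OF sep] Cc_diff Cc) simp_all
qed

text \<open>The link between module and representation: left convolution by \<open>f\<close> acts on
  slices over \<open>L\<close> as the operator with kernel \<open>kern L f\<close>.\<close>

lemma slice_conv:
  assumes L: "L \<in> transversal L0" and s: "slice L s v \<in> fin_supp L"
    and sep: "uniformly_separated L0" and Cc: "f \<in> Cc L0" "s \<in> Cc L0"
  shows "slice L (conv L0 f s) v = mop L (kern L f) (slice L s v)"
proof
  fix g
  show "slice L (conv L0 f s) v g = mop L (kern L f) (slice L s v) g"
  proof (cases "g \<in> L")
    case True
    let ?S = "{g' \<in> L. s (g', L) \<noteq> 0}"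
    have S: "finite ?S" using Cc_fiber_finite[OF sep Cc(2) transversal_hull[OF L]] .
    have "conv L0 f s (g, L) = (\<Sum>g'\<in>?S. f (g \<circ> inv g', act_set g' L) ** s (g', L))"
      using L True S by (simp add: conv_def groupoid_iff, intro infsum_eq_sum)
        (auto simp: matrix_mult_eq_0)
    then have "slice L (conv L0 f s) v g = (\<Sum>g'\<in>?S. kern L f g g' *v slice L s v g')"
      by (simp add: slice_def kern_def matrix_vector_mult_sum_left matrix_vector_mul_assoc)
    also have "\<dots> = mop L (kern L f) (slice L s v) g"
      using S True by (subst mop_eq_sum[where S = ?S]) (auto simp: slice_def)
    finally show ?thesis .
  next
    case False
    then show ?thesis by (simp add: slice_def conv_def groupoid_iff mop_outside)
  qed
qed

lemma mod_norm_conv_le: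
  fixes f s :: "('d::finite) emap \<times> 'd emap set \<Rightarrow> complex ^ 'n ^ ('n::finite)"
  assumes sep: "uniformly_separated L0" and Cc: "f \<in> Cc L0" "s \<in> Cc L0"
    and R: "R \<ge> 0" "\<And>L. L \<in> transversal L0 \<Longrightarrow> op_bound L (kern L f) R"
  shows "mod_norm L0 (conv L0 f s) \<le> R * mod_norm L0 s"
proof (rule mod_norm_le[OF sep conv_Cc[OF sep Cc]])
  show "0 \<le> R * mod_norm L0 s" using R(1) mod_norm_bounds(1)[OF sep Cc(2)] by simp
  obtain M C where b: "\<And>L. L \<in> transversal L0 \<Longrightarrow> banded L (kern L f) M C"
    by (rule kern_banded[OF sep Cc(1)]) iprover
  show "mod_bound L0 (conv L0 f s) (R * mod_norm L0 s)"
    unfolding mod_bound_def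
  proof (intro ballI allI)
    fix L and v :: "complex ^ 'n" assume L: "L \<in> transversal L0"
    have "ell2_norm L (slice L (conv L0 f s) v) = ell2_norm L (mop L (kern L f) (slice L s v))"
      using slice_conv[OF L slice_fin_supp[OF sep Cc(2) L] sep Cc] by simp
    also have "\<dots> \<le> R * ell2_norm L (slice L s v)"
      using mop_ell2(2)[OF b[OF L] R(2)[OF L] R(1) slice_ell2[OF sep Cc(2) L]] .
    also have "\<dots> \<le> R * (mod_norm L0 s * norm v)"
      using mod_norm_bounds(2)[OF sep Cc(2)] L R(1) by (intro mult_left_mono) (auto simp: mod_bound_def)
    finally show "ell2_norm L (slice L (conv L0 f s) v) \<le> R * mod_norm L0 s * norm v" by simp
  qed
qed

lemma conv_diff:
  fixes f s t :: "('d::finite) emap \<times> 'd emap set \<Rightarrow> complex ^ 'n ^ ('n::finite)"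
  assumes sep: "uniformly_separated L0" and Cc: "s \<in> Cc L0" "t \<in> Cc L0"
  shows "conv L0 f s - conv L0 f t = conv L0 f (s - t)"
proof
  fix p :: "'d emap \<times> 'd emap set"
  obtain g L where p: "p = (g, L)" by (cases p)
  show "(conv L0 f s - conv L0 f t) p = conv L0 f (s - t) p"
  proof (cases "(g, L) \<in> groupoid L0")
    case True
    then have L: "L \<in> dynamical_hull L0" using transversal_hull by (auto simp: groupoid_iff)
    let ?S = "{g' \<in> L. s (g', L) \<noteq> 0} \<union> {g' \<in> L. t (g', L) \<noteq> 0}"
    have S: "finite ?S" "?S \<subseteq> L" using Cc_fiber_finite[OF sep Cc(1) L] Cc_fiber_finite[OF sep Cc(2) L] by auto
    have *: "conv L0 f u p = (\<Sum>g'\<in>?S. f (g \<circ> inv g', act_set g' L) ** u (g', L))"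
      if "\<And>g'. g' \<in> L \<Longrightarrow> g' \<notin> ?S \<Longrightarrow> u (g', L) = 0" for u :: "'d emap \<times> 'd emap set \<Rightarrow> complex ^ 'n ^ 'n"
      unfolding p using True S that
      by (simp add: conv_def, intro infsum_eq_sum) (auto simp: matrix_mult_eq_0)
    have "A ** (X - Y) = A ** X - A ** Y" for A X Y :: "complex ^ 'n ^ 'n"
      by (simp add: matrix_matrix_mult_def vec_eq_iff algebra_simps sum_subtractf)
    then show ?thesis
      using *[of s] *[of t] *[of "s - t"] by (simp add: sum_subtractf)
  qed (simp add: p conv_def)
qed


section \<open>Completions\<close>

text \<open>The type of the completed space provides subtraction only, so the seminorm axioms are
  phrased through differences. \<open>mod_norm_seminorm\<close> supplies them for the module
  norm.\<close>

context
  fixes V :: "'v::minus set" and p :: "'v \<Rightarrow> real"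
  assumes p_refl: "\<And>x. x \<in> V \<Longrightarrow> p (x - x) = 0"
    and p_sym: "\<And>x y. x \<in> V \<Longrightarrow> y \<in> V \<Longrightarrow> p (x - y) = p (y - x)"
    and p_tri: "\<And>x y z. x \<in> V \<Longrightarrow> y \<in> V \<Longrightarrow> z \<in> V \<Longrightarrow> p (x - z) \<le> p (x - y) + p (y - z)"
    and p_norm: "\<And>x y. x \<in> V \<Longrightarrow> y \<in> V \<Longrightarrow> p x \<le> p y + p (x - y)"
begin

lemma p_abs_diff: "x \<in> V \<Longrightarrow> y \<in> V \<Longrightarrow> \<bar>p x - p y\<bar> \<le> p (x - y)"
  using p_norm[of x y] p_norm[of y x] p_sym[of x y] by linarith

lemma cauchy_seqs_in: "s \<in> cauchy_seqs V p \<Longrightarrow> s n \<in> V"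
  by (auto simp: cauchy_seqs_def)

text \<open>The limit of the norms does not depend on the representative, so the description in
  \<open>completion_norm\<close> is satisfied by all members of a class.\<close>

lemma null_rel_limit:
  assumes "(s, t) \<in> null_rel V p" and "(\<lambda>n. p (s n)) \<longlonglongrightarrow> a"
  shows "(\<lambda>n. p (t n)) \<longlonglongrightarrow> a"
proof -
  have st: "s n \<in> V" "t n \<in> V" for n using assms(1) cauchy_seqs_in by (auto simp: null_rel_def)
  have "(\<lambda>n. p (s n - t n)) \<longlonglongrightarrow> 0" using assms(1) by (simp add: null_rel_def)
  then have "(\<lambda>n. p (s n) - p (t n)) \<longlonglongrightarrow> 0"
    by (rule Lim_null_comparison[rotated]) (use p_abs_diff st in auto)
  from tendsto_diff[OF assms(2) this] show ?thesis by simp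
qed

lemma cauchy_seqs_norm_convergent:
  assumes s: "s \<in> cauchy_seqs V p"
  obtains a where "(\<lambda>n. p (s n)) \<longlonglongrightarrow> a"
proof -
  have "Cauchy (\<lambda>n. p (s n))"
  proof (rule CauchyI)
    fix e :: real assume "e > 0"
    then obtain M where M: "\<forall>m\<ge>M. \<forall>n\<ge>M. p (s m - s n) < e"
      using s unfolding cauchy_seqs_def by blast
    have "norm (p (s m) - p (s n)) < e" if "m \<ge> M" "n \<ge> M" for m n
      using M that p_abs_diff[OF cauchy_seqs_in[OF s] cauchy_seqs_in[OF s], of m n] by fastforce
    then show "\<exists>M. \<forall>m\<ge>M. \<forall>n\<ge>M. norm (p (s m) - p (s n)) < e" by blast
  qed
  then show thesis using that Cauchy_convergent convergent_def by blast
qed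

lemma null_rel_refl: "s \<in> cauchy_seqs V p \<Longrightarrow> (s, s) \<in> null_rel V p"
  using p_refl cauchy_seqs_in by (simp add: null_rel_def)

lemma completion_norm_eq:
  assumes "X \<noteq> {}" and "\<And>t. t \<in> X \<Longrightarrow> (\<lambda>n. p (t n)) \<longlonglongrightarrow> a"
  shows "completion_norm p X = a"
  unfolding completion_norm_def
proof (rule the_equality)
  show "\<forall>s\<in>X. (\<lambda>n. p (s n)) \<longlonglongrightarrow> a" using assms(2) by blast
  show "r = a" if "\<forall>s\<in>X. (\<lambda>n. p (s n)) \<longlonglongrightarrow> r" for r
    using assms that LIMSEQ_unique by (metis ex_in_conv)
qed

lemma completion_norm_class:
  assumes "s \<in> cauchy_seqs V p" and "(\<lambda>n. p (s n)) \<longlonglongrightarrow> a"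
  shows "completion_norm p (null_rel V p `` {s}) = a"
  using null_rel_refl[OF assms(1)] null_rel_limit[OF _ assms(2)]
  by (intro completion_norm_eq) auto

end


section \<open>The reduced norm\<close>

text \<open>Left convolution by \<open>f\<close> is Lipschitz with constant \<open>R\<close> for the
  module norm, so it maps Cauchy sequences to Cauchy sequences and equivalent ones to equivalent
  ones. The norm of the image class can therefore be computed along the single representative
  \<open>s\<close>, and \<open>b \<le> R * a\<close> holds termwise before the limit.\<close>

lemma conv_op_class:
  fixes f :: "('d::finite) emap \<times> 'd emap set \<Rightarrow> complex ^ 'n ^ ('n::finite)"
  assumes sep: "uniformly_separated L0" and f: "f \<in> Cc L0"
    and s: "s \<in> cauchy_seqs (Cc L0) (mod_norm L0)"
    and R: "R \<ge> 0" "\<And>L. L \<in> transversal L0 \<Longrightarrow> op_bound L (kern L f) R"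
  defines "X \<equiv> null_rel (Cc L0) (mod_norm L0) `` {s}"
  obtains a b where "(\<lambda>n. mod_norm L0 (s n)) \<longlonglongrightarrow> a" "completion_norm (mod_norm L0) X = a"
    "(\<lambda>n. mod_norm L0 (conv L0 f (s n))) \<longlonglongrightarrow> b"
    "completion_norm (mod_norm L0) (conv_op L0 f X) = b" "b \<le> R * a"
proof -
  let ?V = "Cc L0" and ?p = "mod_norm L0"
  note ax = mod_norm_seminorm[OF sep]
  have sV: "t n \<in> ?V" if "t \<in> cauchy_seqs ?V ?p" for t n
    using that by (auto simp: cauchy_seqs_def)
  have cd: "?p (conv L0 f x - conv L0 f y) \<le> R * ?p (x - y)" if "x \<in> ?V" "y \<in> ?V" for x y
    using mod_norm_conv_le[OF sep f Cc_diff[OF that] R] conv_diff[OF sep that, of f] by simp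
  have cC: "(\<lambda>n. conv L0 f (t n)) \<in> cauchy_seqs ?V ?p" if t: "t \<in> cauchy_seqs ?V ?p" for t
    unfolding cauchy_seqs_def
  proof (intro CollectI conjI allI impI)
    show "range (\<lambda>n. conv L0 f (t n)) \<subseteq> ?V" using conv_Cc[OF sep f] sV[OF t] by auto
    fix e :: real assume e: "e > 0"
    \<comment> \<open>\<open>R\<close> may be 0, hence the denominator \<open>R + 1\<close>.\<close>
    then have "e / (R + 1) > 0" using R(1) by simp
    then obtain M where M: "\<forall>m\<ge>M. \<forall>n\<ge>M. ?p (t m - t n) < e / (R + 1)"
      using t unfolding cauchy_seqs_def by blast
    have "?p (conv L0 f (t m) - conv L0 f (t n)) < e" if "m \<ge> M" "n \<ge> M" for m n
    proof -
      have "?p (conv L0 f (t m) - conv L0 f (t n)) \<le> R * ?p (t m - t n)"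
        using cd sV[OF t] by blast
      also have "\<dots> \<le> R * (e / (R + 1))" using M that R(1) by (intro mult_left_mono) (auto intro: less_imp_le)
      also have "\<dots> < e" using e R(1) by (simp add: field_simps)
      finally show ?thesis .
    qed
    then show "\<exists>M. \<forall>m\<ge>M. \<forall>n\<ge>M. ?p (conv L0 f (t m) - conv L0 f (t n)) < e" by blast
  qed
  obtain a where a: "(\<lambda>n. ?p (s n)) \<longlonglongrightarrow> a"
    by (rule cauchy_seqs_norm_convergent[of ?V ?p, OF ax s])
  obtain b where b: "(\<lambda>n. ?p (conv L0 f (s n))) \<longlonglongrightarrow> b"
    by (rule cauchy_seqs_norm_convergent[of ?V ?p, OF ax cC[OF s]])
  have ca: "completion_norm ?p X = a"
    unfolding X_def by (rule completion_norm_class[of ?V ?p, OF ax s a])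
  have lim: "(\<lambda>n. ?p (u n)) \<longlonglongrightarrow> b" if u: "u \<in> conv_op L0 f X" for u
  proof -
    obtain t where t: "(s, t) \<in> null_rel ?V ?p" "((\<lambda>n. conv L0 f (t n)), u) \<in> null_rel ?V ?p"
      using u by (auto simp: conv_op_def X_def)
    then have tC: "t \<in> cauchy_seqs ?V ?p" by (simp add: null_rel_def)
    have "(\<lambda>n. ?p (s n - t n)) \<longlonglongrightarrow> 0" using t(1) by (simp add: null_rel_def)
    then have "(\<lambda>n. R * ?p (s n - t n)) \<longlonglongrightarrow> 0" by (rule tendsto_mult_right_zero)
    then have "(\<lambda>n. ?p (conv L0 f (s n) - conv L0 f (t n))) \<longlonglongrightarrow> 0"
    proof (rule Lim_null_comparison[rotated])
      have "0 \<le> ?p (conv L0 f (s n) - conv L0 f (t n))" for n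
        using sV[OF cC[OF s]] sV[OF cC[OF tC]] by (intro mod_norm_bounds(1)[OF sep] Cc_diff)
      then show "\<forall>\<^sub>F n in sequentially. norm (?p (conv L0 f (s n) - conv L0 f (t n))) \<le> R * ?p (s n - t n)"
        using cd sV[OF s] sV[OF tC] by simp
    qed
    then have "((\<lambda>n. conv L0 f (s n)), (\<lambda>n. conv L0 f (t n))) \<in> null_rel ?V ?p"
      using cC[OF s] cC[OF tC] by (simp add: null_rel_def)
    from null_rel_limit[of ?V ?p, OF ax this b]
    have "(\<lambda>n. ?p (conv L0 f (t n))) \<longlonglongrightarrow> b" .
    from null_rel_limit[of ?V ?p, OF ax t(2) this] show ?thesis .
  qed
  have "s \<in> X" using null_rel_refl[of ?V ?p, OF ax s] by (simp add: X_def)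
  moreover have "((\<lambda>n. conv L0 f (s n)), (\<lambda>n. conv L0 f (s n))) \<in> null_rel ?V ?p"
    by (rule null_rel_refl[of ?V ?p, OF ax cC[OF s]])
  ultimately have "(\<lambda>n. conv L0 f (s n)) \<in> conv_op L0 f X" unfolding conv_op_def by blast
  then have cb: "completion_norm ?p (conv_op L0 f X) = b"
    using lim by (intro completion_norm_eq[of ?V ?p, OF ax]) auto
  have "b \<le> R * a"
    using b tendsto_mult_left[OF a, of R]
  proof (rule LIMSEQ_le)
    show "\<exists>N. \<forall>n\<ge>N. ?p (conv L0 f (s n)) \<le> R * ?p (s n)"
      using mod_norm_conv_le[OF sep f sV[OF s] R] by blast
  qed
  then show thesis using that a ca b cb by blast
qed

lemma const_cauchy:
  fixes s :: "('d::finite) emap \<times> 'd emap set \<Rightarrow> complex ^ 'n ^ ('n::finite)"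
  assumes "uniformly_separated L0" and "s \<in> Cc L0"
  shows "(\<lambda>n. s) \<in> cauchy_seqs (Cc L0) (mod_norm L0)"
  using mod_norm_seminorm(1)[OF assms assms(2)] assms(2) by (simp add: cauchy_seqs_def)

lemma zero_Cc: "(\<lambda>p. 0) \<in> Cc L0"
  by (auto simp: Cc_iff intro: exI[of _ "{}"])

lemma hilbert_module_bound:
  fixes f :: "('d::finite) emap \<times> 'd emap set \<Rightarrow> complex ^ 'n ^ ('n::finite)"
  assumes sep: "uniformly_separated L0" and f: "f \<in> Cc L0"
    and R: "R \<ge> 0" "\<And>L. L \<in> transversal L0 \<Longrightarrow> op_bound L (kern L f) R"
    and X: "X \<in> hilbert_module L0" "completion_norm (mod_norm L0) X \<le> 1"
  shows "completion_norm (mod_norm L0) (conv_op L0 f X) \<le> R"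
proof -
  obtain s where s: "s \<in> cauchy_seqs (Cc L0) (mod_norm L0)" "X = null_rel (Cc L0) (mod_norm L0) `` {s}"
    using X(1) unfolding hilbert_module_def completion_def by (rule quotientE)
  obtain a b where "completion_norm (mod_norm L0) X = a"
      "completion_norm (mod_norm L0) (conv_op L0 f X) = b" "b \<le> R * a"
    unfolding s(2) by (rule conv_op_class[OF sep f s(1) R]) iprover
  moreover from this have "R * a \<le> R * 1" using X(2) R(1) by (intro mult_left_mono) auto
  ultimately show ?thesis by simp
qed

text \<open>One half of the identification of the reduced norm with the supremum of the operator
  norms over the transversal; the other half is \<open>op_bound_reduced_norm\<close>.\<close>

lemma reduced_norm_le:
  fixes f :: "('d::finite) emap \<times> 'd emap set \<Rightarrow> complex ^ 'n ^ ('n::finite)"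
  assumes sep: "uniformly_separated L0" and f: "f \<in> Cc L0"
    and R: "R \<ge> 0" "\<And>L. L \<in> transversal L0 \<Longrightarrow> op_bound L (kern L f) R"
  shows "reduced_norm L0 f \<le> R"
  unfolding reduced_norm_def op_norm_on_def
proof (rule cSup_least)
  \<comment> \<open>The class of the zero sequence has norm 0, so the set under the supremum is
    nonempty, as \<open>cSup_least\<close> demands.\<close>
  let ?s = "\<lambda>n::nat. \<lambda>p :: 'd emap \<times> 'd emap set. 0 :: complex ^ 'n ^ 'n"
  let ?X = "null_rel (Cc L0) (mod_norm L0) `` {?s}"
  have s: "?s \<in> cauchy_seqs (Cc L0) (mod_norm L0)" using const_cauchy[OF sep zero_Cc] .
  obtain a b where ab: "(\<lambda>n. mod_norm L0 (?s n)) \<longlonglongrightarrow> a" "completion_norm (mod_norm L0) ?X = a"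
    by (rule conv_op_class[OF sep f s R]) iprover
  have "mod_norm L0 (\<lambda>p :: 'd emap \<times> 'd emap set. 0 :: complex ^ 'n ^ 'n) = 0"
    using mod_norm_seminorm(1)[OF sep zero_Cc zero_Cc] by (simp add: fun_diff_def)
  then have "a = 0" using ab(1) by (simp add: LIMSEQ_const_iff)
  moreover have "?X \<in> hilbert_module L0"
    using s unfolding hilbert_module_def completion_def by (rule quotientI)
  ultimately show "{completion_norm (mod_norm L0) (conv_op L0 f v) | v.
      v \<in> hilbert_module L0 \<and> completion_norm (mod_norm L0) v \<le> 1} \<noteq> {}"
    using ab(2) by fastforce
next
  fix q assume "q \<in> {completion_norm (mod_norm L0) (conv_op L0 f v) | v.
      v \<in> hilbert_module L0 \<and> completion_norm (mod_norm L0) v \<le> 1}"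
  then show "q \<le> R" using hilbert_module_bound[OF sep f R] by blast
qed

text \<open>Constant sequences place \<open>Cc L0\<close> in the Hilbert module, and the supremum
  defining the reduced norm is over a bounded set by Schur's test.\<close>

lemma mod_norm_conv_le_reduced_norm:
  fixes f s :: "('d::finite) emap \<times> 'd emap set \<Rightarrow> complex ^ 'n ^ ('n::finite)"
  assumes sep: "uniformly_separated L0" and f: "f \<in> Cc L0" and s: "s \<in> Cc L0" "mod_norm L0 s \<le> 1"
  shows "mod_norm L0 (conv L0 f s) \<le> reduced_norm L0 f"
proof -
  obtain R where R: "R \<ge> 0" "\<And>L. L \<in> transversal L0 \<Longrightarrow> op_bound L (kern L f) R"
    by (rule Cc_op_bound[OF sep f]) iprover
  let ?Q = "{completion_norm (mod_norm L0) (conv_op L0 f v) | v.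
      v \<in> hilbert_module L0 \<and> completion_norm (mod_norm L0) v \<le> 1}"
  let ?X = "null_rel (Cc L0) (mod_norm L0) `` {\<lambda>n::nat. s}"
  have c: "(\<lambda>n. s) \<in> cauchy_seqs (Cc L0) (mod_norm L0)" using const_cauchy[OF sep s(1)] .
  obtain a b where ab: "(\<lambda>n. mod_norm L0 s) \<longlonglongrightarrow> a" "completion_norm (mod_norm L0) ?X = a"
    "(\<lambda>n. mod_norm L0 (conv L0 f s)) \<longlonglongrightarrow> b" "completion_norm (mod_norm L0) (conv_op L0 f ?X) = b"
    by (rule conv_op_class[OF sep f c R]) iprover
  have "?X \<in> hilbert_module L0"
    using c unfolding hilbert_module_def completion_def by (rule quotientI)
  moreover have "completion_norm (mod_norm L0) ?X \<le> 1" using ab s(2) by (simp add: LIMSEQ_const_iff)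
  ultimately have "b \<in> ?Q" using ab(4) by blast
  moreover have "bdd_above ?Q"
    using hilbert_module_bound[OF sep f R] by (intro bdd_aboveI[where M = R]) blast
  ultimately have "b \<le> Sup ?Q" by (rule cSup_upper)
  then show ?thesis using ab(3) by (simp add: reduced_norm_def op_norm_on_def LIMSEQ_const_iff)
qed

text \<open>The idea is to use bump functions with disjoint supports, each of which meets every
  \<open>L'\<close> at most once.\<close>

lemma extend_fin_supp:
  fixes \<phi> :: "('d::finite) emap \<Rightarrow> complex ^ ('n::finite)"
  assumes sep: "uniformly_separated L0" and L: "L \<in> transversal L0" and p: "\<phi> \<in> fin_supp L"
  obtains s and v :: "complex ^ 'n" where "s \<in> Cc L0" "norm v = 1" "slice L s v = \<phi>" "mod_norm L0 s \<le> ell2_norm L \<phi>"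
proof -
  define A where "A = {k. \<phi> k \<noteq> 0}"
  have A: "finite A" "A \<subseteq> L" using fin_suppD[OF p] by (auto simp: A_def)
  have Ai: "A \<subseteq> isoE" using A(2) transversal_isoE[OF L] by blast
  obtain r where r: "\<And>k. k \<in> A \<Longrightarrow> r k > 0"
    "\<And>k L x y. k \<in> A \<Longrightarrow> L \<in> dynamical_hull L0 \<Longrightarrow> x \<in> L \<inter> isoE_cball k (r k) \<Longrightarrow>
       y \<in> L \<inter> isoE_cball k (r k) \<Longrightarrow> x = y"
    "\<And>k k' g. k \<in> A \<Longrightarrow> k' \<in> A \<Longrightarrow> g \<in> isoE_ball k (r k) \<Longrightarrow> g \<in> isoE_ball k' (r k') \<Longrightarrow> k = k'"
    by (rule separating_cballs[OF sep A(1) Ai]) iprover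
  \<comment> \<open>A tent in the coordinate metric, equal to 1 at \<open>k\<close> and 0 outside
    the open ball of radius \<open>r k\<close>.\<close>
  define bump where "bump k g = max 0 (1 - dist (iso_coord g) (iso_coord k) / r k)" for k g :: "'d emap"
  have chi0: "0 \<le> bump k g" "bump k g \<le> 1" if "k \<in> A" for k g
    using r(1)[OF that] by (auto simp: bump_def)
  have chi_ball: "g \<in> isoE_ball k (r k)" if "k \<in> A" "g \<in> isoE" "bump k g \<noteq> 0" for k g
    using that r(1)[OF that(1)] by (auto simp: bump_def isoE_ball_def max_def field_simps split: if_splits)
  have chi1: "bump k k = 1" for k by (simp add: bump_def)
  \<comment> \<open>Any column will do. \<open>B k\<close> carries \<open>\<phi> k\<close> in column
    \<open>i0\<close>, so it sends the unit vector of index \<open>i0\<close> to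
    \<open>\<phi> k\<close> and lengthens no vector by more than the factor
    \<open>norm (\<phi> k)\<close>.\<close>
  define i0 where "i0 = (undefined :: 'n)"
  define B :: "'d emap \<Rightarrow> complex ^ 'n ^ 'n" where "B k = (\<chi> i j. if j = i0 then \<phi> k $ i else 0)" for k
  have B: "B k *v v = (v $ i0) *s \<phi> k" for k v
  proof -
    have "(if j = i0 then a else 0) * x j = (if j = i0 then a * x i0 else 0)"
      for j and a :: complex and x by simp
    then show ?thesis by (simp add: B_def matrix_vector_mult_def vec_eq_iff)
  qed
  define s where "s q = (if q \<in> groupoid L0 then \<Sum>k\<in>A. bump k (fst q) *\<^sub>R B k else 0)" for q
  have sl: "slice L' s v g = (if g \<in> L' then \<Sum>k\<in>A. bump k g *\<^sub>R ((v $ i0) *s \<phi> k) else 0)"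
    if "L' \<in> transversal L0" for L' v g
    using that by (simp add: slice_def s_def groupoid_iff matrix_vector_mult_sum_left
        matrix_vector_mult_scaleR_left B)
  have r_nz: "r k \<noteq> 0" if "k \<in> A" for k using r(1)[OF that] by simp
  have "continuous_map (groupoid_top L0) euclidean (\<lambda>q. iso_coord (fst q))"
    using continuous_map_compose[OF continuous_map_groupoid_fst iso_coord_continuous] by (simp add: o_def)
  then have "continuous_map (groupoid_top L0) euclidean (\<lambda>q. \<Sum>k\<in>A. bump k (fst q) *\<^sub>R B k)"
    unfolding continuous_map_euclidean_iff_tendsto bump_def
    using r_nz by (auto intro!: tendsto_intros)
  then have "continuous_map (groupoid_top L0) euclidean s"
    by (rule continuous_map_eq) (simp add: s_def)
  moreover have "compactin isoE_top (\<Union>k\<in>A. isoE_cball k (r k))"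
    using A(1) compactin_isoE_cball by (intro compactin_Union) auto
  moreover have "g \<in> (\<Union>k\<in>A. isoE_cball k (r k))" if "s (g, L') \<noteq> 0" for g L'
  proof -
    have gL: "(g, L') \<in> groupoid L0" using that by (auto simp: s_def split: if_splits)
    then have g: "g \<in> isoE" using transversal_isoE by (auto simp: groupoid_iff)
    have "(\<Sum>k\<in>A. bump k g *\<^sub>R B k) \<noteq> 0" using that gL by (simp add: s_def)
    then obtain k where "k \<in> A" "bump k g *\<^sub>R B k \<noteq> 0" by (rule sum.not_neutral_contains_not_neutral)
    then show ?thesis using chi_ball[of k g] g isoE_ball_subset_cball by fastforce
  qed
  moreover have "s q = 0" if "q \<notin> groupoid L0" for q using that by (simp add: s_def)
  ultimately have sC: "s \<in> Cc L0" unfolding Cc_iff by blast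
  define v :: "complex ^ 'n" where "v = axis i0 1"
  have "slice L s v = \<phi>"
  proof
    fix g
    show "slice L s v g = \<phi> g"
    proof (cases "g \<in> A")
      case True
      then have gL: "g \<in> L" "g \<in> isoE" using A Ai by auto
      have "bump k g = 0" if "k \<in> A" "k \<noteq> g" for k
      proof (rule ccontr)
        assume "bump k g \<noteq> 0"
        then have "g \<in> isoE_ball k (r k)" using chi_ball that(1) gL by blast
        moreover have "g \<in> isoE_ball g (r g)" using r(1)[OF True] gL by (simp add: isoE_ball_def)
        ultimately show False using r(3)[OF that(1) True] that(2) by blast
      qed
      then have "(\<Sum>k\<in>A. bump k g *\<^sub>R ((v $ i0) *s \<phi> k)) = (\<Sum>k\<in>A. if k = g then \<phi> g else 0)"
        by (intro sum.cong refl) (auto simp: chi1 v_def axis_def)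
      then show ?thesis using sl[OF L] gL True A(1) by simp
    next
      case False
      then have 0: "\<phi> g = 0" by (simp add: A_def)
      \<comment> \<open>The ball around \<open>k\<close> already contains the point \<open>k\<close>
        of \<open>L\<close>, hence no other point of \<open>L\<close>.\<close>
      have "bump k g = 0" if gL: "g \<in> L" and k: "k \<in> A" for k
      proof (rule ccontr)
        assume "bump k g \<noteq> 0"
        then have "g \<in> isoE_cball k (r k)"
          using chi_ball k transversal_isoE[OF L gL] isoE_ball_subset_cball by blast
        moreover have "k \<in> isoE_cball k (r k)" using r(1)[OF k] k Ai by (auto simp: isoE_cball_def)
        ultimately have "g = k" using r(2)[OF k transversal_hull[OF L]] gL k A(2) by blast
        then show False using False k by simp
      qed
      then show ?thesis using sl[OF L] 0 by simp
    qed
  qed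
  moreover have "mod_norm L0 s \<le> ell2_norm L \<phi>"
  proof (rule mod_norm_le[OF sep sC])
    show "mod_bound L0 s (ell2_norm L \<phi>)"
      unfolding mod_bound_def
    proof (intro ballI allI)
      fix L' and u :: "complex ^ 'n" assume L': "L' \<in> transversal L0"
      \<comment> \<open>The balls are disjoint, so at most one \<open>k\<close> contributes at
        \<open>g\<close>. Writing its contribution as a sum over \<open>A\<close> prepares the
        exchange of sums below.\<close>
      have pt: "(norm (slice L' s u g))\<^sup>2 \<le>
          (\<Sum>k\<in>A. if g \<in> isoE_ball k (r k) then (norm u)\<^sup>2 * (norm (\<phi> k))\<^sup>2 else 0)"
        (is "_ \<le> ?T g") if gL: "g \<in> L'" for g
      proof (cases "\<exists>k\<in>A. g \<in> isoE_ball k (r k)")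
        case True
        then obtain k where k: "k \<in> A" "g \<in> isoE_ball k (r k)" by blast
        have gi: "g \<in> isoE" using transversal_isoE[OF L' gL] .
        have z: "bump k' g = 0" if "k' \<in> A" "k' \<noteq> k" for k'
          using chi_ball[OF that(1) gi] r(3)[OF that(1) k(1) _ k(2)] that(2) by blast
        have "slice L' s u g = (\<Sum>k'\<in>A. if k' = k then bump k g *\<^sub>R ((u $ i0) *s \<phi> k) else 0)"
          using sl[OF L'] gL z by (auto intro: sum.cong)
        then have "norm (slice L' s u g) = bump k g * (norm (u $ i0) * norm (\<phi> k))"
          using A(1) k(1) chi0(1)[OF k(1)] by (simp add: norm_smult_vec)
        also have "\<dots> \<le> 1 * (norm u * norm (\<phi> k))"
          using chi0[OF k(1)] Finite_Cartesian_Product.norm_nth_le[of u i0]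
          by (intro mult_mono mult_right_mono) auto
        finally have "(norm (slice L' s u g))\<^sup>2 \<le> (norm u * norm (\<phi> k))\<^sup>2"
          by (intro power_mono) auto
        also have "\<dots> = (if g \<in> isoE_ball k (r k) then (norm u)\<^sup>2 * (norm (\<phi> k))\<^sup>2 else 0)"
          using k(2) by (simp add: power_mult_distrib)
        also have "\<dots> \<le> ?T g" using A(1) k(1) by (intro member_le_sum) auto
        finally show ?thesis .
      next
        case False
        then have "bump k g = 0" if "k \<in> A" for k
          using chi_ball[OF that transversal_isoE[OF L' gL]] that by blast
        then have "slice L' s u g = 0" using sl[OF L'] by simp
        then show ?thesis by (simp add: sum_nonneg)
      qed
      show "ell2_norm L' (slice L' s u) \<le> ell2_norm L \<phi> * norm u"
      proof (rule ell2I(2))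
        show "slice L' s u x = 0" if "x \<notin> L'" for x using sl[OF L'] that by simp
        fix S assume S: "finite S" "S \<subseteq> L'"
        have "(\<Sum>g\<in>S. (norm (slice L' s u g))\<^sup>2) \<le> (\<Sum>g\<in>S. \<Sum>k\<in>A.
            if g \<in> isoE_ball k (r k) then (norm u)\<^sup>2 * (norm (\<phi> k))\<^sup>2 else 0)"
          using S pt by (intro sum_mono) blast
        also have "\<dots> = (\<Sum>k\<in>A. \<Sum>g\<in>S. if g \<in> isoE_ball k (r k) then (norm u)\<^sup>2 * (norm (\<phi> k))\<^sup>2 else 0)"
          by (rule sum.swap)
        \<comment> \<open>\<open>L'\<close> has at most one point in each ball, so every
          \<open>k\<close> is counted at most once.\<close>
        also have "\<dots> \<le> (\<Sum>k\<in>A. (norm u)\<^sup>2 * (norm (\<phi> k))\<^sup>2)"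
        proof (rule sum_mono)
          fix k assume k: "k \<in> A"
          have "x = y" if "x \<in> S \<inter> isoE_ball k (r k)" "y \<in> S \<inter> isoE_ball k (r k)" for x y
            using r(2)[OF k transversal_hull[OF L'], of x y] that S(2) isoE_ball_subset_cball by blast
          then have "card (S \<inter> isoE_ball k (r k)) \<le> 1"
            using S(1) by (simp add: card_le_Suc0_iff_eq)
          then have "real (card (S \<inter> isoE_ball k (r k))) * ((norm u)\<^sup>2 * (norm (\<phi> k))\<^sup>2) \<le>
              1 * ((norm u)\<^sup>2 * (norm (\<phi> k))\<^sup>2)"
            by (intro mult_right_mono) auto
          moreover have "(\<Sum>g\<in>S. if g \<in> isoE_ball k (r k) then (norm u)\<^sup>2 * (norm (\<phi> k))\<^sup>2 else 0) =
              real (card (S \<inter> isoE_ball k (r k))) * ((norm u)\<^sup>2 * (norm (\<phi> k))\<^sup>2)"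
            using S(1) by (simp add: sum.If_cases)
          ultimately show "(\<Sum>g\<in>S. if g \<in> isoE_ball k (r k) then (norm u)\<^sup>2 * (norm (\<phi> k))\<^sup>2 else 0)
              \<le> (norm u)\<^sup>2 * (norm (\<phi> k))\<^sup>2"
            by linarith
        qed
        also have "\<dots> = (norm u)\<^sup>2 * ip \<phi> \<phi>"
          by (simp add: ip_def A_def power2_norm_eq_inner flip: sum_distrib_left)
        also have "\<dots> = (ell2_norm L \<phi> * norm u)\<^sup>2"
          using fin_supp_ell2(2)[OF p] by (simp add: power_mult_distrib mult.commute)
        finally show "(\<Sum>g\<in>S. (norm (slice L' s u g))\<^sup>2) \<le> (ell2_norm L \<phi> * norm u)\<^sup>2" .
      qed simp
    qed
  qed simp
  moreover have "norm v = 1" by (simp add: v_def norm_axis_1)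
  ultimately show thesis using that sC by blast
qed

text \<open>A finitely supported vector of norm at most 1 over \<open>L\<close> is a slice of a
  module element of norm at most 1, by \<open>extend_fin_supp\<close>, and left convolution acts on
  that slice as the operator over \<open>L\<close>. Hence the reduced norm dominates the operator
  norm over each single \<open>L\<close>.\<close>

lemma op_bound_reduced_norm:
  fixes f :: "('d::finite) emap \<times> 'd emap set \<Rightarrow> complex ^ 'n ^ ('n::finite)"
  assumes sep: "uniformly_separated L0" and f: "f \<in> Cc L0" and L: "L \<in> transversal L0"
  shows "op_bound L (kern L f) (reduced_norm L0 f)" and "reduced_norm L0 f \<ge> 0"
proof -
  obtain M C where b: "banded L (kern L f) M C" by (rule kern_banded_at[OF sep f L])
  have unit: "ip (mop L (kern L f) \<phi>) (mop L (kern L f) \<phi>) \<le> (reduced_norm L0 f)\<^sup>2 \<and> reduced_norm L0 f \<ge> 0"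
    if p: "\<phi> \<in> fin_supp L" and le: "ip \<phi> \<phi> \<le> 1" for \<phi>
  proof -
    have "(ell2_norm L \<phi>)\<^sup>2 \<le> 1\<^sup>2" using fin_supp_ell2(2)[OF p] le by simp
    then have n1: "ell2_norm L \<phi> \<le> 1" by (rule power2_le_imp_le) simp
    obtain s v where s: "s \<in> Cc L0" "norm v = 1" "slice L s v = \<phi>" "mod_norm L0 s \<le> ell2_norm L \<phi>"
      by (rule extend_fin_supp[OF sep L p])
    have c: "conv L0 f s \<in> Cc L0" using conv_Cc[OF sep f s(1)] .
    have "ell2_norm L (mop L (kern L f) \<phi>) = ell2_norm L (slice L (conv L0 f s) v)"
      using slice_conv[OF L _ sep f s(1), of v] s(3) p by simp
    also have "\<dots> \<le> mod_norm L0 (conv L0 f s) * norm v"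
      using mod_norm_bounds(2)[OF sep c] L by (simp add: mod_bound_def)
    also have "\<dots> \<le> reduced_norm L0 f"
      using mod_norm_conv_le_reduced_norm[OF sep f s(1)] s(2,4) n1 by simp
    finally have le: "ell2_norm L (mop L (kern L f) \<phi>) \<le> reduced_norm L0 f" .
    then have "reduced_norm L0 f \<ge> 0" by (rule order_trans[OF ell2_norm_nonneg])
    moreover have "(ell2_norm L (mop L (kern L f) \<phi>))\<^sup>2 \<le> (reduced_norm L0 f)\<^sup>2"
      using le by (intro power_mono) auto
    ultimately show ?thesis using fin_supp_ell2(2)[OF mop_fin_supp[OF b p]] by simp
  qed
  have "(\<lambda>x. 0) \<in> fin_supp L" "ip (\<lambda>x. 0) (\<lambda>x. 0 :: complex ^ 'n) \<le> 1"
    by (simp_all add: fin_supp_def ip_def)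
  then show "reduced_norm L0 f \<ge> 0" using unit by blast
  show "op_bound L (kern L f) (reduced_norm L0 f)"
    unfolding op_bound_def
  proof
    fix \<phi> :: "'d emap \<Rightarrow> complex ^ 'n" assume p: "\<phi> \<in> fin_supp L"
    show "ip (mop L (kern L f) \<phi>) (mop L (kern L f) \<phi>) \<le> (reduced_norm L0 f)\<^sup>2 * ip \<phi> \<phi>"
    proof (cases "ip \<phi> \<phi> = 0")
      case True
      then have "\<phi> = (\<lambda>x. 0)"
        using fin_supp_ell2[OF p] by (intro ell2_norm_eq_0) auto
      then have "mop L (kern L f) \<phi> = (\<lambda>x. 0)" by (simp add: mop_def fun_eq_iff)
      then show ?thesis using True by (simp add: ip_def)
    next
      case False
      then have pos: "ip \<phi> \<phi> > 0" using ip_nonneg[of \<phi>] by linarith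
      \<comment> \<open>Rescaling to norm 1. The factor used below is \<open>- c\<close>, because
        \<open>fin_supp_combine\<close> and \<open>mop_combine\<close> are stated for differences
        and are applied to \<open>0 - c *\<^sub>R \<phi> x\<close>.\<close>
      define c where "c = 1 / sqrt (ip \<phi> \<phi>)"
      have c2: "c\<^sup>2 * ip \<phi> \<phi> = 1" using pos by (simp add: c_def power_divide)
      have z: "(\<lambda>x. 0) \<in> fin_supp L" by (simp add: fin_supp_def)
      have m: "mop L (kern L f) \<phi> \<in> fin_supp L" using b p by (rule mop_fin_supp)
      let ?\<psi> = "\<lambda>x. (- c) *\<^sub>R \<phi> x"
      have ps: "?\<psi> \<in> fin_supp L" using fin_supp_combine[OF z p, of c] by simp
      have "mop L (kern L f) ?\<psi> = (\<lambda>x. (- c) *\<^sub>R mop L (kern L f) \<phi> x)"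
        using mop_combine[OF b, of "\<lambda>x. 0" c \<phi>] by (simp add: mop_def fun_eq_iff)
      then have "c\<^sup>2 * ip (mop L (kern L f) \<phi>) (mop L (kern L f) \<phi>) =
          ip (mop L (kern L f) ?\<psi>) (mop L (kern L f) ?\<psi>)"
        using ip_scale[OF m, of "- c"] by simp
      also have "\<dots> \<le> (reduced_norm L0 f)\<^sup>2"
        using unit[OF ps] ip_scale[OF p, of "- c"] c2 by simp
      finally have "(c\<^sup>2 * ip \<phi> \<phi>) * ip (mop L (kern L f) \<phi>) (mop L (kern L f) \<phi>) \<le>
          (reduced_norm L0 f)\<^sup>2 * ip \<phi> \<phi>"
        using pos by (simp add: mult_right_mono ac_simps)
      then show ?thesis by (simp add: c2)
    qed
  qed
qed


section \<open>Dynamical matrices\<close>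

lemma transversal_punctured: "L \<in> transversal L0 \<Longrightarrow> L \<in> punctured_hull L0"
  using transversal_hull transversal_id by (fastforce simp: punctured_hull_def)

lemma coupling_fun_Cc:
  fixes w :: "('d::finite, 'n::finite) coupling"
  assumes "admissible_coupling L0 w"
  shows "coupling_fun L0 w \<in> Cc L0"
proof -
  have "finite_range L0 w" and c: "continuous_map (groupoid_top L0) euclidean (\<lambda>(g, L). w L g id)"
    using assms by (simp_all add: admissible_coupling_def continuous_coupling_def)
  then obtain K where K: "compactin isoE_top K"
    "\<And>L x x'. L \<in> punctured_hull L0 \<Longrightarrow> x \<in> L \<Longrightarrow> x' \<in> L \<Longrightarrow> act x' x \<notin> K \<Longrightarrow> w L x x' = 0"
    unfolding finite_range_def by blast
  have "continuous_map (groupoid_top L0) euclidean (coupling_fun L0 w)"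
    using c by (rule continuous_map_eq) (auto simp: coupling_fun_def)
  moreover have "g \<in> K" if nz: "coupling_fun L0 w (g, L) \<noteq> 0" for g L
  proof (rule ccontr)
    assume "g \<notin> K"
    have L: "L \<in> transversal L0" "g \<in> L"
      using nz by (auto simp: coupling_fun_def groupoid_iff split: if_splits)
    have "act id g = g" by (simp add: act_def)
    then have "w L g id = 0"
      using K(2)[OF transversal_punctured[OF L(1)] L(2) transversal_id[OF L(1)]] \<open>g \<notin> K\<close> by simp
    then show False using nz by (simp add: coupling_fun_def split: if_splits)
  qed
  moreover have "coupling_fun L0 w p = 0" if "p \<notin> groupoid L0" for p
    using that by (cases p) (simp add: coupling_fun_def)
  ultimately show ?thesis unfolding Cc_iff using K(1) by blast
qed

lemma kern_coupling_fun:
  assumes w: "equivariant L0 w" and L: "L \<in> transversal L0" and x: "x \<in> L" and y: "y \<in> L"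
  shows "kern L (coupling_fun L0 w) x y = w L x y"
proof -
  have y': "y \<in> isoE" using transversal_isoE[OF L y] .
  \<comment> \<open>The second index \<open>id\<close> is rewritten as \<open>act y y\<close>, so
    that equivariance under \<open>y\<close> applies.\<close>
  have "kern L (coupling_fun L0 w) x y = w (act_set y L) (act y x) (act y y)"
    using groupoid_kernel[OF L x y] y' by (simp add: kern_def coupling_fun_def act_def)
  also have "\<dots> = w L x y"
    using w transversal_punctured[OF L] x y y' by (simp add: equivariant_def)
  finally show ?thesis .
qed

lemma dynamical_matrix_eq_left_regular:
  fixes w :: "('d::finite, 'n::finite) coupling"
  assumes sep: "uniformly_separated L0" and w: "admissible_coupling L0 w" and L: "L \<in> transversal L0"
  shows "dynamical_matrix w L = left_regular L (coupling_fun L0 w)"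
proof -
  let ?k = "kern L (coupling_fun L0 w)"
  have e: "?k x y = w L x y" if "x \<in> L" "y \<in> L" for x y
    using kern_coupling_fun[where w = w, OF _ L that] w by (simp add: admissible_coupling_def)
  obtain M C where b: "banded L ?k M C" by (rule kern_banded_at[OF sep coupling_fun_Cc[OF w] L])
  have "(\<Sum>\<^sub>\<infinity>(x, x')\<in>L \<times> L. ketbra (w L x x') x x' \<phi> y) = mop L ?k \<phi> y" for \<phi> y
  proof (cases "y \<in> L")
    case True
    let ?S = "{x' \<in> L. ?k y x' \<noteq> 0}"
    have S: "finite ?S" using b True by (rule banded_row)
    \<comment> \<open>Only terms with first index \<open>y\<close> contribute to the entry at
      \<open>y\<close>, and among these only the finitely many nonzero entries of row
      \<open>y\<close>.\<close>
    have "(\<Sum>\<^sub>\<infinity>(x, x')\<in>L \<times> L. ketbra (w L x x') x x' \<phi> y) =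
        (\<Sum>(x, x')\<in>{y} \<times> ?S. ketbra (w L x x') x x' \<phi> y)"
      using S True e by (intro infsum_eq_sum) (auto simp: ketbra_def split: if_splits)
    also have "\<dots> = (\<Sum>x'\<in>?S. ?k y x' *v \<phi> x')"
      using True e by (simp add: ketbra_def flip: sum.cartesian_product)
    also have "\<dots> = mop L ?k \<phi> y" using mop_row[OF b True] by simp
    finally show ?thesis .
  next
    case False
    then have "(\<Sum>\<^sub>\<infinity>(x, x')\<in>L \<times> L. ketbra (w L x x') x x' \<phi> y) = 0"
      by (intro infsum_0) (auto simp: ketbra_def)
    then show ?thesis using False by (simp add: mop_outside)
  qed
  then show ?thesis by (simp add: dynamical_matrix_def left_regular_eq restrict_def)
qed


section \<open>Norm limits lie in the image of the reduced C*-algebra\<close>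

text \<open>The definite description asks for a limit common to all representatives. Another
  representative \<open>t\<close> has the same limit because the operator norm over \<open>L\<close>
  is at most the reduced norm; uniqueness is tested on \<open>h\<close> alone.\<close>

lemma left_regular_ext_eq:
  fixes h :: "nat \<Rightarrow> ('d::finite) emap \<times> 'd emap set \<Rightarrow> complex ^ 'n ^ ('n::finite)"
  assumes sep: "uniformly_separated L0" and L: "L \<in> transversal L0" and T: "T \<in> bounded_ops L"
    and h: "h \<in> cauchy_seqs (Cc L0) (reduced_norm L0)"
    and lim: "\<And>e. e > 0 \<Longrightarrow> \<exists>N. \<forall>n\<ge>N. op_close L (left_regular L (h n)) T e"
  shows "left_regular_ext L (null_rel (Cc L0) (reduced_norm L0) `` {h}) = T"
  unfolding left_regular_ext_def
proof (rule the_equality)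
  have hC: "t n \<in> Cc L0" if "t \<in> cauchy_seqs (Cc L0) (reduced_norm L0)" for t n
    using that by (auto simp: cauchy_seqs_def)
  have bo: "left_regular L (t n) \<in> bounded_ops L" if "t \<in> cauchy_seqs (Cc L0) (reduced_norm L0)" for t n
    using left_regular_bounded_ops[OF sep hC[OF that] L] .
  have tends: "tends_in_op_norm L (\<lambda>n. left_regular L (t n)) T"
    if t: "(h, t) \<in> null_rel (Cc L0) (reduced_norm L0)" for t
  proof -
    have tC: "t \<in> cauchy_seqs (Cc L0) (reduced_norm L0)"
      and n0: "(\<lambda>n. reduced_norm L0 (h n - t n)) \<longlonglongrightarrow> 0"
      using t by (auto simp: null_rel_def)
    show ?thesis
      unfolding tends_in_op_norm_iff[OF bo[OF tC] T]
    proof (intro allI impI)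
      fix e :: real assume e: "e > 0"
      then obtain N1 where N1: "\<And>n. n \<ge> N1 \<Longrightarrow> norm (reduced_norm L0 (h n - t n) - 0) < e / 2"
        using LIMSEQ_D[OF n0, of "e / 2"] by (meson half_gt_zero)
      obtain N2 where N2: "\<And>n. n \<ge> N2 \<Longrightarrow> op_close L (left_regular L (h n)) T (e / 2)"
        using lim[of "e / 2"] e by (meson half_gt_zero)
      have "op_close L (left_regular L (t n)) T e" if n: "n \<ge> max N1 N2" for n
      proof -
        have d: "h n - t n \<in> Cc L0" using hC[OF h] hC[OF tC] by (rule Cc_diff)
        have "op_close L (left_regular L (h n)) (left_regular L (t n)) (reduced_norm L0 (h n - t n))"
          using left_regular_close_iff[OF sep hC[OF h] hC[OF tC] L op_bound_reduced_norm(2)[OF sep d L]]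
            op_bound_reduced_norm(1)[OF sep d L] by blast
        moreover have "reduced_norm L0 (h n - t n) \<le> e / 2" using N1[of n] n by simp
        ultimately have "op_close L (left_regular L (t n)) (left_regular L (h n)) (e / 2)"
          using op_close_mono op_close_commute by blast
        then have "op_close L (left_regular L (t n)) T (e / 2 + e / 2)"
          using N2[of n] n by (intro op_close_trans[OF bo[OF tC] bo[OF h] T]) auto
        then show ?thesis by simp
      qed
      then show "\<exists>N. \<forall>n\<ge>N. op_close L (left_regular L (t n)) T e" by blast
    qed
  qed
  then show "T \<in> bounded_ops L \<and> (\<forall>s\<in>null_rel (Cc L0) (reduced_norm L0) `` {h}.
      tends_in_op_norm L (\<lambda>n. left_regular L (s n)) T)"
    using T by blast
  fix U assume U: "U \<in> bounded_ops L \<and> (\<forall>s\<in>null_rel (Cc L0) (reduced_norm L0) `` {h}.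
      tends_in_op_norm L (\<lambda>n. left_regular L (s n)) U)"
  \<comment> \<open>Needed for \<open>h\<close> to belong to its own class.\<close>
  have "reduced_norm L0 (h n - h n) = 0" for n
  proof (rule order_antisym)
    show "reduced_norm L0 (h n - h n) \<le> 0"
      by (rule reduced_norm_le[OF sep Cc_diff[OF hC[OF h] hC[OF h]] _ op_bound_self_diff]) simp
    show "0 \<le> reduced_norm L0 (h n - h n)"
      using op_bound_reduced_norm(2)[OF sep Cc_diff[OF hC[OF h] hC[OF h]] L] .
  qed
  then have "(h, h) \<in> null_rel (Cc L0) (reduced_norm L0)" using h by (simp add: null_rel_def)
  then have U': "tends_in_op_norm L (\<lambda>n. left_regular L (h n)) U" using U by blast
  show "U = T"
  proof (rule op_close_eq)
    show "U \<in> bounded_ops L" using U by blast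
    show "T \<in> bounded_ops L" by (rule T)
    fix r :: real assume r: "r > 0"
    have "\<forall>e>0. \<exists>N. \<forall>n\<ge>N. op_close L (left_regular L (h n)) U e"
      using U' U tends_in_op_norm_iff[of "\<lambda>n. left_regular L (h n)" L U, OF bo[OF h]] by simp
    then obtain N1 where N1: "\<And>n. n \<ge> N1 \<Longrightarrow> op_close L (left_regular L (h n)) U (r / 2)"
      using r by (meson half_gt_zero)
    obtain N2 where N2: "\<And>n. n \<ge> N2 \<Longrightarrow> op_close L (left_regular L (h n)) T (r / 2)"
      using lim[of "r / 2"] r by (meson half_gt_zero)
    let ?n = "max N1 N2"
    have "op_close L U T (r / 2 + r / 2)"
    proof (rule op_close_trans[OF _ bo[OF h] T])
      show "U \<in> bounded_ops L" using U by blast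
      show "op_close L U (left_regular L (h ?n)) (r / 2)"
        using N1[of ?n] by (subst op_close_commute) simp
      show "op_close L (left_regular L (h ?n)) T (r / 2)" using N2[of ?n] by simp
    qed
    then show "op_close L U T r" by simp
  qed
qed

text \<open>Each round takes a fresh approximant \<open>f\<close> of \<open>T\<close> over
  \<open>L\<close>, but adds to \<open>h\<close> only a norm-controlled substitute for
  \<open>f - h\<close>. The resulting sequence has the limit \<open>T\<close> over \<open>L\<close>
  and is Cauchy over the whole transversal.\<close>

lemma norm_limit_in_image:
  fixes T :: "(('d::finite) emap \<Rightarrow> complex ^ 'n) \<Rightarrow> ('d emap \<Rightarrow> complex ^ ('n::finite))"
  assumes sep: "uniformly_separated L0" and L: "L \<in> transversal L0" and T: "T \<in> bounded_ops L"
    and approx: "\<And>e. e > 0 \<Longrightarrow> \<exists>f\<in>Cc L0. op_close L (left_regular L f) T e"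
  shows "T \<in> left_regular_ext L ` reduced_cstar L0"
proof -
  \<comment> \<open>\<open>P\<close> is the rate of convergence to \<open>T\<close> over the given
    \<open>L\<close>; \<open>Q\<close> concerns all architectures and makes the sequence Cauchy in
    the reduced norm.\<close>
  define P where "P n h \<longleftrightarrow> h \<in> Cc L0 \<and> op_close L (left_regular L h) T ((1 / 2) ^ n)"
    for n and h :: "'d emap \<times> 'd emap set \<Rightarrow> complex ^ 'n ^ 'n"
  define Q where "Q n h h' \<longleftrightarrow>
      (\<forall>L'\<in>transversal L0. op_bound L' (kern L' (h' - h)) (9 / 4 * (1 / 2) ^ n))"
    for n and h h' :: "'d emap \<times> 'd emap set \<Rightarrow> complex ^ 'n ^ 'n"
  have "\<exists>h. P 0 h" using approx[of 1] by (auto simp: P_def)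
  moreover have "\<exists>h'. P (Suc n) h' \<and> Q n h h'" if "P n h" for n h
  proof -
    have h: "h \<in> Cc L0" "op_close L (left_regular L h) T ((1 / 2) ^ n)"
      using that by (simp_all add: P_def)
    define d :: real where "d = (1 / 2) ^ n"
    have d: "d > 0" by (simp add: d_def)
    \<comment> \<open>With \<open>f\<close> within \<open>d / 8\<close> of \<open>T\<close>, the
      difference \<open>f - h\<close> has norm at most \<open>9 / 8 * d\<close> over
      \<open>L\<close>. Its lift has at most twice this norm over the transversal, which is the
      \<open>9 / 4\<close> in \<open>Q\<close>. The new distance to \<open>T\<close> is at most
      \<open>9 / 8 * d / 15 + d / 8 = d / 5\<close>, below the required
      \<open>d / 2\<close>.\<close>
    obtain f where f: "f \<in> Cc L0" "op_close L (left_regular L f) T (d / 8)"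
      using approx[of "d / 8"] d by auto
    have bo: "left_regular L f \<in> bounded_ops L" "left_regular L h \<in> bounded_ops L"
      using left_regular_bounded_ops[OF sep _ L] f(1) h(1) by auto
    have "op_close L (left_regular L f) (left_regular L h) (d / 8 + d)"
      using f(2) h(2) op_close_commute unfolding d_def
      by (intro op_close_trans[OF bo(1) T bo(2)]) auto
    then have ob: "op_bound L (kern L (f - h)) (9 / 8 * d)"
      using left_regular_close_iff[OF sep f(1) h(1) L, of "9 / 8 * d"] d by simp
    obtain g where g: "g \<in> Cc L0" "\<And>L'. L' \<in> transversal L0 \<Longrightarrow> op_bound L' (kern L' g) (2 * (9 / 8 * d))"
      "op_bound L (kern L (f - h - g)) (9 / 8 * d / 15)"
      by (rule norm_controlled_lift[OF sep L _ Cc_diff[OF f(1) h(1)] ob]) (use d in \<open>simp, iprover\<close>)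
    define h' where "h' = (\<lambda>p. h p + g p)"
    have h': "h' \<in> Cc L0" unfolding h'_def using h(1) g(1) by (rule Cc_add)
    have bo': "left_regular L h' \<in> bounded_ops L" using left_regular_bounded_ops[OF sep h' L] .
    have "f - h' = f - h - g" by (auto simp: h'_def fun_eq_iff)
    then have "op_close L (left_regular L f) (left_regular L h') (9 / 8 * d / 15)"
      using left_regular_close_iff[OF sep f(1) h' L, of "9 / 8 * d / 15"] g(3) d by simp
    then have "op_close L (left_regular L h') T (9 / 8 * d / 15 + d / 8)"
      using f(2) op_close_commute by (intro op_close_trans[OF bo' bo(1) T]) auto
    then have "op_close L (left_regular L h') T ((1 / 2) ^ Suc n)"
      by (rule op_close_mono) (use d in \<open>simp add: d_def\<close>)
    moreover have "h' - h = g" by (auto simp: h'_def fun_eq_iff)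
    then have "Q n h h'" using g(2) by (simp add: Q_def d_def)
    ultimately show ?thesis using h' by (auto simp: P_def)
  qed
  ultimately obtain h where h: "\<And>n. P n (h n)" "\<And>n. Q n (h n) (h (Suc n))"
    using dependent_nat_choice[of P Q] by blast
  have hC: "h n \<in> Cc L0" for n using h(1)[of n] by (simp add: P_def)
  \<comment> \<open>The bounds in \<open>Q\<close> form a geometric series of ratio
    \<open>1 / 2\<close>; keeping the exact partial sum makes the induction on \<open>k\<close>
    close.\<close>
  have tel: "op_bound L' (kern L' (h (n + k) - h n)) (9 / 2 * ((1 / 2) ^ n - (1 / 2) ^ (n + k)))"
    if L': "L' \<in> transversal L0" for L' n k
  proof (induction k)
    case 0
    have "op_bound L' (kern L' (h n - h n)) 0" by (rule op_bound_self_diff)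
    moreover have "9 / 2 * ((1 / 2) ^ n - (1 / 2) ^ (n + 0)) = (0 :: real)" by simp
    ultimately show ?case by (simp only: add_0_right)
  next
    case (Suc k)
    have nn: "0 \<le> 9 / 4 * (1 / 2 :: real) ^ (n + k)" "0 \<le> 9 / 2 * ((1 / 2 :: real) ^ n - (1 / 2) ^ (n + k))"
      by (simp_all add: power_decreasing)
    have "op_bound L' (kern L' (h (Suc (n + k)) - h (n + k))) (9 / 4 * (1 / 2) ^ (n + k))"
      using h(2)[of "n + k"] L' by (simp only: Q_def)
    from op_bound_triangle[OF sep hC hC hC L' nn this Suc]
    have "op_bound L' (kern L' (h (Suc (n + k)) - h n))
        (9 / 4 * (1 / 2) ^ (n + k) + 9 / 2 * ((1 / 2) ^ n - (1 / 2) ^ (n + k)))" .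
    moreover have "9 / 4 * (1 / 2) ^ (n + k) + 9 / 2 * ((1 / 2) ^ n - (1 / 2) ^ (n + k)) =
        9 / 2 * ((1 / 2 :: real) ^ n - (1 / 2) ^ (n + Suc k))"
      by (simp add: algebra_simps)
    ultimately show ?case by (simp only: add_Suc_right)
  qed
  have le: "op_bound L' (kern L' (h m - h n)) (9 / 2 * (1 / 2) ^ N)"
    if L': "L' \<in> transversal L0" and mn: "m \<ge> N" "n \<ge> N" for L' m n N
  proof -
    have arith: "\<bar>9 / 2 * (a - b)\<bar> \<le> 9 / 2 * c" if "a \<le> c" "b \<le> a" "0 \<le> b" for a b c :: real
    proof -
      have "\<bar>a - b\<bar> \<le> c" using that by linarith
      then show ?thesis unfolding abs_mult by (intro mult_mono) auto
    qed
    have up: "op_bound L' (kern L' (h m - h n)) (9 / 2 * (1 / 2) ^ N)" if "n \<le> m" "N \<le> n" for m n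
    proof -
      define k where "k = m - n"
      have k: "m = n + k" using that(1) by (simp add: k_def)
      have "(1 / 2 :: real) ^ n \<le> (1 / 2) ^ N" using that(2) by (intro power_decreasing) auto
      moreover have "(1 / 2 :: real) ^ (n + k) \<le> (1 / 2) ^ n" by (intro power_decreasing) auto
      moreover have "0 \<le> (1 / 2 :: real) ^ (n + k)" by simp
      ultimately have "\<bar>9 / 2 * ((1 / 2 :: real) ^ n - (1 / 2) ^ (n + k))\<bar> \<le> 9 / 2 * (1 / 2) ^ N"
        by (rule arith)
      with tel[OF L', of n k] show ?thesis unfolding k by (rule op_bound_mono)
    qed
    show ?thesis
    \<comment> \<open>The case \<open>m < n\<close> follows by passing through
      \<open>op_close\<close>, which is symmetric in its two operators.\<close>
    proof (cases "n \<le> m")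
      case False
      then have "op_bound L' (kern L' (h n - h m)) (9 / 2 * (1 / 2) ^ N)" using up mn by simp
      then show ?thesis
        using left_regular_close_iff[OF sep hC hC L', of "9 / 2 * (1 / 2) ^ N" n m]
          left_regular_close_iff[OF sep hC hC L', of "9 / 2 * (1 / 2) ^ N" m n]
        by (simp add: op_close_commute[of L' "left_regular L' (h n)"])
    qed (use up mn in blast)
  qed
  have "h \<in> cauchy_seqs (Cc L0) (reduced_norm L0)"
    unfolding cauchy_seqs_def
  proof (intro CollectI conjI allI impI)
    show "range h \<subseteq> Cc L0" using hC by blast
    fix e :: real assume "e > 0"
    then obtain N where N: "(1 / 2) ^ N < e / (9 / 2)"
      using real_arch_pow_inv[of "e / (9 / 2)" "1 / 2"] by auto
    have "reduced_norm L0 (h m - h n) < e" if "m \<ge> N" "n \<ge> N" for m n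
    proof -
      have "reduced_norm L0 (h m - h n) \<le> 9 / 2 * (1 / 2) ^ N"
        using le that by (intro reduced_norm_le[OF sep Cc_diff[OF hC hC]]) auto
      then show ?thesis using N by simp
    qed
    then show "\<exists>M. \<forall>m\<ge>M. \<forall>n\<ge>M. reduced_norm L0 (h m - h n) < e" by blast
  qed
  moreover have "\<exists>N. \<forall>n\<ge>N. op_close L (left_regular L (h n)) T e" if e: "e > 0" for e
  proof -
    obtain N where N: "(1 / 2 :: real) ^ N < e" using real_arch_pow_inv[OF e, of "1 / 2"] by auto
    have "op_close L (left_regular L (h n)) T e" if "n \<ge> N" for n
    proof -
      have "(1 / 2 :: real) ^ n \<le> (1 / 2) ^ N" using that by (intro power_decreasing) auto
      then show ?thesis using h(1)[of n] N unfolding P_def by (meson less_imp_le op_close_mono order_trans)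
    qed
    then show ?thesis by blast
  qed
  ultimately have "T = left_regular_ext L (null_rel (Cc L0) (reduced_norm L0) `` {h})"
    and "null_rel (Cc L0) (reduced_norm L0) `` {h} \<in> reduced_cstar L0"
    using left_regular_ext_eq[OF sep L T] unfolding reduced_cstar_def completion_def
    by (auto intro: quotientI)
  then show ?thesis by blast
qed

text \<open>Boundedness of the dynamical matrices is included in (a), since the operator norm
  distances in (b) are suprema that are meaningful only for bounded operators. By (a), the limit in
  (b) is one of operators \<open>left_regular L f\<close> with \<open>f\<close> in
  \<open>Cc L0\<close>, to which \<open>norm_limit_in_image\<close> applies.\<close>

theorem mainTheorem2:
  fixes L0 :: "('d::finite) emap set"
  assumes "CARD('d) \<in> {1, 2, 3}"
    and "closedin isoE_top L0"
    and "uniformly_separated L0"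
  shows "(\<forall>w :: ('d, 'n::finite) coupling. admissible_coupling L0 w \<longrightarrow>
            coupling_fun L0 w \<in> Cc L0 \<and>
            (\<forall>L\<in>transversal L0.
               dynamical_matrix w L \<in> bounded_ops L \<and>
               dynamical_matrix w L = left_regular L (coupling_fun L0 w))) \<and>
         (\<forall>L\<in>transversal L0.
            \<forall>T :: ('d emap \<Rightarrow> complex ^ 'n) \<Rightarrow> ('d emap \<Rightarrow> complex ^ 'n).
            \<forall>ws :: nat \<Rightarrow> ('d, 'n) coupling.
              T \<in> bounded_ops L \<and>
              (\<forall>n. admissible_coupling L0 (ws n)) \<and>
              tends_in_op_norm L (\<lambda>n. dynamical_matrix (ws n) L) T \<longrightarrow>
              T \<in> left_regular_ext L ` reduced_cstar L0)"
proof (intro conjI allI impI ballI)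
  fix w :: "('d, 'n) coupling" assume w: "admissible_coupling L0 w"
  show c: "coupling_fun L0 w \<in> Cc L0" using w by (rule coupling_fun_Cc)
  fix L assume L: "L \<in> transversal L0"
  show eq: "dynamical_matrix w L = left_regular L (coupling_fun L0 w)"
    by (rule dynamical_matrix_eq_left_regular[OF assms(3) w L])
  show "dynamical_matrix w L \<in> bounded_ops L"
    unfolding eq by (rule left_regular_bounded_ops[OF assms(3) c L])
next
  fix L and T :: "('d emap \<Rightarrow> complex ^ 'n) \<Rightarrow> ('d emap \<Rightarrow> complex ^ 'n)"
    and ws :: "nat \<Rightarrow> ('d, 'n) coupling"
  assume L: "L \<in> transversal L0"
    and *: "T \<in> bounded_ops L \<and> (\<forall>n. admissible_coupling L0 (ws n)) \<and>
      tends_in_op_norm L (\<lambda>n. dynamical_matrix (ws n) L) T"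
  have w: "admissible_coupling L0 (ws n)" for n using * by blast
  have f: "coupling_fun L0 (ws n) \<in> Cc L0" for n using w by (rule coupling_fun_Cc)
  have T: "T \<in> bounded_ops L" using * by blast
  have "tends_in_op_norm L (\<lambda>n. left_regular L (coupling_fun L0 (ws n))) T"
    using * dynamical_matrix_eq_left_regular[OF assms(3) w L] by simp
  then have lim: "\<forall>e>0. \<exists>N. \<forall>n\<ge>N. op_close L (left_regular L (coupling_fun L0 (ws n))) T e"
    using tends_in_op_norm_iff[of "\<lambda>n. left_regular L (coupling_fun L0 (ws n))" L T,
        OF left_regular_bounded_ops[OF assms(3) f L] T] by simp
  show "T \<in> left_regular_ext L ` reduced_cstar L0"
  proof (rule norm_limit_in_image[OF assms(3) L T])
    fix e :: real assume "e > 0"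
    then show "\<exists>f\<in>Cc L0. op_close L (left_regular L f) T e" using lim f by blast
  qed
qed

end
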